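(* There exist absolute constants $C,c>0$ such that for all sufficiently large even $n\in\mathbb{N}$ and for all $\varepsilon\ge 0$, $$\mathbf{P}\left(s_n(M_n)\le \varepsilon n^{-1/2}\right)\le C\varepsilon+e^{-cn},$$ where $M_n$ is a uniformly random element of $\mathcal{M}^{\pm}_{n,n/2}$.
   Context: For even $n$, $\mathcal{M}^{\pm}_{n,n/2}$ denotes the set of all $n\times n$ matrices $Q$ with entries in $\{-1,0,1\}$ satisfying $\sum_{j=1}^n|Q(i,j)|=n/2$ for every $i\in[n]=\{1,\dots,n\}$. Equivalently, the rows of $M_n$ are independent and each is uniformly distributed over the vectors in $\{-1,0,1\}^n$ with exactly $n/2$ zero coordinates. For an $n\times n$ real matrix $A$, $s_n(A)=\inf_{x\in\mathbb{S}^{n-1}}\|Ax\|_2$ is the smallest singular value, where $\mathbb{S}^{n-1}$ is the unit Euclidean sphere of $\mathbb{R}^n$ and $\|\cdot\|_2$ the Euclidean norm. *)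

theory Defs
  imports
    "HOL-Probability.Probability"
    "Jordan_Normal_Form.Matrix"
begin

no_notation vec_nth (infixl "$" 90)

text \<open>The dimension \<open>n\<close> is quantified inside the theorem, so matrices and vectors are the
  explicitly dimensioned ones of Jordan\_Normal\_Form; indices run over \<open>0, ..., n - 1\<close>.\<close>

definition vec_norm2 :: "real vec \<Rightarrow> real" where
  "vec_norm2 v = L2_set (\<lambda>i. v $ i) {..<dim_vec v}"

definition unit_sphere_vec :: "nat \<Rightarrow> real vec set" where
  "unit_sphere_vec n = {x \<in> carrier_vec n. vec_norm2 x = 1}"

text \<open>The infimum is over a nonempty set, bounded below by 0, unless \<open>A\<close> has no columns.\<close>

definition least_singular_value :: "real mat \<Rightarrow> real" where
  "least_singular_value A = (INF x \<in> unit_sphere_vec (dim_col A). vec_norm2 (A *\<^sub>v x))"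

definition signed_row_regular :: "nat \<Rightarrow> nat \<Rightarrow> real mat set" where
  "signed_row_regular n d =
     {Q \<in> carrier_mat n n. (\<forall>i<n. \<forall>j<n. Q $$ (i, j) \<in> {-1, 0, 1}) \<and>
        (\<forall>i<n. (\<Sum>j<n. \<bar>Q $$ (i, j)\<bar>) = real d)}"

text \<open>Finiteness and nonemptiness are what make \<open>pmf_of_set\<close> on this set the uniform
  distribution.\<close>

lemma finite_signed_row_regular: "finite (signed_row_regular n d)"
proof -
  let ?F = "({..<n} \<times> {..<n}) \<rightarrow>\<^sub>E {-1, 0, 1 :: real}"
  have "signed_row_regular n d \<subseteq> (\<lambda>f. mat n n f) ` ?F"
  proof
    fix Q assume Q: "Q \<in> signed_row_regular n d"
    let ?f = "restrict (\<lambda>ij. Q $$ ij) ({..<n} \<times> {..<n})"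
    have "Q = mat n n ?f"
      using Q by (intro eq_matI) (auto simp: signed_row_regular_def)
    moreover have "?f \<in> ?F"
      using Q by (auto simp: signed_row_regular_def)
    ultimately show "Q \<in> (\<lambda>f. mat n n f) ` ?F" by blast
  qed
  moreover have "finite ?F" by (intro finite_PiE) auto
  ultimately show ?thesis by (meson finite_imageI finite_subset)
qed

lemma signed_row_regular_nonempty:
  assumes "d \<le> n"
  shows "signed_row_regular n d \<noteq> {}"
proof -
  let ?Q = "mat n n (\<lambda>(i, j). if j < d then 1 else 0 :: real)"
  have "(\<Sum>j<n. \<bar>?Q $$ (i, j)\<bar>) = real d" if "i < n" for i
  proof -
    have "(\<Sum>j<n. \<bar>?Q $$ (i, j)\<bar>) = (\<Sum>j<n. if j \<in> {..<d} then 1 else 0)"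
      using that by (intro sum.cong) auto
    also have "\<dots> = (\<Sum>j\<in>{..<n} \<inter> {..<d}. 1)" by (rule sum.inter_restrict[symmetric]) simp
    also have "{..<n} \<inter> {..<d} = {..<d}" using assms by auto
    finally show ?thesis by simp
  qed
  then have "?Q \<in> signed_row_regular n d" by (auto simp: signed_row_regular_def)
  then show ?thesis by blast
qed

end

theory Submission
  imports Defs "Jordan_Normal_Form.Determinant"
begin

text \<open>The characteristic function of \<open>\<langle>R, x\<rangle>\<close> for a random row \<open>R\<close> is a normalized elementary symmetric
  polynomial in the numbers \<open>cos (x j)\<close>. Maclaurin's inequality bounds it by
  \<open>exp (- dist(x / \<pi>, \<int>\<^sup>n)\<^sup>2)\<close>, exactly as for a vector of independent signs, and this is the only
  small ball information about the model that is needed.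

  The rest is the argument of Rudelson and Vershynin. Let \<open>x\<close> be a unit normal to all rows but one and
  suppose that \<open>\<theta> x\<close> is close to an integer point \<open>p\<close> for some \<open>\<theta>\<close> below an exponential bound. If
  \<open>\<theta>\<close> is at most a small multiple of \<open>\<surd>n\<close>, there are few points \<open>p\<close>, and each of them is nearly
  orthogonal to the rows with exponentially small probability. If \<open>\<theta>\<close> is larger, the small ball
  probability of the vectors near \<open>p / \<theta>\<close> beats the number of points \<open>p\<close>. Hence the normal has no such
  \<open>\<theta>\<close>, and its inner product with the remaining row is at most \<open>t\<close> with probability at most
  \<open>C t + exp (- c n)\<close>.

  If the least singular value is small, then \<open>A\<^sup>T y\<close> is small for some unit vector \<open>y\<close>. The mass of
  \<open>y\<close> is spread out, since otherwise \<open>y\<close> would be close to a multiple of an integer point of norm at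
  most a small multiple of \<open>\<surd>n\<close>. Therefore a positive proportion of the rows have small inner product
  with the normal to the other rows, and Markov's inequality concludes.\<close>

section \<open>Elementary symmetric polynomials and the law of a row\<close>

text \<open>A row has a prescribed number of nonzero entries, so its coordinates are dependent and
  its characteristic function does not factor; Maclaurin's inequality restores the bound that
  independence would give. The columns are dependent too, which is why distances are measured from a
  row to the other rows and smallness of \<open>A x\<close> is first transferred to the transpose.

  The two ranges of \<theta> rest on different counts. An integer point has l1 norm at most its
  squared l2 norm, so below a small multiple of \<surd>n there are at most exp(n / 100) candidates,
  against a probability of about exp(- n / 50) for each. At a larger scale T there are about (C T /
  \<surd>n)^n candidates, each determining the normal up to an error of order
  \<open>lcd_const\<close> \<surd>n / T. The small ball estimate for n - 1 rows then cancels all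
  powers of T but one, and the smallness of \<open>lcd_const\<close> wins. The range ends at
  exp(\<open>lcd_const\<close>^2 n / 2), where 1 / T still dominates the additive error exp(-
  \<open>lcd_const\<close>^2 n) of the small ball estimate.\<close>

definition signed_rows :: "nat \<Rightarrow> nat \<Rightarrow> (nat \<Rightarrow> real) set" where
  "signed_rows n m = {r \<in> {..<n} \<rightarrow>\<^sub>E {-1, 0, 1}. (\<Sum>j<n. \<bar>r j\<bar>) = real m}"

lemma finite_rows [simp]: "finite (signed_rows n m)"
proof -
  have "finite ({..<n} \<rightarrow>\<^sub>E {-1, 0, 1 :: real})" by (intro finite_PiE) auto
  then show ?thesis unfolding signed_rows_def by (rule rev_finite_subset) auto
qed

lemma signed_rows_0: "signed_rows n 0 = {\<lambda>j\<in>{..<n}. 0}"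
proof -
  have "r = (\<lambda>j\<in>{..<n}. 0)" if "r \<in> {..<n} \<rightarrow>\<^sub>E {-1, 0, 1}" "(\<Sum>j<n. \<bar>r j\<bar>) = 0" for r :: "nat \<Rightarrow> real"
  proof -
    have "r j = 0" if "j < n" for j
      using \<open>(\<Sum>j<n. \<bar>r j\<bar>) = 0\<close> that by (simp add: sum_nonneg_eq_0_iff)
    with that(1) show ?thesis by (auto simp: fun_eq_iff PiE_def extensional_def)
  qed
  moreover have "(\<lambda>j\<in>{..<n}. 0) \<in> signed_rows n 0" by (simp add: signed_rows_def)
  ultimately show ?thesis unfolding signed_rows_def by (simp only: of_nat_0) blast
qed

lemma signed_rows_Suc_empty: "signed_rows 0 (Suc m) = {}"
  by (auto simp: signed_rows_def)

text \<open>Split by the last entry: a zero leaves all nonzero entries to the first \<open>n\<close>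
  places, a sign uses up one of them. This is the recursion that defines
  \<open>esym\<close>.\<close>

lemma signed_rows_Suc_Suc:
  "signed_rows (Suc n) (Suc m) =
    (\<lambda>r. r(n := 0)) ` signed_rows n (Suc m) \<union> ((\<lambda>r. r(n := 1)) ` signed_rows n m \<union> (\<lambda>r. r(n := -1)) ` signed_rows n m)"
  (is "?L = ?R")
proof
  show "?L \<subseteq> ?R"
  proof
    fix r assume r: "r \<in> ?L"
    let ?r = "restrict r {..<n}"
    have rj: "r j \<in> {-1, 0, 1}" if "j < Suc n" for j
      using r that unfolding signed_rows_def by (blast dest: PiE_mem)
    have r1: "?r \<in> {..<n} \<rightarrow>\<^sub>E {-1, 0, 1}" by (intro restrict_PiE_iff[THEN iffD2] ballI rj) simp
    have ext: "r = ?r(n := r n)"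
    proof
      fix j show "r j = (?r(n := r n)) j"
        using r by (cases "j < Suc n") (simp_all add: signed_rows_def PiE_def extensional_def)
    qed
    have s: "(\<Sum>j<n. \<bar>?r j\<bar>) + \<bar>r n\<bar> = 1 + real m"
      using r by (simp add: signed_rows_def)
    have "r n \<in> {-1, 0, 1}" by (rule rj) simp
    then consider "r n = 0" | "r n = 1" | "r n = -1" by auto
    then show "r \<in> ?R"
    proof cases
      case 1
      then have "?r \<in> signed_rows n (Suc m)" using r1 s by (simp add: signed_rows_def)
      then show ?thesis using ext 1 by (metis UnI1 imageI)
    next
      case 2
      then have "?r \<in> signed_rows n m" using r1 s by (simp add: signed_rows_def)
      then show ?thesis using ext 2 by (metis UnI1 UnI2 imageI)
    next
      case 3
      then have "?r \<in> signed_rows n m" using r1 s by (simp add: signed_rows_def)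
      then show ?thesis using ext 3 by (metis UnI2 imageI)
    qed
  qed
  have "r(n := a) \<in> ?L"
    if "r \<in> signed_rows n k" "a \<in> {-1, 0, 1}" "real k + \<bar>a\<bar> = 1 + real m" for r a k
  proof -
    have "(\<Sum>j<n. \<bar>(r(n := a)) j\<bar>) = (\<Sum>j<n. \<bar>r j\<bar>)" by (intro sum.cong) auto
    moreover have "r(n := a) \<in> {..<Suc n} \<rightarrow>\<^sub>E {-1, 0, 1}"
      using PiE_fun_upd[of a "\<lambda>_. {-1, 0, 1}" n r "{..<n}"] that
      by (simp add: signed_rows_def lessThan_Suc)
    ultimately show ?thesis using that by (simp add: signed_rows_def)
  qed
  then show "?R \<subseteq> ?L" by auto
qed

lemma inj_on_upd_rows: "inj_on (\<lambda>r. r(n := a)) (signed_rows n m)"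
proof (rule inj_onI)
  fix r s assume r: "r \<in> signed_rows n m" "s \<in> signed_rows n m" "r(n := a) = s(n := a)"
  show "r = s"
  proof
    fix j
    show "r j = s j"
    proof (cases "j = n")
      case True
      with r(1,2) show ?thesis by (auto simp: signed_rows_def PiE_def extensional_def)
    next
      case False
      with r(3) show ?thesis by (metis fun_upd_other)
    qed
  qed
qed

lemma sum_rows_Suc_Suc:
  "(\<Sum>r\<in>signed_rows (Suc n) (Suc m). F r) =
    (\<Sum>r\<in>signed_rows n (Suc m). F (r(n := 0))) + (\<Sum>r\<in>signed_rows n m. F (r(n := 1)) + F (r(n := -1)))"
  for F :: "(nat \<Rightarrow> real) \<Rightarrow> 'a::comm_monoid_add"
proof -
  have disj: "(\<lambda>r. r(n := a)) ` A \<inter> (\<lambda>r. r(n := b)) ` B = {}"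
    if "a \<noteq> b" for a b :: real and A B :: "(nat \<Rightarrow> real) set"
  proof -
    have val: "f n = c" if "f \<in> (\<lambda>r. r(n := c)) ` C" for f c and C :: "(nat \<Rightarrow> real) set"
      using that by (elim imageE) simp
    show ?thesis
    proof (rule equals0I)
      fix f assume "f \<in> (\<lambda>r. r(n := a)) ` A \<inter> (\<lambda>r. r(n := b)) ` B"
      then have "f \<in> (\<lambda>r. r(n := a)) ` A" "f \<in> (\<lambda>r. r(n := b)) ` B" by blast+
      then have "f n = a" "f n = b" using val[of f a A] val[of f b B] by blast+
      with \<open>a \<noteq> b\<close> show False by simp
    qed
  qed
  have reindex: "(\<Sum>r\<in>(\<lambda>r. r(n := a)) ` signed_rows n k. F r) = (\<Sum>r\<in>signed_rows n k. F (r(n := a)))" for a k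
    by (subst sum.reindex[OF inj_on_upd_rows]) (simp add: o_def)
  have d1: "(\<lambda>r. r(n := 0)) ` signed_rows n (Suc m) \<inter>
      ((\<lambda>r. r(n := 1)) ` signed_rows n m \<union> (\<lambda>r. r(n := -1)) ` signed_rows n m) = {}"
    unfolding Int_Un_distrib by (subst disj, simp)+ simp
  have d2: "(\<lambda>r. r(n := 1)) ` signed_rows n m \<inter> (\<lambda>r. r(n := -1)) ` signed_rows n m = {}"
    by (rule disj) simp
  show ?thesis
    by (simp only: signed_rows_Suc_Suc sum.union_disjoint[OF _ _ d1] sum.union_disjoint[OF _ _ d2]
        finite_imageI finite_UnI finite_rows reindex sum.distrib)
qed

text \<open>This is \<open>2\<^sup>m\<close> times the elementary symmetric polynomial of degree \<open>m\<close> in \<open>f 0, ..., f (n - 1)\<close>;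
  the power of two counts the signs of the nonzero entries of a row.\<close>

fun esym :: "(nat \<Rightarrow> real) \<Rightarrow> nat \<Rightarrow> nat \<Rightarrow> real" where
  "esym f n 0 = 1"
| "esym f 0 (Suc m) = 0"
| "esym f (Suc n) (Suc m) = esym f n (Suc m) + 2 * f n * esym f n m"

text \<open>Every row average below is an instance: \<open>h = 1\<close> counts the rows,
  \<open>h = cis\<close> gives cosines and \<open>h = exp\<close> gives hyperbolic cosines. The type
  is general because the first two kinds of average are real and complex respectively.\<close>

lemma sum_rows_prod:
  fixes h :: "nat \<Rightarrow> real \<Rightarrow> 'a::real_normed_field"
  assumes h0: "\<And>j. h j 0 = 1" and h1: "\<And>j. h j 1 + h j (-1) = of_real (2 * f j)"
  shows "(\<Sum>r\<in>signed_rows n m. \<Prod>j<n. h j (r j)) = of_real (esym f n m)"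
proof (induction n arbitrary: m)
  case 0
  show ?case by (cases m) (simp_all add: signed_rows_0 signed_rows_Suc_empty)
next
  case (Suc n)
  have eq: "(\<Prod>j<n. h j ((r(n := a)) j)) = (\<Prod>j<n. h j (r j))" for r a
    by (intro prod.cong) auto
  show ?case
  proof (cases m)
    case 0
    then show ?thesis by (simp add: signed_rows_0 h0)
  next
    case (Suc k)
    show ?thesis
      unfolding Suc
      apply (simp only: sum_rows_Suc_Suc prod.lessThan_Suc eq fun_upd_same h0 mult_1_right)
      apply (simp only: distrib_left[symmetric] h1 sum_distrib_right[symmetric] Suc.IH)
      by (simp add: mult.commute)
  qed
qed

text \<open>Convexity: the graph of the power \<open>Suc m\<close> lies above its tangent at
  \<open>u\<close>. The induction step discards a nonnegative multiple of
  \<open>(u - v) ^ 2\<close>.\<close>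

lemma power_tangent_le:
  fixes u v :: real
  assumes "u \<ge> 0" "v \<ge> 0"
  shows "real (Suc m) * u ^ m * v \<le> v ^ Suc m + real m * u ^ Suc m"
proof (induction m)
  case (Suc m)
  have "real (Suc (Suc m)) * u ^ Suc m * v
      = (real (Suc m) * u ^ m * v) * v - real m * u ^ Suc m * v + real (Suc m) * u ^ Suc (Suc m)
        - real (Suc m) * u ^ m * (u - v) ^ 2"
    by (simp add: algebra_simps power2_eq_square)
  also have "\<dots> \<le> (v ^ Suc m + real m * u ^ Suc m) * v - real m * u ^ Suc m * v
      + real (Suc m) * u ^ Suc (Suc m) - 0"
    using assms by (intro diff_mono add_mono mult_right_mono Suc) auto
  finally show ?case by (simp add: algebra_simps)
qed (use assms in simp)

lemma esym_one: "esym (\<lambda>_. 1) n m = 2 ^ m * real (n choose m)"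
proof (induction n arbitrary: m)
  case 0 show ?case by (cases m) auto
next
  case (Suc n) then show ?case by (cases m) (auto simp: algebra_simps)
qed

lemma esym_one_nonneg: "esym (\<lambda>_. 1) n m \<ge> 0"
  by (simp add: esym_one)

lemma card_rows: "real (card (signed_rows n m)) = esym (\<lambda>_. 1) n m"
  using sum_rows_prod[of "\<lambda>_ _. 1 :: real" "\<lambda>_. 1" n m] by simp

lemma abs_esym_le: "\<bar>esym f n m\<bar> \<le> esym (\<lambda>j. \<bar>f j\<bar>) n m"
proof (induction n arbitrary: m)
  case 0 show ?case by (cases m) auto
next
  case (Suc n)
  show ?case
  proof (cases m)
    case (Suc k)
    have "\<bar>esym f n (Suc k) + 2 * f n * esym f n k\<bar> \<le> \<bar>esym f n (Suc k)\<bar> + 2 * \<bar>f n\<bar> * \<bar>esym f n k\<bar>"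
      by (rule order_trans[OF abs_triangle_ineq]) (simp add: abs_mult)
    also have "\<dots> \<le> esym (\<lambda>j. \<bar>f j\<bar>) n (Suc k) + 2 * \<bar>f n\<bar> * esym (\<lambda>j. \<bar>f j\<bar>) n k"
      by (intro add_mono mult_left_mono Suc.IH) auto
    finally show ?thesis by (simp add: Suc)
  qed simp
qed

text \<open>With all variables at least 1, each monomial is at most the product of all of them, and
  \<open>esym (\<lambda>_. 1)\<close> counts the monomials with their signs.\<close>

lemma esym_le_prod:
  assumes "\<And>j. f j \<ge> 1"
  shows "esym f n m \<le> (\<Prod>j<n. f j) * esym (\<lambda>_. 1) n m"
proof (induction n arbitrary: m)
  case 0 show ?case by (cases m) auto
next
  case (Suc n)
  have f0: "f j \<ge> 0" for j using assms[of j] by linarith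
  have p1: "(\<Prod>j<n. f j) \<ge> 0" "1 * (\<Prod>j<n. f j) \<le> f n * (\<Prod>j<n. f j)"
    by (rule prod_nonneg, rule f0) (intro mult_right_mono assms prod_nonneg f0)
  have one: "1 \<le> (\<Prod>j<Suc n. f j)" by (intro prod_ge_1 assms)
  show ?case
  proof (cases m)
    case 0 then show ?thesis using one by simp
  next
    case (Suc k)
    let ?P = "\<Prod>j<n. f j" and ?e = "esym (\<lambda>_. 1)"
    have "esym f n (Suc k) + 2 * f n * esym f n k \<le> ?P * ?e n (Suc k) + 2 * f n * (?P * ?e n k)"
      by (intro add_mono mult_left_mono Suc.IH) (use f0 in auto)
    also have "\<dots> \<le> (f n * ?P) * ?e n (Suc k) + 2 * f n * (?P * ?e n k)"
      using p1 by (intro add_right_mono mult_right_mono esym_one_nonneg) simp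
    finally show ?thesis by (simp add: Suc algebra_simps)
  qed
qed

text \<open>Maclaurin's inequality; the induction step is the tangent line inequality at the mean.\<close>

lemma esym_le_mean_power:
  assumes f: "\<And>j. f j \<ge> 0" and n: "n > 0"
  shows "esym f n m \<le> esym (\<lambda>_. 1) n m * ((\<Sum>j<n. f j) / real n) ^ m"
  using n
proof (induction n arbitrary: m rule: nat_induct_non_zero)
  case 1
  have 0: "esym g 0 k = (if k = 0 then 1 else 0)" for g k by (cases k) auto
  have 1: "esym f (Suc 0) m \<le> esym (\<lambda>_. 1) (Suc 0) m * ((\<Sum>j<Suc 0. f j) / real (Suc 0)) ^ m"
    by (cases m) (auto simp: 0)
  then show ?case by simp
next
  case (Suc n)
  show ?case
  proof (cases m)
    case 0 then show ?thesis by simp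
  next
    case m: (Suc k)
    define u where "u = (\<Sum>j<n. f j) / real n"
    define v where "v = (\<Sum>j<Suc n. f j) / real (Suc n)"
    define N where "N = esym (\<lambda>_. 1) (Suc n) (Suc k)"
    have u: "u \<ge> 0" and v: "v \<ge> 0" unfolding u_def v_def by (intro divide_nonneg_nonneg sum_nonneg f; simp)+
    have y: "f n = real (Suc n) * v - real n * u"
      using Suc by (simp add: u_def v_def)
    have a: "esym (\<lambda>_. 1) n k * (2 * real (Suc n)) = N * real (Suc k)"
    proof -
      have "real (Suc n) * real (n choose k) = real (Suc n choose Suc k) * real (Suc k)"
        using Suc_times_binomial_eq[of n k] by (metis of_nat_mult)
      then have "2 ^ Suc k * (real (Suc n) * real (n choose k)) = 2 ^ Suc k * (real (Suc n choose Suc k) * real (Suc k))"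
        by (rule arg_cong)
      then show ?thesis by (simp only: N_def esym_one power_Suc mult_ac)
    qed
    then have b: "2 * esym (\<lambda>_. 1) n k = N * real (Suc k) / real (Suc n)"
      by (simp add: field_simps)
    have c: "esym (\<lambda>_. 1) n (Suc k) = N - 2 * esym (\<lambda>_. 1) n k"
      by (simp add: N_def)
    have "esym f (Suc n) (Suc k) = esym f n (Suc k) + 2 * f n * esym f n k" by simp
    also have "\<dots> \<le> esym (\<lambda>_. 1) n (Suc k) * u ^ Suc k + 2 * f n * (esym (\<lambda>_. 1) n k * u ^ k)"
      unfolding u_def by (intro add_mono mult_left_mono Suc.IH) (use f in auto)
    also have "\<dots> = N * u ^ Suc k + (2 * esym (\<lambda>_. 1) n k) * (u ^ k * (f n - u))"
      unfolding c by (simp add: algebra_simps)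
    \<comment> \<open>By \<open>y\<close>, \<open>f n - u\<close> is \<open>n + 1\<close> times the
      change \<open>v - u\<close> of the mean, and this factor cancels the denominator in
      \<open>b\<close>. What remains is the tangent at the old mean evaluated at the new
      one.\<close>
    also have "\<dots> = N * (u ^ Suc k + real (Suc k) * u ^ k * (v - u))"
      unfolding b y by (simp add: field_simps)
    also have "\<dots> \<le> N * v ^ Suc k"
      using power_tangent_le[OF u v, of k] esym_one_nonneg[of "Suc n" "Suc k"]
      by (intro mult_left_mono) (auto simp: N_def algebra_simps)
    finally show ?thesis by (simp add: m N_def v_def mult.commute)
  qed
qed

lemma esym_le_exp:
  assumes f: "\<And>j. f j \<ge> 0" and n: "n > 0"
  shows "esym f n m \<le> esym (\<lambda>_. 1) n m * exp (- (real m / real n) * (\<Sum>j<n. 1 - f j))"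
proof -
  have "(\<Sum>j<n. f j) / real n = 1 - (\<Sum>j<n. 1 - f j) / real n"
    using n by (simp add: sum_subtractf field_simps)
  also have "\<dots> \<le> exp (- ((\<Sum>j<n. 1 - f j) / real n))"
    using exp_ge_add_one_self[of "- ((\<Sum>j<n. 1 - f j) / real n)"] by simp
  finally have "((\<Sum>j<n. f j) / real n) ^ m \<le> exp (- ((\<Sum>j<n. 1 - f j) / real n)) ^ m"
    by (intro power_mono divide_nonneg_nonneg sum_nonneg f) auto
  also have "\<dots> = exp (- (real m / real n) * (\<Sum>j<n. 1 - f j))"
    by (simp add: exp_of_nat_mult[symmetric])
  finally show ?thesis
    using esym_le_mean_power[OF f n] esym_one_nonneg by (meson mult_left_mono order_trans)
qed

section \<open>Characteristic and moment generating functions of a row\<close>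

definition int_dist :: "real \<Rightarrow> real" where
  "int_dist u = \<bar>u - of_int (round u)\<bar>"

lemma int_dist_le_half: "int_dist u \<le> 1 / 2"
  using of_int_round_abs_le[of u] by (simp add: int_dist_def abs_minus_commute)

lemma int_dist_small: "\<bar>u\<bar> < 1 / 2 \<Longrightarrow> int_dist u = \<bar>u\<bar>"
  using round_unique'[of u 0] by (simp add: int_dist_def)

text \<open>Subtracting the nearest multiple of \<pi> leaves an angle \<pi> d with \<bar>d\<bar>
  \<le> 1/2. The half-angle formula then reduces the claim to \<bar>sin (\<pi> d / 2)\<bar> \<ge>
  \<bar>d\<bar>.\<close>

lemma abs_cos_le_int_dist: "\<bar>cos b\<bar> \<le> 1 - 2 * int_dist (b / pi) ^ 2"
proof -
  define k where "k = round (b / pi)"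
  define d where "d = b / pi - of_int k"
  have d: "int_dist (b / pi) = \<bar>d\<bar>" "\<bar>d\<bar> \<le> 1 / 2"
    using int_dist_le_half[of "b / pi"] by (auto simp: int_dist_def d_def k_def)
  have b: "b = pi * of_int k + pi * d" by (simp add: d_def field_simps)
  have "\<bar>cos b\<bar> = \<bar>cos (pi * d)\<bar>"
    unfolding b cos_add by (auto simp: abs_mult)
  also have "\<bar>pi * d\<bar> \<le> pi / 2" using d(2) by (simp add: abs_mult)
  then have "\<bar>cos (pi * d)\<bar> = cos (pi * d)" by (intro abs_of_nonneg cos_ge_zero) linarith+
  also have "\<dots> = 1 - 2 * sin (pi * d / 2) ^ 2"
    using cos_double_sin[of "pi * d / 2"] by simp
  \<comment> \<open>The cubic Taylor bound gives \<bar>sin x\<bar> \<ge> 0.8 \<bar>x\<bar> for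
    \<bar>x\<bar> \<le> 0.8, and \<bar>x\<bar> \<ge> 3/2 \<bar>d\<bar>; the product of the two
    constants exceeds 1.\<close>
  also have "\<bar>d\<bar> \<le> \<bar>sin (pi * d / 2)\<bar>"
  proof -
    define x where "x = pi * d / 2"
    have "pi * \<bar>d\<bar> \<le> 3.2 * (1/2)"
      by (intro mult_mono) (use d(2) pi_approx in auto)
    then have x: "\<bar>x\<bar> \<le> 0.8" by (simp add: x_def abs_mult)
    have "\<bar>sin x - x\<bar> \<le> \<bar>x\<bar> ^ 3 / 6"
      using Maclaurin_sin_bound[of x 3] by (simp add: eval_nat_numeral sin_coeff_def field_simps)
    moreover have "\<bar>x\<bar> ^ 3 / 6 \<le> 0.2 * \<bar>x\<bar>"
    proof -
      have "\<bar>x\<bar> * \<bar>x\<bar> \<le> 0.8 * 0.8" using x by (intro mult_mono) auto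
      then have "\<bar>x\<bar> * (\<bar>x\<bar> * \<bar>x\<bar>) \<le> \<bar>x\<bar> * 0.64" by (intro mult_left_mono) auto
      then show ?thesis by (simp add: eval_nat_numeral)
    qed
    ultimately have "0.8 * \<bar>x\<bar> \<le> \<bar>sin x\<bar>" by linarith
    moreover have "\<bar>d\<bar> * 3 / 2 \<le> \<bar>x\<bar>"
    proof -
      have "3 * \<bar>d\<bar> \<le> pi * \<bar>d\<bar>" by (intro mult_right_mono) (use pi_approx in auto)
      then show ?thesis by (simp add: x_def abs_mult)
    qed
    ultimately show ?thesis unfolding x_def by linarith
  qed
  then have "1 - 2 * sin (pi * d / 2) ^ 2 \<le> 1 - 2 * \<bar>d\<bar> ^ 2"
    by (simp add: abs_le_square_iff)
  finally show ?thesis by (simp add: d)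
qed

definition half_rows :: "nat \<Rightarrow> (nat \<Rightarrow> real) set" where
  "half_rows n = signed_rows n (n div 2)"

lemma finite_half_rows [simp]: "finite (half_rows n)"
  by (simp add: half_rows_def)

lemma card_half_rows: "real (card (half_rows n)) = esym (\<lambda>_. 1) n (n div 2)"
  by (simp add: half_rows_def card_rows)

lemma card_half_rows_pos: "card (half_rows n) > 0"
proof -
  have "real (card (half_rows n)) > 0" unfolding card_half_rows esym_one by simp
  then show ?thesis by simp
qed

lemma cis_sum: "finite A \<Longrightarrow> cis (\<Sum>i\<in>A. f i) = (\<Prod>i\<in>A. cis (f i))"
  by (induction rule: finite_induct) (auto simp: cis_mult[symmetric])

text \<open>The complex form is kept because \<open>cis\<close> turns sums over rows into products,
  which the estimate for the transposed matrix needs. The two signs of each entry cancel the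
  imaginary parts.\<close>

lemma sum_half_rows_cis:
  "(\<Sum>r\<in>half_rows n. cis (\<Sum>j<n. r j * b j)) = of_real (esym (\<lambda>j. cos (b j)) n (n div 2))"
  unfolding half_rows_def
  using sum_rows_prod[where h = "\<lambda>j s. cis (s * b j)" and f = "\<lambda>j. cos (b j)" and n = n and m = "n div 2"]
  by (simp add: cis_sum complex_eq_iff)

lemma sum_half_rows_cos:
  "(\<Sum>r\<in>half_rows n. cos (\<Sum>j<n. r j * b j)) = esym (\<lambda>j. cos (b j)) n (n div 2)"
  using arg_cong[OF sum_half_rows_cis[where n = n and b = b], of Re] by simp

text \<open>Taking absolute values first makes the variables nonnegative, as Maclaurin's inequality
  requires. The density 1/2 of nonzero entries cancels the factor 2 of
  \<open>abs_cos_le_int_dist\<close>.\<close>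

lemma abs_esym_cos_le:
  assumes "even n" "n > 0"
  shows "\<bar>esym (\<lambda>j. cos (b j)) n (n div 2)\<bar> \<le>
    real (card (half_rows n)) * exp (- (\<Sum>j<n. int_dist (b j / pi) ^ 2))"
proof -
  have h: "real (n div 2) / real n = 1 / 2"
    using assms by (simp add: real_of_nat_div)
  have "\<bar>esym (\<lambda>j. cos (b j)) n (n div 2)\<bar> \<le> esym (\<lambda>j. \<bar>cos (b j)\<bar>) n (n div 2)"
    by (rule abs_esym_le)
  also have "\<dots> \<le> real (card (half_rows n)) * exp (- (1 / 2) * (\<Sum>j<n. 1 - \<bar>cos (b j)\<bar>))"
    using esym_le_exp[of "\<lambda>j. \<bar>cos (b j)\<bar>" n "n div 2"] assms by (simp add: card_half_rows h)
  also have "\<dots> \<le> real (card (half_rows n)) * exp (- (\<Sum>j<n. int_dist (b j / pi) ^ 2))"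
  proof -
    have "(\<Sum>j<n. 2 * int_dist (b j / pi) ^ 2) \<le> (\<Sum>j<n. 1 - \<bar>cos (b j)\<bar>)"
      using abs_cos_le_int_dist by (intro sum_mono) (simp add: algebra_simps)
    then show ?thesis by (intro mult_left_mono) (simp_all add: sum_distrib_left[symmetric])
  qed
  finally show ?thesis .
qed

text \<open>Compare the power series term by term, using (2k)! \<ge> 2^k k!.\<close>

lemma cosh_le_exp_square: "cosh b \<le> exp (b\<^sup>2 / 2)" for b :: real
proof -
  have fact_le: "2 ^ k * fact k \<le> (fact (2 * k) :: real)" for k
  proof (induction k)
    case (Suc k)
    have "2 ^ Suc k * fact (Suc k) = (2 * real (Suc k)) * (2 ^ k * fact k)" by simp
    also have "\<dots> \<le> (real (2 * k + 2) * real (2 * k + 1)) * fact (2 * k)"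
      by (intro mult_mono Suc) auto
    also have "\<dots> = fact (2 * Suc k)" by (simp add: algebra_simps)
    finally show ?case .
  qed simp
  have 1: "(\<lambda>n. if even n then b ^ n /\<^sub>R fact n else 0) sums cosh b" by (rule cosh_converges)
  have "(\<lambda>k. (if even (2 * k) then b ^ (2 * k) /\<^sub>R fact (2 * k) else 0)) sums cosh b"
    using 1 by (subst sums_mono_reindex[where g = "\<lambda>k. 2 * k" and f = "\<lambda>n. if even n then b ^ n /\<^sub>R fact n else 0"])
      (auto simp: strict_mono_def dvd_def image_def)
  then have 1: "(\<lambda>k. b ^ (2 * k) / fact (2 * k)) sums cosh b" by (simp add: field_simps)
  have 2: "(\<lambda>k. (b\<^sup>2 / 2) ^ k / fact k) sums exp (b\<^sup>2 / 2)"
    using exp_converges[of "b\<^sup>2 / 2"] by (simp add: field_simps)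
  show ?thesis
  proof (rule sums_le[OF _ 1 2])
    fix k
    have "b ^ (2 * k) / fact (2 * k) \<le> b ^ (2 * k) / (2 ^ k * fact k)"
      by (intro divide_left_mono fact_le) (auto simp: power_mult)
    then show "b ^ (2 * k) / fact (2 * k) \<le> (b\<^sup>2 / 2) ^ k / fact k"
      by (simp add: power_mult power_divide)
  qed
qed

text \<open>By \<open>esym_le_prod\<close> for hyperbolic cosines, the dependent entries are
  sub-Gaussian with the same constant as independent signs.\<close>

lemma sum_half_rows_exp_le:
  "(\<Sum>r\<in>half_rows n. exp (\<Sum>j<n. r j * b j)) \<le> real (card (half_rows n)) * exp ((\<Sum>j<n. (b j)\<^sup>2) / 2)"
proof -
  have "(\<Sum>r\<in>half_rows n. exp (\<Sum>j<n. r j * b j)) = esym (\<lambda>j. cosh (b j)) n (n div 2)"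
    unfolding half_rows_def
    using sum_rows_prod[of "\<lambda>j s. exp (s * b j)" "\<lambda>j. cosh (b j)" n "n div 2"]
    by (simp add: exp_sum cosh_def)
  also have "\<dots> \<le> (\<Prod>j<n. cosh (b j)) * real (card (half_rows n))"
    unfolding card_half_rows by (rule esym_le_prod) (rule cosh_real_ge_1)
  also have "\<dots> \<le> (\<Prod>j<n. exp ((b j)\<^sup>2 / 2)) * real (card (half_rows n))"
    by (intro mult_right_mono prod_mono conjI cosh_le_exp_square cosh_real_nonneg) auto
  finally show ?thesis by (simp add: exp_sum sum_divide_distrib mult.commute)
qed

section \<open>Matrices with independent rows\<close>

abbreviation nrm :: "nat \<Rightarrow> (nat \<Rightarrow> real) \<Rightarrow> real" where
  "nrm n x \<equiv> L2_set x {..<n}"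

abbreviation ip :: "nat \<Rightarrow> (nat \<Rightarrow> real) \<Rightarrow> (nat \<Rightarrow> real) \<Rightarrow> real" where
  "ip n x y \<equiv> (\<Sum>j<n. x j * y j)"

definition tmul :: "nat \<Rightarrow> (nat \<Rightarrow> nat \<Rightarrow> real) \<Rightarrow> (nat \<Rightarrow> real) \<Rightarrow> nat \<Rightarrow> real" where
  "tmul n A y j = (\<Sum>i<n. y i * A i j)"

lemma L2_set_square: "(L2_set x A)\<^sup>2 = (\<Sum>i\<in>A. (x i)\<^sup>2)"
  by (simp add: L2_set_def sum_nonneg)

lemma abs_ip_le: "\<bar>ip n x y\<bar> \<le> nrm n x * nrm n y"
proof -
  have "\<bar>ip n x y\<bar> \<le> (\<Sum>j<n. \<bar>x j\<bar> * \<bar>y j\<bar>)"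
    by (rule order_trans[OF sum_abs]) (simp add: abs_mult)
  then show ?thesis using L2_set_mult_ineq order_trans by blast
qed

lemma sum_abs_le_nrm: "(\<Sum>j<n. \<bar>x j\<bar>) \<le> sqrt (real n) * nrm n x"
  using L2_set_mult_ineq[of "\<lambda>_. 1" x "{..<n}"] by (simp add: L2_set_def)

lemma nrm_le_bound: "(\<And>j. j < n \<Longrightarrow> \<bar>x j\<bar> \<le> c) \<Longrightarrow> c \<ge> 0 \<Longrightarrow> nrm n x \<le> sqrt (real n) * c"
proof -
  assume a: "\<And>j. j < n \<Longrightarrow> \<bar>x j\<bar> \<le> c" "c \<ge> 0"
  have "(\<Sum>j<n. (x j)\<^sup>2) \<le> (\<Sum>j<n. c\<^sup>2)"
    using a by (intro sum_mono) (simp add: abs_le_square_iff[symmetric])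
  then have "nrm n x \<le> sqrt (real n * c\<^sup>2)" by (simp add: L2_set_def)
  then show ?thesis using a by (simp add: real_sqrt_mult)
qed

lemma L2_set_mult_left: "L2_set (\<lambda>j. c * x j) A = \<bar>c\<bar> * L2_set x A"
  by (simp add: L2_set_def power_mult_distrib sum_distrib_left[symmetric] real_sqrt_mult)

lemma L2_set_triangle_diff: "L2_set (\<lambda>i. f i - g i) A \<le> L2_set f A + L2_set g A"
  using L2_set_triangle_ineq[of f "\<lambda>i. - g i" A] by (simp add: L2_set_def)

definition mats :: "nat \<Rightarrow> (nat \<Rightarrow> nat \<Rightarrow> real) set" where
  "mats n = ({..<n} \<rightarrow>\<^sub>E half_rows n)"

lemma finite_mats [simp]: "finite (mats n)"
  unfolding mats_def by (intro finite_PiE) auto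

lemma card_mats: "card (mats n) = card (half_rows n) ^ n"
  by (simp add: mats_def card_PiE)

lemma card_mats_pos: "card (mats n) > 0"
  by (simp add: card_mats card_half_rows_pos)

lemma sum_mats_prod:
  fixes f :: "nat \<Rightarrow> (nat \<Rightarrow> real) \<Rightarrow> 'a::comm_semiring_1"
  shows "(\<Sum>A\<in>mats n. \<Prod>i<n. f i (A i)) = (\<Prod>i<n. \<Sum>r\<in>half_rows n. f i r)"
  unfolding mats_def by (subst prod_sum_PiE) auto

definition mprob :: "nat \<Rightarrow> ((nat \<Rightarrow> nat \<Rightarrow> real) \<Rightarrow> bool) \<Rightarrow> real" where
  "mprob n E = real (card {A \<in> mats n. E A}) / real (card (mats n))"

text \<open>Markov's inequality in counting form: \<open>F\<close> dominates the indicator of the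
  event. Choosing for \<open>F\<close> a product over rows or columns turns a bound on a Euclidean
  norm into one on characteristic functions.\<close>

lemma mprob_le_sum:
  assumes "\<And>A. A \<in> mats n \<Longrightarrow> F A \<ge> 0" "\<And>A. A \<in> mats n \<Longrightarrow> E A \<Longrightarrow> F A \<ge> 1"
    and "(\<Sum>A\<in>mats n. F A) \<le> real (card (mats n)) * b"
  shows "mprob n E \<le> b"
proof -
  have "real (card {A \<in> mats n. E A}) = (\<Sum>A\<in>{A \<in> mats n. E A}. 1)" by simp
  also have "\<dots> \<le> (\<Sum>A\<in>{A \<in> mats n. E A}. F A)"
    by (rule sum_mono) (use assms(2) in simp)
  also have "\<dots> \<le> (\<Sum>A\<in>mats n. F A)"
    by (rule sum_mono2) (use assms(1) in auto)
  finally show ?thesis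
    using assms(3) card_mats_pos[of n] by (simp add: mprob_def field_simps)
qed

lemma mprob_mono: "(\<And>A. A \<in> mats n \<Longrightarrow> E A \<Longrightarrow> F A) \<Longrightarrow> mprob n E \<le> mprob n F"
  unfolding mprob_def by (intro divide_right_mono) (auto intro!: card_mono)

lemma mprob_disj: "mprob n (\<lambda>A. E A \<or> F A) \<le> mprob n E + mprob n F"
proof -
  have "{A \<in> mats n. E A \<or> F A} = {A \<in> mats n. E A} \<union> {A \<in> mats n. F A}" by auto
  then have "card {A \<in> mats n. E A \<or> F A} \<le> card {A \<in> mats n. E A} + card {A \<in> mats n. F A}"
    by (simp add: card_Un_le)
  then show ?thesis
    by (simp add: mprob_def add_divide_distrib[symmetric] divide_right_mono)
qed

lemma mprob_Bex:
  assumes "finite S"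
  shows "mprob n (\<lambda>A. \<exists>x\<in>S. E x A) \<le> (\<Sum>x\<in>S. mprob n (E x))"
  using assms
proof (induction rule: finite_induct)
  case empty
  then show ?case by (simp add: mprob_def)
next
  case (insert x S)
  have "mprob n (\<lambda>A. \<exists>x\<in>insert x S. E x A) \<le> mprob n (E x) + mprob n (\<lambda>A. \<exists>x\<in>S. E x A)"
    using mprob_disj[of n "E x" "\<lambda>A. \<exists>x\<in>S. E x A"] by simp
  then show ?case using insert by simp
qed

lemma mprob_Bex_le:
  assumes "finite S" "\<And>x. x \<in> S \<Longrightarrow> mprob n (E x) \<le> b" "real (card S) \<le> N" "b \<ge> 0"
  shows "mprob n (\<lambda>A. \<exists>x\<in>S. E x A) \<le> N * b"
proof -
  have "mprob n (\<lambda>A. \<exists>x\<in>S. E x A) \<le> (\<Sum>x\<in>S. b)"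
    using mprob_Bex[OF assms(1), of n E] sum_mono[of S "\<lambda>x. mprob n (E x)" "\<lambda>_. b"] assms(2) by auto
  also have "\<dots> \<le> N * b" using assms by (simp add: mult_right_mono)
  finally show ?thesis .
qed

section \<open>Counting integer points in an l1 ball\<close>

definition int_pts :: "nat \<Rightarrow> real \<Rightarrow> (nat \<Rightarrow> int) set" where
  "int_pts n M = {p \<in> {..<n} \<rightarrow>\<^sub>E UNIV. (\<Sum>j<n. \<bar>real_of_int (p j)\<bar>) \<le> M}"

lemma sum_geometric_two_sided_le:
  fixes q :: real
  assumes "0 < q" "q < 1"
  shows "(\<Sum>k\<in>{- int b..int b}. q ^ nat \<bar>k\<bar>) \<le> 1 + 2 * q / (1 - q)"
proof -
  have "(\<Sum>k\<in>{- int b..int b}. q ^ nat \<bar>k\<bar>) = 1 + 2 * (q - q ^ Suc b) / (1 - q)"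
  proof (induction b)
    case (Suc b)
    have "{- int (Suc b)..int (Suc b)} = insert (- int (Suc b)) (insert (int (Suc b)) {- int b..int b})"
      by auto
    then have "(\<Sum>k\<in>{- int (Suc b)..int (Suc b)}. q ^ nat \<bar>k\<bar>)
        = 2 * q ^ Suc b + (\<Sum>k\<in>{- int b..int b}. q ^ nat \<bar>k\<bar>)"
      by (simp add: nat_add_distrib)
    then show ?case unfolding Suc using assms by (simp add: field_simps)
  qed simp
  moreover have "2 * (q - q ^ Suc b) / (1 - q) \<le> 2 * q / (1 - q)"
    using assms by (intro divide_right_mono) auto
  ultimately show ?thesis by linarith
qed

lemma int_pts_subset: "int_pts n M \<subseteq> {..<n} \<rightarrow>\<^sub>E {- int (nat \<lfloor>M\<rfloor>)..int (nat \<lfloor>M\<rfloor>)}"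
proof
  fix p assume p: "p \<in> int_pts n M"
  have abs: "\<bar>p j\<bar> \<le> int (nat \<lfloor>M\<rfloor>)" if "j < n" for j
  proof -
    have "\<bar>real_of_int (p j)\<bar> \<le> (\<Sum>j<n. \<bar>real_of_int (p j)\<bar>)"
      using that by (intro member_le_sum) auto
    then have "real_of_int \<bar>p j\<bar> \<le> M" using p by (simp add: int_pts_def)
    then show ?thesis by linarith
  qed
  have "p j \<in> {- int (nat \<lfloor>M\<rfloor>)..int (nat \<lfloor>M\<rfloor>)}" if "j < n" for j
    using abs[OF that] by (intro atLeastAtMost_iff[THEN iffD2] conjI) linarith+
  moreover have "p \<in> extensional {..<n}" using p by (simp add: int_pts_def PiE_def)
  ultimately show "p \<in> {..<n} \<rightarrow>\<^sub>E {- int (nat \<lfloor>M\<rfloor>)..int (nat \<lfloor>M\<rfloor>)}"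
    unfolding PiE_def by blast
qed

lemma finite_int_pts [simp]: "finite (int_pts n M)"
  by (rule finite_subset[OF int_pts_subset]) (intro finite_PiE; simp)

text \<open>Weight each point by \<open>exp (l * (M - l1 norm))\<close>, which is at least 1 on the
  ball and factors over the coordinates; \<open>1 + 2 / (exp l - 1)\<close> is the sum of
  \<open>exp (- l * \<bar>k\<bar>)\<close> over all integers \<open>k\<close>. The parameter
  \<open>l\<close> is tuned at each use.\<close>

lemma card_int_pts_le:
  assumes l: "l > 0"
  shows "real (card (int_pts n M)) \<le> exp (l * M) * (1 + 2 / (exp l - 1)) ^ n"
proof -
  define B where "B = int (nat \<lfloor>M\<rfloor>)"
  define q where "q = exp (- l)"
  have q: "0 < q" "q < 1" using l by (auto simp: q_def)
  have qe: "2 * q / (1 - q) = 2 / (exp l - 1)"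
    using l by (simp add: q_def exp_minus field_simps)
  have qpow: "q ^ nat \<bar>k\<bar> = exp (- l * \<bar>real_of_int k\<bar>)" for k
    by (simp add: q_def exp_of_nat_mult[symmetric])
  have "real (card (int_pts n M)) = (\<Sum>p\<in>int_pts n M. 1)" by simp
  also have "\<dots> \<le> (\<Sum>p\<in>int_pts n M. exp (l * M) * (\<Prod>j<n. q ^ nat \<bar>p j\<bar>))"
  proof (rule sum_mono)
    fix p assume "p \<in> int_pts n M"
    then have "l * (\<Sum>j<n. \<bar>real_of_int (p j)\<bar>) \<le> l * M" using l by (simp add: int_pts_def)
    moreover have "(\<Prod>j<n. q ^ nat \<bar>p j\<bar>) = exp (- l * (\<Sum>j<n. \<bar>real_of_int (p j)\<bar>))"
      by (simp add: qpow exp_sum[symmetric] sum_distrib_left sum_negf)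
    ultimately show "1 \<le> exp (l * M) * (\<Prod>j<n. q ^ nat \<bar>p j\<bar>)"
      by (simp add: exp_add[symmetric])
  qed
  also have "\<dots> \<le> (\<Sum>p\<in>{..<n} \<rightarrow>\<^sub>E {-B..B}. exp (l * M) * (\<Prod>j<n. q ^ nat \<bar>p j\<bar>))"
  proof (rule sum_mono2)
    show "finite ({..<n} \<rightarrow>\<^sub>E {-B..B})" by (intro finite_PiE) simp_all
    show "int_pts n M \<subseteq> {..<n} \<rightarrow>\<^sub>E {-B..B}" unfolding B_def by (rule int_pts_subset)
    show "0 \<le> exp (l * M) * (\<Prod>j<n. q ^ nat \<bar>p j\<bar>)" for p :: "nat \<Rightarrow> int"
      using q by (intro mult_nonneg_nonneg prod_nonneg) simp_all
  qed
  also have "\<dots> = exp (l * M) * (\<Sum>k\<in>{-B..B}. q ^ nat \<bar>k\<bar>) ^ n"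
    using prod_sum_PiE[of "{..<n}" "\<lambda>_. {-B..B}" "\<lambda>_ k. q ^ nat \<bar>k\<bar>"]
    by (simp add: sum_distrib_left[symmetric])
  also have "\<dots> \<le> exp (l * M) * (1 + 2 / (exp l - 1)) ^ n"
    using sum_geometric_two_sided_le[OF q, of "nat \<lfloor>M\<rfloor>"] q
    by (intro mult_left_mono power_mono sum_nonneg) (simp_all add: B_def qe)
  finally show ?thesis .
qed

section \<open>The bilinear form of a matrix\<close>

definition bil :: "nat \<Rightarrow> (nat \<Rightarrow> nat \<Rightarrow> real) \<Rightarrow> (nat \<Rightarrow> real) \<Rightarrow> (nat \<Rightarrow> real) \<Rightarrow> real" where
  "bil n A y x = (\<Sum>i<n. y i * ip n (A i) x)"

lemma bil_tmul: "bil n A y x = ip n (tmul n A y) x"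
  unfolding bil_def tmul_def sum_distrib_left sum_distrib_right
  by (subst sum.swap) (simp add: mult.assoc)

lemma bil_add_right: "bil n A y (\<lambda>j. x j + x' j) = bil n A y x + bil n A y x'"
  by (simp add: bil_def sum.distrib algebra_simps)

lemma bil_add_left: "bil n A (\<lambda>j. y j + y' j) x = bil n A y x + bil n A y' x"
  by (simp add: bil_def sum.distrib algebra_simps)

lemma bil_mult_right: "bil n A y (\<lambda>j. c * x j) = c * bil n A y x"
  by (simp add: bil_def sum_distrib_left mult_ac)

lemma bil_mult_left: "bil n A (\<lambda>j. c * y j) x = c * bil n A y x"
  by (simp add: bil_def sum_distrib_left mult_ac)

text \<open>The rows are independent, and row \<open>i\<close> is sub-Gaussian in the direction
  \<open>y i * x\<close>; the squared lengths of these directions add up to the product of the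
  squared norms.\<close>

lemma sum_mats_exp_bil_le:
  "(\<Sum>A\<in>mats n. exp (bil n A y x)) \<le> real (card (mats n)) * exp ((nrm n y)\<^sup>2 * (nrm n x)\<^sup>2 / 2)"
proof -
  have "(\<Sum>A\<in>mats n. exp (bil n A y x)) = (\<Sum>A\<in>mats n. \<Prod>i<n. exp (y i * ip n (A i) x))"
    by (simp add: bil_def exp_sum)
  also have "\<dots> = (\<Prod>i<n. \<Sum>r\<in>half_rows n. exp (\<Sum>j<n. r j * (y i * x j)))"
    by (subst sum_mats_prod) (simp add: sum_distrib_left mult_ac)
  also have "\<dots> \<le> (\<Prod>i<n. real (card (half_rows n)) * exp ((y i)\<^sup>2 * (nrm n x)\<^sup>2 / 2))"
  proof (intro prod_mono conjI)
    fix i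
    show "(\<Sum>r\<in>half_rows n. exp (\<Sum>j<n. r j * (y i * x j))) \<le> real (card (half_rows n)) * exp ((y i)\<^sup>2 * (nrm n x)\<^sup>2 / 2)"
      using sum_half_rows_exp_le[of "\<lambda>j. y i * x j" n]
      by (simp add: L2_set_square power_mult_distrib sum_distrib_left)
  qed (auto intro: sum_nonneg)
  also have "\<dots> = real (card (mats n)) * exp ((nrm n y)\<^sup>2 * (nrm n x)\<^sup>2 / 2)"
    by (simp add: prod.distrib card_mats exp_sum[symmetric] L2_set_square[of y]
        sum_divide_distrib[symmetric] sum_distrib_right[symmetric])
  finally show ?thesis .
qed

lemma mats_abs_le_one: "A \<in> mats n \<Longrightarrow> i < n \<Longrightarrow> j < n \<Longrightarrow> \<bar>A i j\<bar> \<le> 1"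
  by (fastforce simp: mats_def half_rows_def signed_rows_def PiE_def Pi_def)

section \<open>The operator norm\<close>

abbreviation ri :: "(nat \<Rightarrow> int) \<Rightarrow> nat \<Rightarrow> real" where
  "ri p \<equiv> \<lambda>j. real_of_int (p j)"

definition round_pt :: "nat \<Rightarrow> (nat \<Rightarrow> real) \<Rightarrow> nat \<Rightarrow> int" where
  "round_pt n x = (\<lambda>j\<in>{..<n}. round (x j))"

lemma nrm_round_pt_diff: "nrm n (\<lambda>j. x j - ri (round_pt n x) j) \<le> sqrt (real n) / 2"
proof -
  have "\<bar>x j - ri (round_pt n x) j\<bar> \<le> 1 / 2" if "j < n" for j
    using of_int_round_abs_le[of "x j"] that by (simp add: round_pt_def abs_minus_commute)
  from nrm_le_bound[OF this] show ?thesis by simp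
qed

lemma int_pts_iff: "p \<in> int_pts n M \<longleftrightarrow> p \<in> extensional {..<n} \<and> (\<Sum>j<n. \<bar>ri p j\<bar>) \<le> M"
  by (auto simp: int_pts_def PiE_def)

lemma round_pt_extensional: "round_pt n x \<in> extensional {..<n}"
  by (simp add: round_pt_def)

lemma abs_le_nrm: "j < n \<Longrightarrow> \<bar>x j\<bar> \<le> nrm n x"
  using member_le_L2_set[of "{..<n}" j "\<lambda>j. \<bar>x j\<bar>"] by (simp add: L2_set_def)

lemma bil_eq_0: "nrm n x = 0 \<or> nrm n y = 0 \<Longrightarrow> bil n A y x = 0"
  by (auto simp: bil_def L2_set_eq_0_iff)

text \<open>The bilinear form treats a matrix and its transpose alike, so one event controls both.
  The constant rounds up 15/2 * 16/7, which solves the inequality for \<open>s\<close> in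
  \<open>op_boundedI\<close>.\<close>

definition op_bounded :: "nat \<Rightarrow> (nat \<Rightarrow> nat \<Rightarrow> real) \<Rightarrow> bool" where
  "op_bounded n A \<longleftrightarrow> (\<forall>x y. bil n A y x \<le> 18 * sqrt (real n) * nrm n y * nrm n x)"

lemma op_boundedI:
  assumes A: "A \<in> mats n" and n: "n > 0"
    and h: "\<And>p q. \<lbrakk>p \<in> int_pts n (5/2 * real n); nrm n (ri p) \<le> 5/2 * sqrt (real n);
        q \<in> int_pts n (5/2 * real n); nrm n (ri q) \<le> 5/2 * sqrt (real n)\<rbrakk>
        \<Longrightarrow> bil n A (ri q) (ri p) \<le> 30 * real n * sqrt (real n)"
  shows "op_bounded n A"
proof -
  define B where "B = {bil n A y x |x y. nrm n x \<le> 1 \<and> nrm n y \<le> 1}"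
  define s where "s = Sup B"
  \<comment> \<open>The net argument absorbs a multiple of the supremum into itself, so the supremum
    must first be known to be finite; this crude bound suffices.\<close>
  have bdd: "bdd_above B"
  proof (rule bdd_aboveI)
    fix b assume "b \<in> B"
    then obtain x y where b: "b = bil n A y x" and xy: "nrm n x \<le> 1" "nrm n y \<le> 1"
      by (auto simp: B_def)
    have x: "\<bar>x j\<bar> \<le> 1" and y: "\<bar>y j\<bar> \<le> 1" if "j < n" for j
      using abs_le_nrm[OF that, of x] abs_le_nrm[OF that, of y] xy by linarith+
    have ipn: "\<bar>ip n (A i) x\<bar> \<le> real n" if "i < n" for i
    proof -
      have "\<bar>ip n (A i) x\<bar> \<le> (\<Sum>j<n. \<bar>A i j * x j\<bar>)" by (rule sum_abs)
      also have "\<dots> \<le> (\<Sum>j<n. 1 * 1)"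
        unfolding abs_mult by (intro sum_mono mult_mono mats_abs_le_one[OF A that] x) auto
      finally show ?thesis by simp
    qed
    have "\<bar>bil n A y x\<bar> \<le> (\<Sum>i<n. \<bar>y i * ip n (A i) x\<bar>)" unfolding bil_def by (rule sum_abs)
    also have "\<dots> \<le> (\<Sum>i<n. 1 * real n)"
      unfolding abs_mult by (intro sum_mono mult_mono ipn y) auto
    finally show "b \<le> real n * real n" by (simp add: b)
  qed
  have sB: "bil n A y x \<le> s" if "nrm n x \<le> 1" "nrm n y \<le> 1" for x y
    unfolding s_def by (rule cSup_upper[OF _ bdd]) (use that in \<open>auto simp: B_def\<close>)
  have s0: "s \<ge> 0"
    using sB[of "\<lambda>_. 0" "\<lambda>_. 0"] by (simp add: bil_def L2_set_def)
  have sc: "bil n A y x \<le> s * nrm n y * nrm n x" for x y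
  proof (cases "nrm n x = 0 \<or> nrm n y = 0")
    case True
    then show ?thesis by (auto simp: bil_eq_0)
  next
    case False
    then have pos: "nrm n x > 0" "nrm n y > 0" using L2_set_nonneg[of x "{..<n}"] L2_set_nonneg[of y "{..<n}"] by linarith+
    have "bil n A (\<lambda>j. (1 / nrm n y) * y j) (\<lambda>j. (1 / nrm n x) * x j) \<le> s"
      by (rule sB; subst L2_set_mult_left) (use pos in simp_all)
    then show ?thesis
      using pos unfolding bil_mult_left bil_mult_right by (simp add: field_simps)
  qed
  \<comment> \<open>Rounding moves a vector by at most \<surd>n / 2, so integer points divided by
    this \<theta> form a 1/4-net of the unit ball.\<close>
  define \<theta> where "\<theta> = 2 * sqrt (real n)"
  have \<theta>: "\<theta> > 0" using n by (simp add: \<theta>_def)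
  have approx: "\<exists>p f. p \<in> int_pts n (5/2 * real n) \<and> nrm n (ri p) \<le> 5/2 * sqrt (real n)
      \<and> nrm n f \<le> 1/4 \<and> (\<forall>j. x j = (1 / \<theta>) * ri p j + f j)" if x: "nrm n x \<le> 1" for x
  proof -
    define p where "p = round_pt n (\<lambda>j. \<theta> * x j)"
    define d where "d = (\<lambda>j. \<theta> * x j - ri p j)"
    have d: "nrm n d \<le> sqrt (real n) / 2"
      unfolding d_def p_def by (rule nrm_round_pt_diff)
    have "nrm n (ri p) = nrm n (\<lambda>j. \<theta> * x j - d j)" by (simp add: d_def)
    also have "\<dots> \<le> \<theta> * nrm n x + nrm n d"
      using L2_set_triangle_diff[of "\<lambda>j. \<theta> * x j" d "{..<n}"] \<theta> by (simp add: L2_set_mult_left)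
    also have "\<dots> \<le> \<theta> * 1 + sqrt (real n) / 2"
      by (intro add_mono mult_left_mono x d) (use \<theta> in simp)
    finally have p: "nrm n (ri p) \<le> 5/2 * sqrt (real n)" by (simp add: \<theta>_def)
    have "(\<Sum>j<n. \<bar>ri p j\<bar>) \<le> sqrt (real n) * (5/2 * sqrt (real n))"
      by (rule order_trans[OF sum_abs_le_nrm]) (intro mult_left_mono p; simp)
    also have "sqrt (real n) * (5/2 * sqrt (real n)) = 5/2 * (sqrt (real n) * sqrt (real n))"
      by (simp only: mult_ac)
    finally have p1: "p \<in> int_pts n (5/2 * real n)"
      by (simp add: int_pts_iff p_def round_pt_extensional)
    have "nrm n (\<lambda>j. (1 / \<theta>) * d j) = (1 / \<theta>) * nrm n d"
      using \<theta> by (subst L2_set_mult_left) simp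
    also have "\<dots> \<le> (1 / \<theta>) * (sqrt (real n) / 2)"
      by (intro mult_left_mono d) (use \<theta> in simp)
    also have "\<dots> = 1/4" using n by (simp add: \<theta>_def)
    finally have f: "nrm n (\<lambda>j. (1 / \<theta>) * d j) \<le> 1/4" .
    have "x j = (1 / \<theta>) * ri p j + (1 / \<theta>) * d j" for j
      using \<theta> by (simp add: d_def field_simps)
    with p p1 f show ?thesis by blast
  qed
  \<comment> \<open>The error \<open>e\<close> is tested against a net vector of norm at most 5/4
    and costs 5/16, the error \<open>f\<close> against \<open>y\<close> itself and costs 1/4;
    together 9/16.\<close>
  have main: "bil n A y x \<le> 15/2 * sqrt (real n) + 9/16 * s" if x: "nrm n x \<le> 1" and y: "nrm n y \<le> 1" for x y
  proof -
    obtain p f where p: "p \<in> int_pts n (5/2 * real n)" "nrm n (ri p) \<le> 5/2 * sqrt (real n)"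
      and f: "nrm n f \<le> 1/4" and xe: "\<And>j. x j = (1 / \<theta>) * ri p j + f j"
      using approx[OF x] by blast
    obtain q e where q: "q \<in> int_pts n (5/2 * real n)" "nrm n (ri q) \<le> 5/2 * sqrt (real n)"
      and e: "nrm n e \<le> 1/4" and ye: "\<And>j. y j = (1 / \<theta>) * ri q j + e j"
      using approx[OF y] by blast
    have x': "x = (\<lambda>j. (1 / \<theta>) * ri p j + f j)" and y': "y = (\<lambda>j. (1 / \<theta>) * ri q j + e j)"
      using xe ye by blast+
    have "bil n A y x = bil n A y (\<lambda>j. (1 / \<theta>) * ri p j) + bil n A y f"
      by (subst x', subst bil_add_right, rule refl)
    also have "bil n A y (\<lambda>j. (1 / \<theta>) * ri p j)
        = bil n A (\<lambda>j. (1 / \<theta>) * ri q j) (\<lambda>j. (1 / \<theta>) * ri p j) + bil n A e (\<lambda>j. (1 / \<theta>) * ri p j)"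
      by (subst y', subst bil_add_left, rule refl)
    finally have eq: "bil n A y x = (1 / \<theta>) * ((1 / \<theta>) * bil n A (ri q) (ri p))
        + (1 / \<theta>) * bil n A e (ri p) + bil n A y f"
      by (simp only: bil_mult_left bil_mult_right)
    have sn: "sqrt (real n) > 0" using n by simp
    have "(1 / \<theta>) * ((1 / \<theta>) * bil n A (ri q) (ri p)) \<le> (1 / \<theta>) * ((1 / \<theta>) * (30 * real n * sqrt (real n)))"
      by (intro mult_left_mono h p q) (use \<theta> in simp_all)
    also have "\<dots> = 15/2 * sqrt (real n)"
      using n by (simp add: \<theta>_def field_simps)
    finally have 1: "(1 / \<theta>) * ((1 / \<theta>) * bil n A (ri q) (ri p)) \<le> 15/2 * sqrt (real n)" .
    have "bil n A e (ri p) \<le> s * nrm n e * nrm n (ri p)" by (rule sc)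
    also have "\<dots> \<le> s * (1/4) * (5/2 * sqrt (real n))"
      by (intro mult_mono e p order_refl s0 mult_nonneg_nonneg) auto
    finally have "(1 / \<theta>) * bil n A e (ri p) \<le> (1 / \<theta>) * (s * (1/4) * (5/2 * sqrt (real n)))"
      using \<theta> by (intro mult_left_mono) auto
    also have "\<dots> = 5/16 * s" using sn by (simp add: \<theta>_def)
    finally have 2: "(1 / \<theta>) * bil n A e (ri p) \<le> 5/16 * s" .
    have "bil n A y f \<le> s * nrm n y * nrm n f" by (rule sc)
    also have "\<dots> \<le> s * 1 * (1/4)"
      by (intro mult_mono y f order_refl s0 mult_nonneg_nonneg) auto
    finally show ?thesis using eq 1 2 by linarith
  qed
  have "s \<le> 15/2 * sqrt (real n) + 9/16 * s"
    unfolding s_def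
  proof (rule cSup_least)
    have "bil n A (\<lambda>_. 0) (\<lambda>_. 0) \<in> B" unfolding B_def by (auto simp: L2_set_def intro!: exI[of _ "\<lambda>_. 0"])
    then show "B \<noteq> {}" by blast
  qed (use main in \<open>auto simp: B_def s_def\<close>)
  moreover have "sqrt (real n) \<ge> 0" by simp
  ultimately have "s \<le> 18 * sqrt (real n)" by linarith
  then have "s * nrm n y * nrm n x \<le> 18 * sqrt (real n) * nrm n y * nrm n x" for x y
    by (intro mult_right_mono) auto
  with sc show ?thesis unfolding op_bounded_def by (meson order_trans)
qed

lemma op_bounded_mul:
  assumes "op_bounded n A"
  shows "nrm n (\<lambda>i. ip n (A i) x) \<le> 18 * sqrt (real n) * nrm n x"
proof -
  let ?v = "\<lambda>i. ip n (A i) x"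
  have "(nrm n ?v)\<^sup>2 = bil n A ?v x" unfolding L2_set_square by (simp add: bil_def power2_eq_square)
  also have "\<dots> \<le> 18 * sqrt (real n) * nrm n ?v * nrm n x" using assms by (simp only: op_bounded_def)
  finally have "nrm n ?v * nrm n ?v \<le> nrm n ?v * (18 * sqrt (real n) * nrm n x)"
    by (simp add: power2_eq_square mult_ac)
  then show ?thesis
    by (cases "nrm n ?v = 0") (auto simp: mult_le_cancel_left order.strict_iff_order)
qed

lemma op_bounded_tmul:
  assumes "op_bounded n A"
  shows "nrm n (tmul n A y) \<le> 18 * sqrt (real n) * nrm n y"
proof -
  let ?v = "tmul n A y"
  have "(nrm n ?v)\<^sup>2 = bil n A y ?v" unfolding L2_set_square by (simp add: bil_tmul power2_eq_square)
  also have "\<dots> \<le> 18 * sqrt (real n) * nrm n y * nrm n ?v" using assms by (simp only: op_bounded_def)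
  finally have "nrm n ?v * nrm n ?v \<le> nrm n ?v * (18 * sqrt (real n) * nrm n y)"
    by (simp add: power2_eq_square mult_ac)
  then show ?thesis
    by (cases "nrm n ?v = 0") (auto simp: mult_le_cancel_left order.strict_iff_order)
qed

lemma two_power_le_exp: "2 ^ k \<le> exp (real k)"
proof -
  have "(1 + 1 :: real) \<le> exp 1" by (rule exp_ge_add_one_self)
  then have "2 ^ k \<le> exp (1::real) ^ k" by (intro power_mono) auto
  then show ?thesis by (simp add: exp_of_nat_mult[symmetric])
qed

lemma mprob_not_op_bounded:
  assumes n: "n > 0"
  shows "mprob n (\<lambda>A. \<not> op_bounded n A) \<le> exp (- real n)"
proof -
  define S where "S = {p \<in> int_pts n (5/2 * real n). nrm n (ri p) \<le> 5/2 * sqrt (real n)}"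
  have fin: "finite S" unfolding S_def by simp
  have "real (card S) \<le> real (card (int_pts n (5/2 * real n)))"
    unfolding S_def by (intro of_nat_mono card_mono) auto
  also have "\<dots> \<le> exp (1 * (5/2 * real n)) * (1 + 2 / (exp 1 - 1)) ^ n"
    by (rule card_int_pts_le) simp
  also have "\<dots> \<le> exp (5/2 * real n) * exp (2 * real n)"
  proof -
    have e: "exp (1::real) \<ge> 2" using two_power_le_exp[of 1] by simp
    have "1 + 2 / (exp 1 - 1) \<le> (1 + 2 / (2 - 1) :: real)"
      using e by (intro add_left_mono divide_left_mono) auto
    also have "\<dots> \<le> exp 2" using two_power_le_exp[of 2] by simp
    finally have "(1 + 2 / (exp 1 - 1)) ^ n \<le> (exp (2::real)) ^ n"
      using e by (intro power_mono) auto
    then show ?thesis by (simp add: exp_of_nat_mult[symmetric] mult.commute)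
  qed
  finally have card: "real (card S) \<le> exp (9/2 * real n)" by (simp add: exp_add[symmetric])
  have each: "mprob n (\<lambda>A. bil n A (ri q) (ri p) > 30 * real n * sqrt (real n)) \<le> exp (- 10 * real n)"
    if "p \<in> S" "q \<in> S" for p q
  proof (rule mprob_le_sum)
    \<comment> \<open>Exponential moment with parameter 1 / \<surd>n: the threshold becomes 30 n,
      while the log moment is at most (25/4)^2 n / 2 \<le> 20 n. The surplus of 10 n beats the 9 n
      needed for pairs of net points.\<close>
    let ?F = "\<lambda>A. exp (- 30 * real n) * exp (bil n A (ri q) (\<lambda>j. (1 / sqrt (real n)) * ri p j))"
    show "?F A \<ge> 0" for A by simp
    show "?F A \<ge> 1" if "bil n A (ri q) (ri p) > 30 * real n * sqrt (real n)" for A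
    proof -
      have "30 * real n \<le> (1 / sqrt (real n)) * bil n A (ri q) (ri p)"
        using that n by (simp add: field_simps)
      then show ?thesis by (simp add: exp_add[symmetric] bil_mult_right del: times_divide_eq_left)
    qed
    have sq: "(nrm n (ri p))\<^sup>2 \<le> 25/4 * real n" if "p \<in> S" for p
    proof -
      have "(nrm n (ri p))\<^sup>2 \<le> (5/2 * sqrt (real n))\<^sup>2"
        using that unfolding S_def by (intro power_mono) auto
      also have "\<dots> = 25/4 * real n" by (simp add: power_mult_distrib power2_eq_square)
      finally show ?thesis .
    qed
    have "(nrm n (\<lambda>j. (1 / sqrt (real n)) * ri p j))\<^sup>2 = (nrm n (ri p))\<^sup>2 / real n"
      by (subst L2_set_mult_left) (simp add: power_mult_distrib power_divide)
    also have "\<dots> \<le> 25/4"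
      using sq[OF \<open>p \<in> S\<close>] n by (simp add: field_simps)
    finally have "(nrm n (ri q))\<^sup>2 * (nrm n (\<lambda>j. (1 / sqrt (real n)) * ri p j))\<^sup>2 \<le> (25/4 * real n) * (25/4)"
      using sq[OF \<open>q \<in> S\<close>] by (intro mult_mono) auto
    then have ex: "(nrm n (ri q))\<^sup>2 * (nrm n (\<lambda>j. (1 / sqrt (real n)) * ri p j))\<^sup>2 / 2 \<le> 20 * real n"
      by simp
    have "(\<Sum>A\<in>mats n. ?F A) = exp (- 30 * real n) * (\<Sum>A\<in>mats n. exp (bil n A (ri q) (\<lambda>j. (1 / sqrt (real n)) * ri p j)))"
      by (simp only: sum_distrib_left)
    also have "\<dots> \<le> exp (- 30 * real n) * (real (card (mats n)) * exp (20 * real n))"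
      by (intro mult_left_mono order_trans[OF sum_mats_exp_bil_le] iffD2[OF exp_le_cancel_iff] ex) auto
    also have "\<dots> = real (card (mats n)) * exp (- 10 * real n)"
      by (simp add: exp_add[symmetric])
    finally show "(\<Sum>A\<in>mats n. ?F A) \<le> real (card (mats n)) * exp (- 10 * real n)" .
  qed
  have "mprob n (\<lambda>A. \<not> op_bounded n A) \<le>
      mprob n (\<lambda>A. \<exists>z\<in>S \<times> S. bil n A (ri (fst z)) (ri (snd z)) > 30 * real n * sqrt (real n))"
  proof (rule mprob_mono, rule ccontr)
    fix A assume A: "A \<in> mats n" "\<not> op_bounded n A"
      and "\<not> (\<exists>z\<in>S \<times> S. bil n A (ri (fst z)) (ri (snd z)) > 30 * real n * sqrt (real n))"
    then have "bil n A (ri q) (ri p) \<le> 30 * real n * sqrt (real n)" if "p \<in> S" "q \<in> S" for p q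
      using that by (force simp: not_less)
    then have "op_bounded n A" by (intro op_boundedI[OF A(1) n]) (simp add: S_def)
    with A show False by simp
  qed
  also have "\<dots> \<le> (exp (9/2 * real n) * exp (9/2 * real n)) * exp (- 10 * real n)"
    by (rule mprob_Bex_le) (use fin each card in \<open>auto simp: card_cartesian_product intro!: mult_mono\<close>)
  also have "\<dots> = exp (- real n)" by (simp add: exp_add[symmetric])
  finally show ?thesis .
qed

section \<open>Integer points of small norm\<close>

text \<open>The right side is the characteristic function of a lazy sign, zero with probability 2/3.
  Laziness keeps it positive, so it can dominate a Gaussian everywhere while being a trigonometric
  polynomial that can be averaged exactly.\<close>

lemma exp_le_cos: "exp (- s\<^sup>2 / 3) \<le> (2 + cos s) / 3" for s :: real
proof -
  define u where "u = (1 - cos s) / 3"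
  have u: "0 \<le> u" "u \<le> 2/3" 
  proof -
    have "0 \<le> (1 - c) / 3 \<and> (1 - c) / 3 \<le> 2/3" if "- 1 \<le> c" "c \<le> 1" for c :: real
      using that by simp
    from this[OF cos_ge_minus_one cos_le_one, of s] show "0 \<le> u" "u \<le> 2/3" by (simp_all only: u_def)
  qed
  have "1 - cos s = 2 * sin (s / 2) ^ 2" using cos_double_sin[of "s / 2"] by simp
  also have "\<dots> \<le> 2 * (s / 2) ^ 2"
    using abs_sin_x_le_abs_x[of "s / 2"] by (simp only: abs_le_square_iff)
  finally have us: "2 * u \<le> s\<^sup>2 / 3" by (simp add: u_def power_divide)
  \<comment> \<open>The product equals 1 + u (1 - 2 u^2), and u^2 \<le> 4/9. This gives
    \<open>exp (- 2 * u) \<le> 1 - u\<close> on the range of \<open>u\<close>.\<close>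
  have "1 \<le> (1 - u) * (1 + 2 * u + 2 * u\<^sup>2)"
  proof -
    have "u * u \<le> 2/3 * (2/3)" using u by (intro mult_mono) auto
    then have "u * (1 - 2 * (u * u)) \<ge> 0" using u by (intro mult_nonneg_nonneg) auto
    then show ?thesis by (simp add: algebra_simps power2_eq_square)
  qed
  also have "\<dots> \<le> (1 - u) * exp (2 * u)"
    using exp_lower_Taylor_quadratic[of "2 * u"] u
    by (intro mult_left_mono) (auto simp: power_mult_distrib)
  finally have "exp (- (2 * u)) \<le> 1 - u"
    by (simp add: exp_minus field_simps)
  moreover have "exp (- s\<^sup>2 / 3) \<le> exp (- (2 * u))" using us by simp
  moreover have "1 - u = (2 + cos s) / 3" by (simp add: u_def field_simps)
  ultimately show ?thesis by linarith
qed

text \<open>For \<bar>b j\<bar> \<le> 1 the nearest integer to \<open>b j / pi\<close> is 0, so no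
  arithmetic structure of \<open>b\<close> can interfere; 10 bounds \<pi>^2.\<close>

lemma abs_esym_cos_small_le:
  assumes "even n" "n > 0" "\<And>j. j < n \<Longrightarrow> \<bar>b j\<bar> \<le> 1"
  shows "\<bar>esym (\<lambda>j. cos (b j)) n (n div 2)\<bar> \<le> real (card (half_rows n)) * exp (- (nrm n b)\<^sup>2 / 10)"
proof -
  have "(nrm n b)\<^sup>2 / 10 \<le> (\<Sum>j<n. int_dist (b j / pi) ^ 2)"
    unfolding L2_set_square sum_divide_distrib
  proof (rule sum_mono)
    fix j assume "j \<in> {..<n}"
    then have b: "\<bar>b j\<bar> \<le> 1" using assms(3) by simp
    have "\<bar>b j / pi\<bar> = \<bar>b j\<bar> / pi" by (simp add: abs_divide)
    also have "\<dots> \<le> 1 / 3" using b pi_approx by (intro frac_le) auto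
    finally have "int_dist (b j / pi) = \<bar>b j / pi\<bar>" by (intro int_dist_small) linarith
    moreover have "pi * pi \<le> 3.15 * 3.15" by (intro mult_mono) (use pi_approx in auto)
    then have "(b j)\<^sup>2 / 10 \<le> (b j)\<^sup>2 / pi\<^sup>2"
      by (intro divide_left_mono) (auto simp: power2_eq_square)
    ultimately show "(b j)\<^sup>2 / 10 \<le> (int_dist (b j / pi))\<^sup>2" by (simp add: power_divide)
  qed
  then have "exp (- (\<Sum>j<n. int_dist (b j / pi) ^ 2)) \<le> exp (- (nrm n b)\<^sup>2 / 10)" by simp
  from mult_left_mono[OF this, of "real (card (half_rows n))"]
  show ?thesis using abs_esym_cos_le[OF assms(1,2), of b] by simp
qed

lemma two_plus_cos_nonneg: "(2 + cos t) / 3 \<ge> 0" for t :: real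
proof -
  have "(2 + c) / 3 \<ge> 0" if "- 1 \<le> c" for c :: real using that by simp
  then show ?thesis using cos_ge_minus_one by blast
qed

lemma exp_neg_tenth_le: "exp (- 1 / 10 :: real) \<le> 91 / 100"
proof -
  have "11 / 10 \<le> exp (1 / 10 :: real)" using exp_ge_add_one_self[of "1/10::real"] by simp
  then have "1 / exp (1 / 10 :: real) \<le> 1 / (11 / 10)" by (intro divide_left_mono) auto
  then show ?thesis by (simp add: exp_minus inverse_eq_divide)
qed

text \<open>Origin of 3/100: the left side is at most 2/3 + 0.91/3 = 0.97.\<close>

lemma two_thirds_plus_le: "2 / 3 + exp (- 1 / 10) / 3 \<le> exp (- 3 / 100 :: real)"
  using exp_neg_tenth_le exp_ge_add_one_self[of "- 3 / 100 :: real"] by simp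

lemma sum_half_rows_cos_le:
  assumes "even n" "n > 0" "nrm n x = 1"
  shows "(\<Sum>r\<in>half_rows n. (2 + cos (ip n r x)) / 3) \<le> real (card (half_rows n)) * exp (- 3 / 100)"
proof -
  have "\<bar>x j\<bar> \<le> 1" if "j < n" for j using abs_le_nrm[OF that, of x] assms(3) by simp
  then have "(\<Sum>r\<in>half_rows n. cos (ip n r x)) \<le> real (card (half_rows n)) * exp (- 1 / 10)"
    using abs_esym_cos_small_le[OF assms(1,2), of x] assms(3) by (simp add: sum_half_rows_cos)
  then have "(\<Sum>r\<in>half_rows n. (2 + cos (ip n r x)) / 3) \<le> real (card (half_rows n)) * (2 / 3 + exp (- 1 / 10) / 3)"
    by (simp add: sum_divide_distrib[symmetric] sum.distrib algebra_simps)
  also have "\<dots> \<le> real (card (half_rows n)) * exp (- 3 / 100)"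
    by (intro mult_left_mono two_thirds_plus_le) simp
  finally show ?thesis .
qed

lemma sum_if_neq_const: "k < n \<Longrightarrow> (\<Sum>i<n. if i = k then 0 else c) = c * (real n - 1)" for c :: real
proof -
  assume "k < n"
  have "(\<Sum>i<n. if i = k then 0 else c) = (\<Sum>i<n. c - (if i = k then c else 0))"
    by (intro sum.cong) auto
  then show ?thesis using \<open>k < n\<close> by (simp add: sum_subtractf sum.delta algebra_simps)
qed

lemma prod_remove_if: "(\<Prod>i\<in>{..<n} - {k}. f i) = (\<Prod>i<n. if i = k then 1 else f i)"
  for f :: "nat \<Rightarrow> real"
  by (simp add: prod.If_cases[of "{..<n}"] Collect_neg_eq[symmetric] set_diff_eq Int_def)

text \<open>Each row other than \<open>k\<close> gains a factor \<open>exp (- 3 / 100)\<close>. The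
  threshold costs a third of 3 n / 100 in the exponent, leaving n / 50, and the summand 1 covers the
  omitted row.\<close>

lemma mprob_row_norm_small:
  assumes n: "even n" "n > 0" and k: "k < n" and x: "nrm n x = 1"
  shows "mprob n (\<lambda>A. (\<Sum>i\<in>{..<n} - {k}. (ip n (A i) x)\<^sup>2) \<le> 3/100 * real n) \<le> exp (- real n / 50 + 1)"
proof (rule mprob_le_sum)
  let ?f = "\<lambda>i r. if i = k then 1 else (2 + cos (ip n r x)) / 3"
  let ?F = "\<lambda>A. exp (real n / 100) * (\<Prod>i<n. ?f i (A i))"
  have f0: "?f i r \<ge> 0" for i r
    by (cases "i = k") (simp_all only: two_plus_cos_nonneg zero_le_one if_True if_False simp_thms)
  show "?F A \<ge> 0" for A by (intro mult_nonneg_nonneg prod_nonneg f0) auto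
  show "?F A \<ge> 1" if "(\<Sum>i\<in>{..<n} - {k}. (ip n (A i) x)\<^sup>2) \<le> 3/100 * real n" for A
  proof -
    have "1 \<le> exp (real n / 100) * exp (\<Sum>i\<in>{..<n} - {k}. - (ip n (A i) x)\<^sup>2 / 3)"
      using that by (simp add: exp_add[symmetric] sum_divide_distrib[symmetric] sum_negf)
    also have "\<dots> \<le> exp (real n / 100) * (\<Prod>i\<in>{..<n} - {k}. (2 + cos (ip n (A i) x)) / 3)"
      by (simp only: exp_sum finite_Diff finite_lessThan) (intro mult_left_mono prod_mono conjI exp_le_cos; simp)
    finally show ?thesis by (simp only: prod_remove_if)
  qed
  have "(\<Sum>A\<in>mats n. ?F A) = exp (real n / 100) * (\<Prod>i<n. \<Sum>r\<in>half_rows n. ?f i r)"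
    by (simp only: sum_distrib_left[symmetric] sum_mats_prod[of "?f"])
  also have "\<dots> \<le> exp (real n / 100) * (\<Prod>i<n. real (card (half_rows n)) * exp (if i = k then 0 else - 3/100))"
    using sum_half_rows_cos_le[OF n x]
    by (intro mult_left_mono prod_mono conjI sum_nonneg f0) auto
  also have "\<dots> = real (card (mats n)) * exp (real n / 100 - 3/100 * (real n - 1))"
    using k by (simp add: prod.distrib exp_sum[symmetric] sum_if_neq_const card_mats exp_add[symmetric] exp_diff algebra_simps)
  also have "\<dots> \<le> real (card (mats n)) * exp (- real n / 50 + 1)"
    by (intro mult_left_mono) (simp_all add: field_simps)
  finally show "(\<Sum>A\<in>mats n. ?F A) \<le> real (card (mats n)) * exp (- real n / 50 + 1)" .
qed

definition trits :: "nat \<Rightarrow> (nat \<Rightarrow> real) set" where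
  "trits n = ({..<n} \<rightarrow>\<^sub>E {-1, 0, 1})"

text \<open>The law of the lazy sign of \<open>exp_le_cos\<close>.\<close>

definition trit_weight :: "real \<Rightarrow> real" where
  "trit_weight w = (if w = 0 then 2 / 3 else 1 / 6)"

lemma trit_sum: "(\<Sum>w\<in>{-1, 0, 1 :: real}. F w) = F (-1) + F 0 + F 1" for F :: "real \<Rightarrow> 'a::comm_monoid_add"
  by (simp add: add.assoc)

lemma sum_trits_prod:
  fixes f :: "nat \<Rightarrow> real \<Rightarrow> 'a::comm_semiring_1"
  shows "(\<Sum>w\<in>trits n. \<Prod>j<n. f j (w j)) = (\<Prod>j<n. f j (-1) + f j 0 + f j 1)"
  unfolding trits_def by (subst prod_sum_PiE[symmetric]) (simp_all add: trit_sum)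

text \<open>Each factor is the characteristic function of a lazy sign. Expanding the product over these
  signs exchanges the roles of signed_rows and columns, so that only the row characteristic function
  enters.\<close>

lemma sum_mats_prod_cos_le:
  assumes n: "even n" "n > 0" and x: "nrm n x = 1"
  shows "(\<Sum>A\<in>mats n. \<Prod>j<n. (2 + cos (tmul n A x j)) / 3) \<le> real (card (mats n)) * exp (- 3 / 100 * real n)"
proof -
  let ?W = "\<lambda>w. \<Prod>j<n. trit_weight (w j)"
  have fin: "finite (trits n)" unfolding trits_def by (intro finite_PiE) auto
  have W0: "?W w \<ge> 0" for w by (intro prod_nonneg) (simp add: trit_weight_def)
  have expand: "complex_of_real (\<Prod>j<n. (2 + cos (tmul n A x j)) / 3)
      = (\<Sum>w\<in>trits n. of_real (?W w) * (\<Prod>i<n. cis (\<Sum>j<n. A i j * (x i * w j))))" for A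
  proof -
    have swap: "(\<Sum>j<n. w j * tmul n A x j) = (\<Sum>i<n. \<Sum>j<n. A i j * (x i * w j))" for w
      unfolding tmul_def sum_distrib_left by (subst sum.swap) (simp add: mult_ac)
    have "complex_of_real (\<Prod>j<n. (2 + cos (tmul n A x j)) / 3)
        = (\<Prod>j<n. (\<Sum>w\<in>{-1, 0, 1}. of_real (trit_weight w) * cis (w * tmul n A x j)))"
      unfolding of_real_prod
      by (intro prod.cong refl) (simp add: trit_weight_def complex_eq_iff)
    also have "\<dots> = (\<Sum>w\<in>trits n. \<Prod>j<n. of_real (trit_weight (w j)) * cis (w j * tmul n A x j))"
      unfolding trit_sum by (rule sum_trits_prod[symmetric])
    also have "\<dots> = (\<Sum>w\<in>trits n. of_real (?W w) * cis (\<Sum>j<n. w j * tmul n A x j))"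
      by (simp add: prod.distrib cis_sum)
    finally show ?thesis by (simp only: swap cis_sum finite_lessThan)
  qed
  have "complex_of_real (\<Sum>A\<in>mats n. \<Prod>j<n. (2 + cos (tmul n A x j)) / 3)
      = (\<Sum>A\<in>mats n. \<Sum>w\<in>trits n. of_real (?W w) * (\<Prod>i<n. cis (\<Sum>j<n. A i j * (x i * w j))))"
    unfolding of_real_sum by (intro sum.cong refl expand)
  also have "\<dots> = (\<Sum>w\<in>trits n. of_real (?W w) * (\<Sum>A\<in>mats n. \<Prod>i<n. cis (\<Sum>j<n. A i j * (x i * w j))))"
    by (subst sum.swap) (simp only: sum_distrib_left)
  also have "\<dots> = (\<Sum>w\<in>trits n. of_real (?W w) * (\<Prod>i<n. of_real (esym (\<lambda>j. cos (x i * w j)) n (n div 2))))"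
    by (subst sum_mats_prod) (simp only: sum_half_rows_cis)
  also have "\<dots> = complex_of_real (\<Sum>w\<in>trits n. ?W w * (\<Prod>i<n. esym (\<lambda>j. cos (x i * w j)) n (n div 2)))"
    by simp
  finally have "(\<Sum>A\<in>mats n. \<Prod>j<n. (2 + cos (tmul n A x j)) / 3)
      = (\<Sum>w\<in>trits n. ?W w * (\<Prod>i<n. esym (\<lambda>j. cos (x i * w j)) n (n div 2)))"
    by (simp only: of_real_eq_iff)
  \<comment> \<open>For a fixed \<open>w\<close>, row \<open>i\<close> contributes its
    characteristic function at \<open>x i * w\<close>, whose entries are at most 1 in absolute
    value. Since \<open>x\<close> is a unit vector, the exponents of the rows add up to the squared
    norm of \<open>w\<close> over 10.\<close>
  also have "\<dots> \<le> (\<Sum>w\<in>trits n. ?W w * (real (card (mats n)) * exp (- (nrm n w)\<^sup>2 / 10)))"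
  proof (intro sum_mono mult_left_mono W0)
    fix w assume w: "w \<in> trits n"
    have wj: "\<bar>w j\<bar> \<le> 1" if "j < n" for j
    proof -
      have "w j \<in> {-1, 0, 1}" using w that unfolding trits_def by (blast dest: PiE_mem)
      then show ?thesis by auto
    qed
    have "(\<Prod>i<n. esym (\<lambda>j. cos (x i * w j)) n (n div 2)) \<le> \<bar>\<Prod>i<n. esym (\<lambda>j. cos (x i * w j)) n (n div 2)\<bar>"
      by simp
    also have "\<dots> \<le> (\<Prod>i<n. real (card (half_rows n)) * exp (- (x i)\<^sup>2 * (nrm n w)\<^sup>2 / 10))"
      unfolding abs_prod
    proof (intro prod_mono conjI)
      fix i assume "i \<in> {..<n}"
      then have xi: "\<bar>x i\<bar> \<le> 1" using abs_le_nrm[of i n x] x by simp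
      have "\<bar>x i * w j\<bar> \<le> 1" if "j < n" for j
        unfolding abs_mult by (rule mult_le_one) (use xi wj[OF that] in auto)
      then show "\<bar>esym (\<lambda>j. cos (x i * w j)) n (n div 2)\<bar> \<le> real (card (half_rows n)) * exp (- (x i)\<^sup>2 * (nrm n w)\<^sup>2 / 10)"
        using abs_esym_cos_small_le[OF n, of "\<lambda>j. x i * w j"]
        by (simp add: L2_set_mult_left power_mult_distrib)
    qed auto
    also have "\<dots> = real (card (mats n)) * exp (\<Sum>i<n. - (x i)\<^sup>2 * (nrm n w)\<^sup>2 / 10)"
      by (simp add: prod.distrib card_mats exp_sum)
    also have "(\<Sum>i<n. - (x i)\<^sup>2 * (nrm n w)\<^sup>2 / 10) = - ((nrm n x)\<^sup>2 * (nrm n w)\<^sup>2 / 10)"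
      by (simp add: L2_set_square[of x] sum_divide_distrib[symmetric] sum_distrib_right[symmetric] sum_negf)
    finally show "(\<Prod>i<n. esym (\<lambda>j. cos (x i * w j)) n (n div 2)) \<le> real (card (mats n)) * exp (- (nrm n w)\<^sup>2 / 10)"
      by (simp add: x)
  qed
  also have "\<dots> = real (card (mats n)) * (\<Sum>w\<in>trits n. \<Prod>j<n. trit_weight (w j) * exp (- (w j)\<^sup>2 / 10))"
    by (simp add: L2_set_square sum_distrib_left prod.distrib exp_sum[symmetric] sum_negf
        sum_divide_distrib[symmetric] mult_ac)
  \<comment> \<open>This average over lazy signs factors again, and each coordinate gives the same
    number as a row does in \<open>sum_half_rows_cos_le\<close>.\<close>
  also have "(\<Sum>w\<in>trits n. \<Prod>j<n. trit_weight (w j) * exp (- (w j)\<^sup>2 / 10)) = (2 / 3 + exp (- 1 / 10) / 3) ^ n"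
    by (subst sum_trits_prod[where f = "\<lambda>j w. trit_weight w * exp (- w\<^sup>2 / 10)"]) (simp add: trit_weight_def add.commute)
  also have "\<dots> \<le> exp (- 3 / 100) ^ n"
    by (intro power_mono two_thirds_plus_le) (simp add: add_nonneg_nonneg)
  also have "\<dots> = exp (- 3 / 100 * real n)" by (simp add: exp_of_nat_mult[symmetric] mult.commute)
  finally show ?thesis by (simp add: mult_left_mono)
qed

lemma mprob_col_norm_small:
  assumes n: "even n" "n > 0" and x: "nrm n x = 1"
  shows "mprob n (\<lambda>A. (nrm n (tmul n A x))\<^sup>2 \<le> 3/100 * real n) \<le> exp (- real n / 50)"
proof (rule mprob_le_sum)
  let ?F = "\<lambda>A. exp (real n / 100) * (\<Prod>j<n. (2 + cos (tmul n A x j)) / 3)"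
  show "?F A \<ge> 0" for A by (intro mult_nonneg_nonneg prod_nonneg two_plus_cos_nonneg) auto
  show "?F A \<ge> 1" if "(nrm n (tmul n A x))\<^sup>2 \<le> 3/100 * real n" for A
  proof -
    have "1 \<le> exp (real n / 100) * exp (\<Sum>j<n. - (tmul n A x j)\<^sup>2 / 3)"
      using that by (simp add: L2_set_square exp_add[symmetric] sum_divide_distrib[symmetric] sum_negf)
    also have "\<dots> \<le> ?F A"
      by (simp only: exp_sum finite_lessThan) (intro mult_left_mono prod_mono conjI exp_le_cos; simp)
    finally show ?thesis .
  qed
  have "(\<Sum>A\<in>mats n. ?F A) \<le> exp (real n / 100) * (real (card (mats n)) * exp (- 3 / 100 * real n))"
    unfolding sum_distrib_left[symmetric] by (intro mult_left_mono sum_mats_prod_cos_le[OF n x]) simp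
  also have "\<dots> = real (card (mats n)) * exp (- real n / 50)"
    by (simp add: exp_add[symmetric])
  finally show "(\<Sum>A\<in>mats n. ?F A) \<le> real (card (mats n)) * exp (- real n / 50)" .
qed

text \<open>The choice \<open>l = 12\<close> gives exponents 12/2000 and 1/1000 per coordinate,
  below half of the exponent 1/50 available for a single vector.\<close>

lemma card_int_pts_sparse_le: "real (card (int_pts n (real n / 2000))) \<le> exp (real n / 100)"
proof -
  have "real (card (int_pts n (real n / 2000))) \<le> exp (12 * (real n / 2000)) * (1 + 2 / (exp 12 - 1)) ^ n"
    by (rule card_int_pts_le) simp
  also have "1 + 2 / (exp 12 - 1) \<le> exp (1 / 1000 :: real)"
  proof -
    have "exp (12::real) \<ge> 4096" using two_power_le_exp[of 12] by simp
    then have "2 / (exp 12 - 1) \<le> (2 / 4095 :: real)" by (intro divide_left_mono) auto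
    then show ?thesis using exp_ge_add_one_self[of "1/1000::real"] by simp
  qed
  then have "(1 + 2 / (exp 12 - 1)) ^ n \<le> exp (1 / 1000 :: real) ^ n"
    by (intro power_mono) simp_all
  also have "exp (12 * (real n / 2000)) * exp (1 / 1000 :: real) ^ n \<le> exp (real n / 100)"
    by (simp add: exp_of_nat_mult[symmetric] exp_add[symmetric])
  finally show ?thesis by (simp add: mult_left_mono)
qed

text \<open>A union bound after normalizing each point: exp(n / 100) points against probability
  exp(- n / 50 + 1).\<close>

lemma mprob_row_sparse:
  assumes n: "even n" "n > 0" and k: "k < n"
  shows "mprob n (\<lambda>A. \<exists>p\<in>int_pts n (real n / 2000). nrm n (ri p) > 0 \<and>
      (\<Sum>i\<in>{..<n} - {k}. (ip n (A i) (ri p))\<^sup>2) \<le> 3/100 * real n * (nrm n (ri p))\<^sup>2) \<le> exp (- real n / 100 + 1)"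
proof -
  have "mprob n (\<lambda>A. nrm n (ri p) > 0 \<and>
      (\<Sum>i\<in>{..<n} - {k}. (ip n (A i) (ri p))\<^sup>2) \<le> 3/100 * real n * (nrm n (ri p))\<^sup>2) \<le> exp (- real n / 50 + 1)" for p
  proof (cases "nrm n (ri p) > 0")
    case True
    let ?x = "\<lambda>j. (1 / nrm n (ri p)) * ri p j"
    have x: "nrm n ?x = 1" by (subst L2_set_mult_left) (use True in simp)
    have e: "(ip n r ?x)\<^sup>2 = (1 / (nrm n (ri p))\<^sup>2) * (ip n r (ri p))\<^sup>2" for r
    proof -
      have "ip n r ?x = (1 / nrm n (ri p)) * ip n r (ri p)"
        unfolding sum_distrib_left by (simp add: mult_ac)
      then show ?thesis by (simp add: power_mult_distrib power_divide)
    qed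
    have eqn: "(\<Sum>i\<in>{..<n} - {k}. (ip n (A i) ?x)\<^sup>2) = (1 / (nrm n (ri p))\<^sup>2) * (\<Sum>i\<in>{..<n} - {k}. (ip n (A i) (ri p))\<^sup>2)" for A
      unfolding e sum_distrib_left by (rule refl)
    then show ?thesis
      using True
      by (intro order_trans[OF mprob_mono mprob_row_norm_small[OF n k x]]) (subst eqn, simp add: field_simps)
  qed (simp add: mprob_def)
  then have "mprob n (\<lambda>A. \<exists>p\<in>int_pts n (real n / 2000). nrm n (ri p) > 0 \<and>
      (\<Sum>i\<in>{..<n} - {k}. (ip n (A i) (ri p))\<^sup>2) \<le> 3/100 * real n * (nrm n (ri p))\<^sup>2)
      \<le> exp (real n / 100) * exp (- real n / 50 + 1)"
    by (intro mprob_Bex_le card_int_pts_sparse_le) auto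
  then show ?thesis by (simp add: exp_add[symmetric])
qed

lemma tmul_scale: "tmul n A (\<lambda>j. c * y j) = (\<lambda>j. c * tmul n A y j)"
  by (simp add: fun_eq_iff tmul_def sum_distrib_left mult_ac)

lemma mprob_col_sparse:
  assumes n: "even n" "n > 0"
  shows "mprob n (\<lambda>A. \<exists>p\<in>int_pts n (real n / 2000). nrm n (ri p) > 0 \<and>
      (nrm n (tmul n A (ri p)))\<^sup>2 \<le> 3/100 * real n * (nrm n (ri p))\<^sup>2) \<le> exp (- real n / 100)"
proof -
  have "mprob n (\<lambda>A. nrm n (ri p) > 0 \<and>
      (nrm n (tmul n A (ri p)))\<^sup>2 \<le> 3/100 * real n * (nrm n (ri p))\<^sup>2) \<le> exp (- real n / 50)" for p
  proof (cases "nrm n (ri p) > 0")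
    case True
    let ?x = "\<lambda>j. (1 / nrm n (ri p)) * ri p j"
    have x: "nrm n ?x = 1" by (subst L2_set_mult_left) (use True in simp)
    have eqn: "(nrm n (tmul n A ?x))\<^sup>2 = (1 / (nrm n (ri p))\<^sup>2) * (nrm n (tmul n A (ri p)))\<^sup>2" for A
      unfolding tmul_scale L2_set_mult_left by (simp add: power_mult_distrib power_divide)
    then show ?thesis
      using True
      by (intro order_trans[OF mprob_mono mprob_col_norm_small[OF n x]]) (subst eqn, simp add: field_simps)
  qed (simp add: mprob_def)
  then have "mprob n (\<lambda>A. \<exists>p\<in>int_pts n (real n / 2000). nrm n (ri p) > 0 \<and>
      (nrm n (tmul n A (ri p)))\<^sup>2 \<le> 3/100 * real n * (nrm n (ri p))\<^sup>2)
      \<le> exp (real n / 100) * exp (- real n / 50)"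
    by (intro mprob_Bex_le card_int_pts_sparse_le) auto
  then show ?thesis by (simp add: exp_add[symmetric])
qed

section \<open>Small ball probabilities\<close>

text \<open>Small enough for 106 * 6000 * 72 * \<open>lcd_const\<close> \<le> exp(- 6), on which
  \<open>mprob_level\<close> rests.\<close>

definition lcd_const :: real where "lcd_const = 1 / 10 ^ 11"

text \<open>In the terminology of Rudelson and Vershynin, the essential least common denominator of \<open>x\<close> is at
  least \<open>T\<close>.\<close>

definition unstructured :: "nat \<Rightarrow> real \<Rightarrow> (nat \<Rightarrow> real) \<Rightarrow> bool" where
  "unstructured n T x \<longleftrightarrow> (\<forall>\<theta> p. 0 < \<theta> \<and> \<theta> \<le> T \<longrightarrow>
     min (\<theta> / 200) (lcd_const * sqrt (real n)) \<le> nrm n (\<lambda>j. \<theta> * x j - ri p j))"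

lemma unstructured_antimono: "unstructured n T x \<Longrightarrow> S \<le> T \<Longrightarrow> unstructured n S x"
  unfolding unstructured_def by (meson order_trans)

text \<open>The kernel equals its own second derivative, so integrating by parts twice reproduces
  the integral with factor \<open>- s\<^sup>2\<close>. This is where \<open>1 + s\<^sup>2\<close>
  and the antiderivative \<open>H\<close> come from.\<close>

lemma has_integral_sinh_cos:
  "((\<lambda>t. sinh (1 - t) * cos (s * t)) has_integral (cosh 1 - cos s) / (1 + s\<^sup>2)) {0..1}"
  for s :: real
proof -
  define H where "H t = s * sinh (1 - t) * sin (s * t) - cosh (1 - t) * cos (s * t)" for t
  define G where "G t = H t / (1 + s\<^sup>2)" for t
  have s0: "1 + s\<^sup>2 \<noteq> 0" using zero_le_power2[of s] by linarith
  have H: "(H has_real_derivative (1 + s\<^sup>2) * (sinh (1 - t) * cos (s * t))) (at t within {0..1})" for t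
    unfolding H_def by (auto intro!: derivative_eq_intros simp: algebra_simps power2_eq_square)
  have "(G has_real_derivative sinh (1 - t) * cos (s * t)) (at t within {0..1})" for t
    using DERIV_cdivide[OF H[of t], of "1 + s\<^sup>2"] s0 by (simp add: G_def[abs_def])
  then have "((\<lambda>t. sinh (1 - t) * cos (s * t)) has_integral (G 1 - G 0)) {0..1}"
    by (intro fundamental_theorem_of_calculus) (auto simp: has_real_derivative_iff_has_vector_derivative)
  moreover have "G 1 - G 0 = (cosh 1 - cos s) / (1 + s\<^sup>2)"
    by (simp add: G_def H_def diff_divide_distrib)
  ultimately show ?thesis by simp
qed

lemma has_integral_exp_neg:
  fixes b c :: real
  assumes "b \<noteq> 0"
  shows "((\<lambda>t. 2 * exp (- (b * t)) + c) has_integral 2 * (1 - exp (- b)) / b + c) {0..1}"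
proof -
  define G where "G t = - 2 * exp (- (b * t)) / b + c * t" for t
  have "(G has_real_derivative 2 * exp (- (b * t)) + c) (at t within {0..1})" for t
    unfolding G_def using assms by (auto intro!: derivative_eq_intros)
  then have "((\<lambda>t. 2 * exp (- (b * t)) + c) has_integral (G 1 - G 0)) {0..1}"
    by (intro fundamental_theorem_of_calculus) (auto simp: has_real_derivative_iff_has_vector_derivative)
  moreover have "G 1 - G 0 = 2 * (1 - exp (- b)) / b + c"
    using assms by (simp add: G_def field_simps)
  ultimately show ?thesis by simp
qed

text \<open>The transform of the compactly supported kernel \<open>sinh (1 - t)\<close> is comparable to the Cauchy
  weight \<open>1 / (1 + s\<^sup>2)\<close> and has no zeros. Products of such weights control small values of a
  Euclidean norm, so one kernel serves both for a single row and for tensorization over the signed_rows.\<close>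

lemma sum_half_rows_cauchy_le_integral:
  assumes b: "\<And>t. 0 \<le> t \<Longrightarrow> t \<le> 1 \<Longrightarrow>
      \<bar>esym (\<lambda>j. cos (t * x j / e)) n (n div 2)\<bar> \<le> real (card (half_rows n)) * b t"
    and I: "(b has_integral I) {0..1}"
  shows "(\<Sum>r\<in>half_rows n. 1 / (1 + (ip n r x / e)\<^sup>2)) \<le> 4 * real (card (half_rows n)) * I"
proof -
  let ?s = "\<lambda>r. ip n r x / e"
  let ?N = "real (card (half_rows n))"
  have pos: "1 + y\<^sup>2 > 0" for y :: real using zero_le_power2[of y] by linarith
  have e1: "exp (- 1 :: real) \<ge> 1 / 3"
    using exp_le by (simp add: exp_minus field_simps)
  have cosh1: "cosh (1::real) \<ge> 7 / 5"
    using exp_lower_Taylor_quadratic[of "1::real"] e1 by (simp add: cosh_def)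
  have sinh1: "0 \<le> sinh y \<and> sinh y \<le> 3 / 2" if "0 \<le> y" "y \<le> 1" for y :: real
  proof -
    have "exp y \<le> exp 1" using that by simp
    also have "\<dots> \<le> 3" by (rule exp_le)
    finally have "(exp y - exp (- y)) / 2 \<le> (3 - 0) / 2"
      by (intro divide_right_mono diff_mono) simp_all
    then have "sinh y \<le> 3 / 2" by (simp add: sinh_field_def)
    then show ?thesis using that by simp
  qed
  have "((\<lambda>t. \<Sum>r\<in>half_rows n. sinh (1 - t) * cos (?s r * t)) has_integral
      (\<Sum>r\<in>half_rows n. (cosh 1 - cos (?s r)) / (1 + (?s r)\<^sup>2))) {0..1}"
    by (intro has_integral_sum has_integral_sinh_cos) simp
  moreover have "((\<lambda>t. 3 / 2 * ?N * b t) has_integral 3 / 2 * ?N * I) {0..1}"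
    by (rule has_integral_mult_right[OF I])
  ultimately have J: "(\<Sum>r\<in>half_rows n. (cosh 1 - cos (?s r)) / (1 + (?s r)\<^sup>2)) \<le> 3 / 2 * ?N * I"
  proof (rule has_integral_le)
    fix t :: real assume t: "t \<in> {0..1}"
    let ?E = "esym (\<lambda>j. cos (t * x j / e)) n (n div 2)"
    have "cos (?s r * t) = cos (ip n r (\<lambda>j. t * x j / e))" for r
      by (simp add: sum_divide_distrib sum_distrib_left mult_ac)
    then have "(\<Sum>r\<in>half_rows n. sinh (1 - t) * cos (?s r * t)) = sinh (1 - t) * ?E"
      by (simp only: sum_distrib_left[symmetric] sum_half_rows_cos)
    also have "\<dots> \<le> \<bar>sinh (1 - t)\<bar> * \<bar>?E\<bar>" by (simp add: abs_mult[symmetric])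
    also have "\<dots> \<le> 3 / 2 * (?N * b t)"
      using t sinh1[of "1 - t"] by (intro mult_mono b) auto
    finally show "(\<Sum>r\<in>half_rows n. sinh (1 - t) * cos (?s r * t)) \<le> 3 / 2 * ?N * b t"
      by (simp add: mult_ac)
  qed
  \<comment> \<open>The numerator of the transform never falls below 7/5 - 1 = 2/5.\<close>
  have "(\<Sum>r\<in>half_rows n. 1 / (1 + (?s r)\<^sup>2)) \<le>
      (\<Sum>r\<in>half_rows n. 5 / 2 * ((cosh 1 - cos (?s r)) / (1 + (?s r)\<^sup>2)))"
  proof (rule sum_mono)
    fix r
    have "1 \<le> 5 / 2 * (cosh 1 - c)" if "c \<le> 1" for c :: real using that cosh1 by simp
    then have "1 / (1 + (?s r)\<^sup>2) \<le> (5 / 2 * (cosh 1 - cos (?s r))) / (1 + (?s r)\<^sup>2)"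
      by (intro divide_right_mono less_imp_le[OF pos]) (use cos_le_one in blast)
    then show "1 / (1 + (?s r)\<^sup>2) \<le> 5 / 2 * ((cosh 1 - cos (?s r)) / (1 + (?s r)\<^sup>2))" by simp
  qed
  also have "\<dots> \<le> 5 / 2 * (3 / 2 * ?N * I)"
    unfolding sum_distrib_left[symmetric] by (intro mult_left_mono J) simp
  \<comment> \<open>Rounding 15/4 up to 4 needs \<open>I\<close> to be nonnegative, which follows
    because \<open>b\<close> dominates an absolute value.\<close>
  also have "\<dots> \<le> 4 * ?N * I"
  proof -
    have "0 \<le> b t" if "t \<in> {0..1}" for t
    proof -
      have "0 \<le> ?N * b t" using b[of t] that by (meson abs_ge_zero atLeastAtMost_iff order_trans)
      then show ?thesis using card_half_rows_pos[of n] by (auto simp: zero_le_mult_iff)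
    qed
    then have "0 \<le> I" by (rule has_integral_nonneg[OF I])
    then have "0 \<le> ?N * I" by simp
    then show ?thesis by (simp add: mult_ac)
  qed
  finally show ?thesis .
qed

text \<open>The two terms of the bound are the two terms of the minimum in
  \<open>unstructured\<close>. By y^2 \<ge> y - 1/4, Gaussian decay in \<theta> is traded for
  exponential decay, which is elementary to integrate. At \<theta> = 0, where
  \<open>unstructured\<close> says nothing, the bound is trivial.\<close>

lemma unstructured_char_le:
  assumes n: "even n" "n > 0" and u: "unstructured n T x" and \<theta>: "0 \<le> \<theta>" "\<theta> \<le> T"
    and b: "\<And>j. b j / pi = \<theta> * x j"
  shows "\<bar>esym (\<lambda>j. cos (b j)) n (n div 2)\<bar>
    \<le> real (card (half_rows n)) * (2 * exp (- (\<theta> / 200)) + exp (- (lcd_const\<^sup>2 * real n)))"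
proof -
  let ?p = "\<lambda>j. round (\<theta> * x j)"
  let ?d = "nrm n (\<lambda>j. \<theta> * x j - ri ?p j)"
  have "(\<Sum>j<n. int_dist (b j / pi) ^ 2) = ?d\<^sup>2"
    by (simp add: b L2_set_square int_dist_def)
  then have 1: "\<bar>esym (\<lambda>j. cos (b j)) n (n div 2)\<bar> \<le> real (card (half_rows n)) * exp (- ?d\<^sup>2)"
    using abs_esym_cos_le[OF n, of b] by simp
  have "exp (- ?d\<^sup>2) \<le> 2 * exp (- (\<theta> / 200)) + exp (- (lcd_const\<^sup>2 * real n))"
  proof (cases "lcd_const * sqrt (real n) \<le> ?d")
    case True
    have "(lcd_const * sqrt (real n))\<^sup>2 \<le> ?d\<^sup>2"
      by (rule power_mono[OF True]) (simp add: lcd_const_def)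
    then have "exp (- ?d\<^sup>2) \<le> exp (- (lcd_const\<^sup>2 * real n))" by (simp add: power_mult_distrib)
    then show ?thesis by (simp add: add_increasing)
  next
    case False
    have "\<theta> / 200 \<le> ?d"
    proof (cases "\<theta> = 0")
      case False
      then have "min (\<theta> / 200) (lcd_const * sqrt (real n)) \<le> ?d"
        using u[unfolded unstructured_def, rule_format, of \<theta> ?p] \<theta> by simp
      then show ?thesis using \<open>\<not> lcd_const * sqrt (real n) \<le> ?d\<close> by (simp add: min_le_iff_disj)
    qed simp
    then have "(\<theta> / 200)\<^sup>2 \<le> ?d\<^sup>2" by (rule power_mono) (use \<theta> in simp)
    moreover have "\<theta> / 200 - 1 / 4 \<le> (\<theta> / 200)\<^sup>2"
    proof -
      have "y\<^sup>2 - (y - 1 / 4) = (y - 1 / 2)\<^sup>2" for y :: real by (simp add: power2_eq_square algebra_simps)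
      then show ?thesis by (metis diff_ge_0_iff_ge zero_le_power2)
    qed
    ultimately have "exp (- ?d\<^sup>2) \<le> exp (1 / 4 + - (\<theta> / 200))"
      unfolding exp_le_cancel_iff by linarith
    also have "\<dots> = exp (1 / 4) * exp (- (\<theta> / 200))" by (rule exp_add)
    also have "exp (1 / 4 :: real) \<le> 2"
    proof -
      have "exp (1 / 4 :: real) ^ 4 = exp 1" by (simp add: exp_of_nat_mult[symmetric])
      also have "\<dots> \<le> (2::real) ^ 4" using exp_le by simp
      finally show ?thesis by (rule power_le_imp_le_base[of _ 3, simplified numeral_eq_Suc, simplified]) simp
    qed
    then have "exp (1 / 4) * exp (- (\<theta> / 200)) \<le> 2 * exp (- (\<theta> / 200))" by simp
    finally show ?thesis by (simp add: add_increasing2)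
  qed
  from mult_left_mono[OF this, of "real (card (half_rows n))"] 1 show ?thesis by simp
qed

text \<open>The kernel lives on [0, 1], so only frequencies \<theta> = t / (\<pi> e) up to 1 /
  (\<pi> e) are tested; hence the condition on \<open>T\<close>. The constant rounds up 1600
  \<pi>.\<close>

lemma sum_half_rows_cauchy_le:
  assumes n: "even n" "n > 0" and u: "unstructured n T x" and e: "e > 0" "1 / (pi * e) \<le> T"
  shows "(\<Sum>r\<in>half_rows n. 1 / (1 + (ip n r x / e)\<^sup>2))
    \<le> real (card (half_rows n)) * (5100 * e + 4 * exp (- (lcd_const\<^sup>2 * real n)))"
proof -
  let ?N = "real (card (half_rows n))"
  define \<beta> where "\<beta> = 1 / (200 * pi * e)"
  define c where "c = exp (- (lcd_const\<^sup>2 * real n))"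
  have \<beta>: "\<beta> > 0" using e by (simp add: \<beta>_def)
  have "(\<Sum>r\<in>half_rows n. 1 / (1 + (ip n r x / e)\<^sup>2)) \<le> 4 * ?N * (2 * (1 - exp (- \<beta>)) / \<beta> + c)"
  proof (rule sum_half_rows_cauchy_le_integral[OF _ has_integral_exp_neg])
    fix t :: real assume t: "0 \<le> t" "t \<le> 1"
    have "t * (1 / (pi * e)) \<le> 1 * (1 / (pi * e))" using t e by (intro mult_right_mono) auto
    then have "t / (pi * e) \<le> T" using e by simp
    then have "\<bar>esym (\<lambda>j. cos (t * x j / e)) n (n div 2)\<bar>
        \<le> ?N * (2 * exp (- (t / (pi * e) / 200)) + exp (- (lcd_const\<^sup>2 * real n)))"
      using t e by (intro unstructured_char_le[OF n u]) (auto simp: field_simps)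
    then show "\<bar>esym (\<lambda>j. cos (t * x j / e)) n (n div 2)\<bar> \<le> ?N * (2 * exp (- (\<beta> * t)) + c)"
      by (simp add: \<beta>_def c_def mult_ac)
  qed (use \<beta> in simp)
  also have "\<dots> \<le> 4 * ?N * (2 * 1 / \<beta> + c)"
    using \<beta> by (intro mult_left_mono add_right_mono divide_right_mono) auto
  also have "\<dots> = ?N * (1600 * pi * e + 4 * c)"
    by (simp add: \<beta>_def algebra_simps)
  also have "\<dots> \<le> ?N * (5100 * e + 4 * c)"
    using e pi_approx by (intro mult_left_mono add_right_mono mult_right_mono) auto
  finally show ?thesis by (simp add: c_def)
qed

text \<open>On the event the Cauchy weight is at least 1/2, so the constants double.\<close>

lemma card_half_rows_small_ip_le:
  assumes n: "even n" "n > 0" and u: "unstructured n T x" and e: "e > 0" "1 / (pi * e) \<le> T"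
  shows "real (card {r \<in> half_rows n. \<bar>ip n r x\<bar> \<le> e})
    \<le> real (card (half_rows n)) * (10200 * e + 8 * exp (- (lcd_const\<^sup>2 * real n)))"
proof -
  have pos: "1 + y\<^sup>2 > 0" for y :: real using zero_le_power2[of y] by linarith
  have "real (card {r \<in> half_rows n. \<bar>ip n r x\<bar> \<le> e}) = (\<Sum>r\<in>{r \<in> half_rows n. \<bar>ip n r x\<bar> \<le> e}. 1)" by simp
  also have "\<dots> \<le> (\<Sum>r\<in>{r \<in> half_rows n. \<bar>ip n r x\<bar> \<le> e}. 2 * (1 / (1 + (ip n r x / e)\<^sup>2)))"
  proof (rule sum_mono)
    fix r assume "r \<in> {r \<in> half_rows n. \<bar>ip n r x\<bar> \<le> e}"
    then have "\<bar>ip n r x / e\<bar> \<le> 1" using e by simp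
    then have "(ip n r x / e)\<^sup>2 \<le> 1" by (simp add: abs_square_le_1)
    then show "1 \<le> 2 * (1 / (1 + (ip n r x / e)\<^sup>2))" using pos[of "ip n r x / e"] by (simp add: pos_le_divide_eq)
  qed
  also have "\<dots> \<le> (\<Sum>r\<in>half_rows n. 2 * (1 / (1 + (ip n r x / e)\<^sup>2)))"
    by (rule sum_mono2) (auto intro!: less_imp_le[OF pos])
  also have "\<dots> \<le> 2 * (real (card (half_rows n)) * (5100 * e + 4 * exp (- (lcd_const\<^sup>2 * real n))))"
    unfolding sum_distrib_left[symmetric] by (intro mult_left_mono sum_half_rows_cauchy_le[OF n u e]) simp
  finally show ?thesis by (simp add: algebra_simps)
qed

text \<open>Markov's inequality with a product of Cauchy weights, since
  \<open>exp (- y\<^sup>2) \<le> 1 / (1 + y\<^sup>2)\<close>. The assumption \<open>ee\<close>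
  absorbs the additive error of each row, so that the bound is a pure power of
  \<open>e\<close>.\<close>

lemma mprob_row_norm_unstructured:
  assumes n: "even n" "n > 0" and k: "k < n" and u: "unstructured n T x" and e: "e > 0" "1 / (pi * e) \<le> T"
    and ee: "exp (- (lcd_const\<^sup>2 * real n)) \<le> e"
  shows "mprob n (\<lambda>A. (\<Sum>i\<in>{..<n} - {k}. (ip n (A i) x)\<^sup>2) \<le> e\<^sup>2 * real n) \<le> exp (real n) * (6000 * e) ^ (n - 1)"
proof (rule mprob_le_sum)
  let ?g = "\<lambda>r. 1 / (1 + (ip n r x / e)\<^sup>2)"
  let ?f = "\<lambda>i r. if i = k then 1 else ?g r"
  let ?F = "\<lambda>A. exp (real n) * (\<Prod>i<n. ?f i (A i))"
  have pos: "1 + y\<^sup>2 > 0" for y :: real using zero_le_power2[of y] by linarith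
  have g0: "?g r > 0" for r using pos by simp
  have f0: "?f i r \<ge> 0" for i r using g0[of r] by simp
  show "?F A \<ge> 0" for A by (intro mult_nonneg_nonneg prod_nonneg f0) auto
  show "?F A \<ge> 1" if "(\<Sum>i\<in>{..<n} - {k}. (ip n (A i) x)\<^sup>2) \<le> e\<^sup>2 * real n" for A
  proof -
    have "(\<Sum>i\<in>{..<n} - {k}. (ip n (A i) x / e)\<^sup>2) \<le> real n"
      using that e by (simp add: power_divide sum_divide_distrib[symmetric] field_simps)
    then have "1 \<le> exp (real n) * exp (\<Sum>i\<in>{..<n} - {k}. - (ip n (A i) x / e)\<^sup>2)"
      by (simp add: exp_add[symmetric] sum_negf)
    also have "\<dots> \<le> exp (real n) * (\<Prod>i\<in>{..<n} - {k}. ?g (A i))"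
    proof -
      have "exp (- y\<^sup>2) \<le> 1 / (1 + y\<^sup>2)" for y :: real
        using exp_ge_add_one_self[of "y\<^sup>2"] pos[of y] by (simp add: exp_minus inverse_eq_divide frac_le)
      then show ?thesis
        by (simp only: exp_sum finite_Diff finite_lessThan) (intro mult_left_mono prod_mono conjI; simp)
    qed
    finally show ?thesis by (simp only: prod_remove_if)
  qed
  have row: "(\<Sum>r\<in>half_rows n. ?g r) \<le> real (card (half_rows n)) * (6000 * e)"
  proof -
    have "real (card (half_rows n)) * (5100 * e + 4 * exp (- (lcd_const\<^sup>2 * real n))) \<le> real (card (half_rows n)) * (6000 * e)"
      by (intro mult_left_mono) (use ee e in simp_all)
    then show ?thesis using sum_half_rows_cauchy_le[OF n u e] by simp
  qed
  have "(\<Sum>A\<in>mats n. ?F A) = exp (real n) * (\<Prod>i<n. \<Sum>r\<in>half_rows n. ?f i r)"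
    by (simp only: sum_distrib_left[symmetric] sum_mats_prod[of "?f"])
  also have "\<dots> \<le> exp (real n) * (\<Prod>i<n. real (card (half_rows n)) * (if i = k then 1 else 6000 * e))"
    using row by (intro mult_left_mono prod_mono conjI sum_nonneg f0) auto
  also have "(\<Prod>i<n. real (card (half_rows n)) * (if i = k then 1 else 6000 * e)) = real (card (mats n)) * (6000 * e) ^ (n - 1)"
    using k by (simp add: prod.distrib card_mats prod_remove_if[symmetric])
  finally show "(\<Sum>A\<in>mats n. ?F A) \<le> real (card (mats n)) * (exp (real n) * (6000 * e) ^ (n - 1))"
    by (simp add: mult_ac)
qed

section \<open>Normal vectors\<close>

text \<open>Rows orthogonal to \<open>x\<close> see only the error \<open>w\<close>, and the
  operator norm bound gives 324 = 18^2.\<close>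

lemma sum_row_ip_le:
  assumes A: "op_bounded n A" and orth: "\<And>i. i < n \<Longrightarrow> i \<noteq> k \<Longrightarrow> ip n (A i) x = 0"
    and y: "\<And>j. j < n \<Longrightarrow> y j = c * x j + w j"
  shows "(\<Sum>i\<in>{..<n} - {k}. (ip n (A i) y)\<^sup>2) \<le> 324 * real n * (nrm n w)\<^sup>2"
proof -
  have eq: "ip n (A i) y = ip n (A i) w" if "i \<in> {..<n} - {k}" for i
  proof -
    have "ip n (A i) y = (\<Sum>j<n. c * (A i j * x j) + A i j * w j)"
      by (intro sum.cong refl) (simp add: y algebra_simps)
    also have "\<dots> = c * ip n (A i) x + ip n (A i) w" by (simp only: sum.distrib sum_distrib_left)
    finally show ?thesis using orth that by simp
  qed
  have "(\<Sum>i\<in>{..<n} - {k}. (ip n (A i) y)\<^sup>2) = (\<Sum>i\<in>{..<n} - {k}. (ip n (A i) w)\<^sup>2)"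
    using eq by (intro sum.cong) auto
  also have "\<dots> \<le> (\<Sum>i<n. (ip n (A i) w)\<^sup>2)" by (rule sum_mono2) auto
  also have "\<dots> = (nrm n (\<lambda>i. ip n (A i) w))\<^sup>2" by (simp add: L2_set_square)
  also have "\<dots> \<le> (18 * sqrt (real n) * nrm n w)\<^sup>2"
    by (intro power_mono op_bounded_mul A) simp
  also have "\<dots> = 324 * real n * (nrm n w)\<^sup>2" by (simp add: power_mult_distrib)
  finally show ?thesis .
qed

lemma L2_set_diff_commute: "L2_set (\<lambda>j. f j - g j) S = L2_set (\<lambda>j. g j - f j) S"
  by (simp add: L2_set_def power2_commute)

text \<open>\<open>unstructured\<close> quantifies over arbitrary functions, whereas points are
  counted as extensional ones.\<close>

lemma restrict_int_point:
  fixes p :: "nat \<Rightarrow> int" and n :: nat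
  defines "q \<equiv> restrict p {..<n}"
  shows "nrm n (\<lambda>j. x j - ri q j) = nrm n (\<lambda>j. x j - ri p j)" "q \<in> extensional {..<n}"
  by (auto simp: q_def intro!: L2_set_cong)

text \<open>Integrality gives \<bar>m\<bar> \<le> m^2. For norms well below \<surd>n this beats the
  Cauchy-Schwarz inequality and makes the points few.\<close>

lemma sum_abs_int_le_square: "(\<Sum>j<n. \<bar>ri p j\<bar>) \<le> (nrm n (ri p))\<^sup>2"
  unfolding L2_set_square
proof (rule sum_mono)
  fix j
  have "\<bar>p j\<bar> * 1 \<le> \<bar>p j\<bar> * \<bar>p j\<bar>"
  proof (cases "p j = 0")
    case False
    then show ?thesis by (intro mult_left_mono) linarith+
  qed simp
  then have "real_of_int \<bar>p j\<bar> \<le> real_of_int (\<bar>p j\<bar> * \<bar>p j\<bar>)" by linarith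
  then show "\<bar>ri p j\<bar> \<le> (ri p j)\<^sup>2" by (simp add: power2_eq_square)
qed

lemma nrm_int_close:
  assumes x: "nrm n x = 1" and \<theta>: "\<theta> \<ge> 0" and d: "nrm n (\<lambda>j. \<theta> * x j - v j) \<le> a"
  shows "\<theta> - a \<le> nrm n v" "nrm n v \<le> \<theta> + a"
proof -
  have sc: "nrm n (\<lambda>j. \<theta> * x j) = \<theta>" using x \<theta> by (simp add: L2_set_mult_left)
  have "nrm n (\<lambda>j. (\<theta> * x j - v j) + v j) \<le> nrm n (\<lambda>j. \<theta> * x j - v j) + nrm n v"
    by (rule L2_set_triangle_ineq)
  then show "\<theta> - a \<le> nrm n v" using sc d by simp
  have "nrm n (\<lambda>j. \<theta> * x j - (\<theta> * x j - v j)) \<le> nrm n (\<lambda>j. \<theta> * x j) + nrm n (\<lambda>j. \<theta> * x j - v j)"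
    by (rule L2_set_triangle_diff)
  then show "nrm n v \<le> \<theta> + a" using sc d by simp
qed

text \<open>The relative error \<theta> / 200 rules out the point 0 and makes the rows nearly
  orthogonal to \<open>p\<close>: 324 / 200^2 is below 3/100 * (199/200)^2. Since \<theta> \<le>
  \<surd>n / 100, \<open>p\<close> is one of the few points of
  \<open>card_int_pts_sparse_le\<close>.\<close>

lemma mprob_low_level:
  assumes n: "even n" "n > 0" and k: "k < n"
  shows "mprob n (\<lambda>A. op_bounded n A \<and> (\<exists>x. nrm n x = 1 \<and> (\<forall>i<n. i \<noteq> k \<longrightarrow> ip n (A i) x = 0) \<and>
      \<not> unstructured n (sqrt (real n) / 100) x)) \<le> exp (- real n / 100 + 1)"
proof (rule order_trans[OF mprob_mono mprob_row_sparse[OF n k]])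
  fix A assume "A \<in> mats n" and "op_bounded n A \<and> (\<exists>x. nrm n x = 1 \<and> (\<forall>i<n. i \<noteq> k \<longrightarrow> ip n (A i) x = 0) \<and>
      \<not> unstructured n (sqrt (real n) / 100) x)"
  then obtain x where A: "op_bounded n A" and x: "nrm n x = 1"
    and orth: "\<And>i. i < n \<Longrightarrow> i \<noteq> k \<Longrightarrow> ip n (A i) x = 0" and "\<not> unstructured n (sqrt (real n) / 100) x"
    by blast
  then obtain \<theta> p0 where \<theta>: "0 < \<theta>" "\<theta> \<le> sqrt (real n) / 100"
    and p0: "nrm n (\<lambda>j. \<theta> * x j - ri p0 j) < \<theta> / 200"
    unfolding unstructured_def by (auto simp: not_le)
  define p where "p = restrict p0 {..<n}"
  have d: "nrm n (\<lambda>j. \<theta> * x j - ri p j) \<le> \<theta> / 200" and ext: "p \<in> extensional {..<n}"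
    using p0 restrict_int_point(1)[where n = n and x = "\<lambda>j. \<theta> * x j" and p = p0] by (auto simp: p_def)
  have lo: "199 / 200 * \<theta> \<le> nrm n (ri p)" and hi: "nrm n (ri p) \<le> 201 / 200 * \<theta>"
    using nrm_int_close[OF x _ d] \<theta> by simp_all
  have pos: "nrm n (ri p) > 0" using lo \<theta> by linarith
  have "(\<Sum>j<n. \<bar>ri p j\<bar>) \<le> (nrm n (ri p))\<^sup>2" by (rule sum_abs_int_le_square)
  also have "\<dots> \<le> (201 / 200 * (sqrt (real n) / 100))\<^sup>2"
    using hi \<theta> by (intro power_mono) auto
  also have "\<dots> \<le> real n / 2000" by (simp add: power_mult_distrib power_divide)
  finally have mem: "p \<in> int_pts n (real n / 2000)" using ext by (simp add: int_pts_iff)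
  have "(\<Sum>i\<in>{..<n} - {k}. (ip n (A i) (ri p))\<^sup>2) \<le> 324 * real n * (nrm n (\<lambda>j. ri p j - \<theta> * x j))\<^sup>2"
    by (rule sum_row_ip_le[OF A orth, where c = \<theta>]) auto
  also have "\<dots> \<le> 324 * real n * (\<theta> / 200)\<^sup>2"
    using d by (intro mult_left_mono power_mono) (auto simp: L2_set_diff_commute[of "ri p"])
  also have "\<dots> \<le> 3 / 100 * real n * (199 / 200 * \<theta>)\<^sup>2"
    by (simp add: power_mult_distrib power_divide)
  also have "\<dots> \<le> 3 / 100 * real n * (nrm n (ri p))\<^sup>2"
    using lo \<theta> by (intro mult_left_mono power_mono) auto
  finally show "\<exists>p\<in>int_pts n (real n / 2000). nrm n (ri p) > 0 \<and>
      (\<Sum>i\<in>{..<n} - {k}. (ip n (A i) (ri p))\<^sup>2) \<le> 3/100 * real n * (nrm n (ri p))\<^sup>2"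
    using mem pos by blast
qed

text \<open>The multiples \<theta> \<open>x\<close> and \<eta> \<open>y\<close> differ by at most
  2a. Comparing norms, so do \<theta> and \<eta>, and dividing by a factor above \<open>T\<close>
  bounds the distance of the unit vectors.\<close>

lemma nrm_close_same_point:
  assumes x: "nrm n x = 1" "nrm n y = 1" and T: "T > 0" "T < \<theta>" "T < \<eta>"
    and d: "nrm n (\<lambda>j. \<theta> * x j - v j) \<le> a" "nrm n (\<lambda>j. \<eta> * y j - v j) \<le> a"
  shows "nrm n (\<lambda>j. y j - x j) \<le> 4 * a / T"
proof -
  define z where "z = (\<lambda>j. \<theta> * x j - \<eta> * y j)"
  have z: "nrm n z \<le> 2 * a"
    using L2_set_triangle_diff[of "\<lambda>j. \<theta> * x j - v j" "\<lambda>j. \<eta> * y j - v j" "{..<n}"] d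
    by (simp add: z_def)
  have "\<theta> - 2 * a \<le> nrm n (\<lambda>j. \<eta> * y j)" "nrm n (\<lambda>j. \<eta> * y j) \<le> \<theta> + 2 * a"
    using nrm_int_close[OF x(1), of \<theta> "\<lambda>j. \<eta> * y j" "2 * a"] z T by (simp_all add: z_def)
  then have ab: "\<bar>\<theta> - \<eta>\<bar> \<le> 2 * a" using x(2) T by (simp add: L2_set_mult_left abs_le_iff)
  have "\<theta> * nrm n (\<lambda>j. y j - x j) = nrm n (\<lambda>j. \<theta> * (y j - x j))"
    using T by (subst L2_set_mult_left) simp
  also have "\<dots> = nrm n (\<lambda>j. (\<theta> - \<eta>) * y j - z j)"
    by (rule L2_set_cong) (auto simp: z_def algebra_simps)
  also have "\<dots> \<le> \<bar>\<theta> - \<eta>\<bar> * nrm n y + nrm n z"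
    using L2_set_triangle_diff[of "\<lambda>j. (\<theta> - \<eta>) * y j" z "{..<n}"] by (simp add: L2_set_mult_left)
  also have "\<dots> \<le> 4 * a" using ab z x by simp
  finally have "\<theta> * nrm n (\<lambda>j. y j - x j) \<le> 4 * a" .
  moreover have "T * nrm n (\<lambda>j. y j - x j) \<le> \<theta> * nrm n (\<lambda>j. y j - x j)"
    using T by (intro mult_right_mono) auto
  ultimately show ?thesis using T by (simp add: field_simps)
qed

lemma exp_neg_ge: "(1 / 3) ^ k \<le> exp (- real k)"
proof -
  have "(1 / 3 :: real) \<le> exp (- 1)" using exp_le by (simp add: exp_minus field_simps)
  then have "(1 / 3 :: real) ^ k \<le> exp (- 1) ^ k" by (intro power_mono) auto
  then show ?thesis by (simp add: exp_of_nat_mult[symmetric])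
qed

text \<open>A union bound over integer points near multiples of the normal by factors between
  \<open>T\<close> and \<open>2 * T\<close>. The number of points grows like a power of
  \<open>T / sn\<close> and the small ball bound shrinks like a power of \<open>e\<close>, a
  multiple of \<open>sn / T\<close>.\<close>

lemma mprob_level:
  assumes n: "even n" "n > 0" and big: "lcd_const * sqrt (real n) \<ge> 1" and k: "k < n"
    and T: "sqrt (real n) / 100 \<le> T" "T \<le> exp (lcd_const\<^sup>2 * real n / 2)"
  shows "mprob n (\<lambda>A. op_bounded n A \<and> (\<exists>x. nrm n x = 1 \<and> (\<forall>i<n. i \<noteq> k \<longrightarrow> ip n (A i) x = 0) \<and>
      unstructured n T x \<and> \<not> unstructured n (2 * T) x)) \<le> exp (- 2 * real n)"
proof -
  define sn where "sn = sqrt (real n)"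
  \<comment> \<open>The operator norm constant 18 times the distance \<open>4 * a / T\<close>
    between two vectors that belong to the same point.\<close>
  define e where "e = 72 * lcd_const * sn / T"
  define a where "a = lcd_const * sn"
  have sn: "sn > 0" "sn * sn = real n" using n by (auto simp: sn_def)
  have lcd_const: "lcd_const > 0" "lcd_const \<le> 1" by (auto simp: lcd_const_def)
  have T0: "T > 0" using T(1) sn unfolding sn_def[symmetric] by linarith
  have e: "e > 0" using sn lcd_const T0 by (simp add: e_def)
  have a1: "a \<ge> 1" using big by (simp add: a_def sn_def)
  have aT: "a \<le> T"
  proof -
    have "a = sn / 100 * (1 / 10 ^ 9)" by (simp add: a_def lcd_const_def)
    also have "\<dots> \<le> sn / 100 * 1" using sn by (intro mult_left_mono) auto
    finally show ?thesis using T(1) by (simp add: sn_def)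
  qed
  have e2: "1 / (pi * e) \<le> T"
  proof -
    have "1 * 1 \<le> pi * (72 * a)" using a1 pi_approx by (intro mult_mono) auto
    then show ?thesis using e T0 sn lcd_const by (simp add: e_def a_def field_simps)
  qed
  have ee: "exp (- (lcd_const\<^sup>2 * real n)) \<le> e"
  proof -
    have "exp (- (lcd_const\<^sup>2 * real n)) \<le> exp (- (lcd_const\<^sup>2 * real n / 2))" by simp
    also have "\<dots> \<le> 1 / T" using T(2) T0 by (simp add: exp_minus inverse_eq_divide frac_le)
    also have "\<dots> \<le> 72 * a / T" using a1 T0 by (intro divide_right_mono) auto
    finally show ?thesis by (simp add: e_def a_def mult.assoc)
  qed
  \<comment> \<open>The point divided by \<theta> need not be unstructured itself. Each point is
    therefore represented by some unstructured unit vector close to a multiple of it, chosen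
    independently of the matrix.\<close>
  define cond where "cond p x \<longleftrightarrow> nrm n x = 1 \<and> unstructured n T x \<and>
    (\<exists>\<theta>>T. \<theta> \<le> 2 * T \<and> nrm n (\<lambda>j. \<theta> * x j - ri p j) \<le> a)" for p x
  define rep where "rep p = (SOME x. cond p x)" for p
  define S where "S = {p \<in> int_pts n (3 * T * sn). \<exists>x. cond p x}"
  have rep: "cond p (rep p)" if "p \<in> S" for p
    using that someI_ex[of "cond p"] by (simp add: S_def rep_def)
  have "real (card S) \<le> real (card (int_pts n (3 * T * sn)))"
    unfolding S_def by (intro of_nat_mono card_mono) auto
  \<comment> \<open>This \<open>l\<close> makes the first exponent exactly \<open>n\<close>; then 2
    / l = 6 T / sn and 1 \<le> 100 T / sn add up to 106 T / sn.\<close>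
  also have "\<dots> \<le> exp (sn / (3 * T) * (3 * T * sn)) * (1 + 2 / (exp (sn / (3 * T)) - 1)) ^ n"
    using sn T0 by (intro card_int_pts_le) simp
  also have "\<dots> \<le> exp (real n) * (106 * (T / sn)) ^ n"
  proof (intro mult_mono power_mono)
    have l: "sn / (3 * T) > 0" using sn T0 by simp
    have "2 / (exp l - 1) \<le> 2 / l" if "l > 0" for l :: real
    proof (rule divide_left_mono)
      have "1 + l \<le> exp l" by (rule exp_ge_add_one_self)
      then show "l \<le> exp l - 1" by (simp only: le_diff_eq add.commute)
      with that show "0 < (exp l - 1) * l" by (intro mult_pos_pos) linarith+
    qed simp
    from this[OF l] have "2 / (exp (sn / (3 * T)) - 1) \<le> 2 / (sn / (3 * T))" .
    moreover have "1 \<le> 100 * (T / sn)" using T(1) sn by (simp add: sn_def field_simps)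
    ultimately show "1 + 2 / (exp (sn / (3 * T)) - 1) \<le> 106 * (T / sn)" by simp
    show "0 \<le> 1 + 2 / (exp (sn / (3 * T)) - 1)" using l by (intro add_nonneg_nonneg divide_nonneg_nonneg) auto
  qed (use sn T0 in auto)
  finally have card: "real (card S) \<le> exp (real n) * (106 * (T / sn)) ^ n" .
  have "mprob n (\<lambda>A. op_bounded n A \<and> (\<exists>x. nrm n x = 1 \<and> (\<forall>i<n. i \<noteq> k \<longrightarrow> ip n (A i) x = 0) \<and>
      unstructured n T x \<and> \<not> unstructured n (2 * T) x))
    \<le> mprob n (\<lambda>A. \<exists>p\<in>S. (\<Sum>i\<in>{..<n} - {k}. (ip n (A i) (rep p))\<^sup>2) \<le> e\<^sup>2 * real n)"
  proof (rule mprob_mono)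
    fix A assume "op_bounded n A \<and> (\<exists>x. nrm n x = 1 \<and> (\<forall>i<n. i \<noteq> k \<longrightarrow> ip n (A i) x = 0) \<and>
      unstructured n T x \<and> \<not> unstructured n (2 * T) x)"
    then obtain x where A: "op_bounded n A" and x: "nrm n x = 1"
      and orth: "\<And>i. i < n \<Longrightarrow> i \<noteq> k \<Longrightarrow> ip n (A i) x = 0"
      and u: "unstructured n T x" "\<not> unstructured n (2 * T) x"
      by blast
    from u(2) obtain \<theta> p0 where \<theta>: "0 < \<theta>" "\<theta> \<le> 2 * T"
      and p0: "nrm n (\<lambda>j. \<theta> * x j - ri p0 j) < min (\<theta> / 200) (lcd_const * sqrt (real n))"
      unfolding unstructured_def by (auto simp: not_le)
    have \<theta>T: "\<theta> > T"
      using u(1) p0 \<theta> unfolding unstructured_def by (meson not_le)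
    define p where "p = restrict p0 {..<n}"
    have d: "nrm n (\<lambda>j. \<theta> * x j - ri p j) \<le> a" and ext: "p \<in> extensional {..<n}"
      using p0 restrict_int_point(1)[where n = n and x = "\<lambda>j. \<theta> * x j" and p = p0] by (auto simp: p_def a_def sn_def)
    have "nrm n (ri p) \<le> 3 * T"
      using nrm_int_close(2)[OF x _ d] \<theta> aT by simp
    then have "(\<Sum>j<n. \<bar>ri p j\<bar>) \<le> sn * (3 * T)"
      unfolding sn_def by (intro order_trans[OF sum_abs_le_nrm] mult_left_mono) auto
    then have "p \<in> int_pts n (3 * T * sn)" using ext by (simp add: int_pts_iff mult_ac)
    moreover have "cond p x" unfolding cond_def using x u(1) \<theta>T \<theta> d by blast
    ultimately have pS: "p \<in> S" by (auto simp: S_def)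
    obtain \<eta> where y: "nrm n (rep p) = 1" and \<eta>: "T < \<eta>" "nrm n (\<lambda>j. \<eta> * rep p j - ri p j) \<le> a"
      using rep[OF pS] unfolding cond_def by blast
    have close: "nrm n (\<lambda>j. rep p j - x j) \<le> 4 * a / T"
      by (rule nrm_close_same_point[OF x y T0 \<theta>T \<eta>(1) d \<eta>(2)])
    have "(\<Sum>i\<in>{..<n} - {k}. (ip n (A i) (rep p))\<^sup>2) \<le> 324 * real n * (nrm n (\<lambda>j. rep p j - x j))\<^sup>2"
      by (rule sum_row_ip_le[OF A orth, where c = 1]) auto
    also have "\<dots> \<le> 324 * real n * (4 * a / T)\<^sup>2"
      by (intro mult_left_mono power_mono close) auto
    also have "\<dots> = e\<^sup>2 * real n"
      by (simp add: e_def a_def power_mult_distrib power_divide)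
    finally show "\<exists>p\<in>S. (\<Sum>i\<in>{..<n} - {k}. (ip n (A i) (rep p))\<^sup>2) \<le> e\<^sup>2 * real n"
      using pS by blast
  qed
  also have "\<dots> \<le> (exp (real n) * (106 * (T / sn)) ^ n) * (exp (real n) * (6000 * e) ^ (n - 1))"
  proof (rule mprob_Bex_le[OF _ _ card])
    show "finite S" by (simp add: S_def)
    show "mprob n (\<lambda>A. (\<Sum>i\<in>{..<n} - {k}. (ip n (A i) (rep p))\<^sup>2) \<le> e\<^sup>2 * real n) \<le> exp (real n) * (6000 * e) ^ (n - 1)"
      if "p \<in> S" for p
      using rep[OF that] unfolding cond_def by (intro mprob_row_norm_unstructured[OF n k _ e e2 ee]) blast
  qed (use e in simp)
  also have "\<dots> \<le> exp (- 2 * real n)"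
  proof -
    obtain m where m: "n = Suc m" using n by (cases n) auto
    \<comment> \<open>Because row \<open>k\<close> is omitted, one factor \<open>T / sn\<close> is
      left uncancelled; it is at most exp(n), and the remaining \<open>m\<close> factors of exp(- 6)
      pay for it.\<close>
    have "(106 * (T / sn)) ^ n * (6000 * e) ^ (n - 1) = 106 * (T / sn) * ((106 * (T / sn)) * (6000 * e)) ^ m"
    proof -
      have "a ^ n * b ^ (n - 1) = a * (a * b) ^ m" for a b :: real
        by (simp add: m power_mult_distrib)
      then show ?thesis .
    qed
    also have "(106 * (T / sn)) * (6000 * e) = 106 * 6000 * 72 * lcd_const"
      using sn T0 by (simp add: e_def)
    also have "106 * (T / sn) * (106 * 6000 * 72 * lcd_const) ^ m \<le> (exp 7 * exp (real n)) * exp (- 6) ^ m"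
    proof (intro mult_mono power_mono)
      show "106 \<le> exp (7::real)" using two_power_le_exp[of 7] by simp
      have "sn \<ge> 1" using n by (simp add: sn_def)
      then have "T / sn \<le> T / 1" using T0 by (intro divide_left_mono) auto
      also have "\<dots> \<le> exp (lcd_const\<^sup>2 * real n / 2)" using T by simp
      also have "\<dots> \<le> exp (real n)"
        using lcd_const mult_right_mono[of "lcd_const\<^sup>2" 1 "real n"] by (simp add: abs_square_le_1)
      finally show "T / sn \<le> exp (real n)" .
      have "106 * 6000 * 72 * lcd_const \<le> (1 / 3) ^ 6" by (simp add: lcd_const_def power_divide)
      also have "\<dots> \<le> exp (- real 6)" by (rule exp_neg_ge)
      finally show "106 * 6000 * 72 * lcd_const \<le> exp (- 6)" by simp
    qed (use T0 sn lcd_const in auto)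
    also have "exp (- 6) ^ m = exp (- 6 * (real n - 1))"
      by (simp add: m exp_of_nat_mult[symmetric])
    finally have "(exp (real n) * exp (real n)) * ((106 * (T / sn)) ^ n * (6000 * e) ^ (n - 1))
        \<le> (exp (real n) * exp (real n)) * ((exp 7 * exp (real n)) * exp (- 6 * (real n - 1)))"
      by (intro mult_left_mono) auto
    also have "\<dots> = exp (13 - 3 * real n)"
      unfolding exp_add[symmetric] by (simp add: algebra_simps)
    also have "\<dots> \<le> exp (- 2 * real n)"
    proof -
      have "10 ^ 11 \<le> sn" using a1 by (simp add: a_def lcd_const_def)
      then have "13 * 1 \<le> sn * sn" by (intro mult_mono) auto
      then show ?thesis using sn by simp
    qed
    finally show ?thesis by (simp add: mult_ac)
  qed
  finally show ?thesis .
qed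

text \<open>Take the least dyadic level \<open>t l\<close> at which the normal is structured: it is
  level 0, or the level before it is covered by \<open>mprob_level\<close>. As 2^n exceeds
  \<open>M\<close>, fewer than \<open>n\<close> doublings occur.\<close>

lemma mprob_structured_normal:
  assumes n: "even n" "n > 0" and big: "lcd_const * sqrt (real n) \<ge> 1" and k: "k < n"
  shows "mprob n (\<lambda>A. op_bounded n A \<and> (\<exists>x. nrm n x = 1 \<and> (\<forall>i<n. i \<noteq> k \<longrightarrow> ip n (A i) x = 0) \<and>
      \<not> unstructured n (exp (lcd_const\<^sup>2 * real n / 2)) x)) \<le> exp (- real n / 100 + 1) + real n * exp (- 2 * real n)"
proof -
  define M where "M = exp (lcd_const\<^sup>2 * real n / 2)"
  define t where "t l = 2 ^ l * (sqrt (real n) / 100)" for l :: nat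
  define N where "N A x \<longleftrightarrow> nrm n x = 1 \<and> (\<forall>i<n. i \<noteq> k \<longrightarrow> ip n (A i) x = 0)" for A x
  let ?L = "{l \<in> {..<n}. t l \<le> M}"
  have s1: "sqrt (real n) / 100 \<ge> 1"
  proof -
    have "sqrt (real n) \<ge> 10 ^ 11" using big by (simp add: lcd_const_def)
    then show ?thesis by simp
  qed
  have tn: "M \<le> t n"
  proof -
    have "M \<le> exp (real n * (1 / 2))"
      using mult_right_mono[of "lcd_const\<^sup>2" 1 "real n"] by (simp add: M_def lcd_const_def power_divide)
    also have "\<dots> = exp (1 / 2) ^ n" by (rule exp_of_nat_mult)
    also have "\<dots> \<le> 2 ^ n"
    proof (rule power_mono)
      have "exp (1 / 2 :: real) ^ 2 = exp 1" by (simp add: exp_of_nat_mult[symmetric])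
      also have "\<dots> \<le> (2::real) ^ 2" using exp_le by simp
      finally show "exp (1 / 2 :: real) \<le> 2" by (rule power2_le_imp_le) simp
    qed simp
    also have "2 ^ n * 1 \<le> t n" unfolding t_def by (intro mult_left_mono s1) simp
    finally show ?thesis by simp
  qed
  have t_ge: "t l \<ge> sqrt (real n) / 100" for l
    unfolding t_def using mult_right_mono[of 1 "2 ^ l" "sqrt (real n) / 100"] by simp
  have "mprob n (\<lambda>A. op_bounded n A \<and> (\<exists>x. N A x \<and> \<not> unstructured n M x))
    \<le> mprob n (\<lambda>A. (op_bounded n A \<and> (\<exists>x. N A x \<and> \<not> unstructured n (t 0) x)) \<or>
        (\<exists>l\<in>?L. op_bounded n A \<and> (\<exists>x. N A x \<and> unstructured n (t l) x \<and> \<not> unstructured n (2 * t l) x)))"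
  proof (rule mprob_mono)
    fix A assume "op_bounded n A \<and> (\<exists>x. N A x \<and> \<not> unstructured n M x)"
    then obtain x where A: "op_bounded n A" and x: "N A x" and s: "\<not> unstructured n M x" by blast
    have "\<not> unstructured n (t n) x" using s tn unstructured_antimono by blast
    define l where "l = (LEAST l. \<not> unstructured n (t l) x)"
    have l: "\<not> unstructured n (t l) x" "l \<le> n"
      unfolding l_def using \<open>\<not> unstructured n (t n) x\<close>
      by (rule LeastI, intro Least_le)
    show "(op_bounded n A \<and> (\<exists>x. N A x \<and> \<not> unstructured n (t 0) x)) \<or>
        (\<exists>l\<in>?L. op_bounded n A \<and> (\<exists>x. N A x \<and> unstructured n (t l) x \<and> \<not> unstructured n (2 * t l) x))"
    proof (cases l)
      case 0
      then show ?thesis using A x l by auto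
    next
      case (Suc l')
      then have "unstructured n (t l') x" using not_less_Least[of l' "\<lambda>l. \<not> unstructured n (t l) x"] by (auto simp: l_def)
      moreover from this have "t l' \<le> M" using s unstructured_antimono[of n "t l'" x M] by (meson linear)
      moreover have "\<not> unstructured n (2 * t l') x" using l(1) Suc by (simp add: t_def mult.assoc)
      ultimately show ?thesis using A x l(2) Suc by auto
    qed
  qed
  also have "\<dots> \<le> mprob n (\<lambda>A. op_bounded n A \<and> (\<exists>x. N A x \<and> \<not> unstructured n (t 0) x)) +
      mprob n (\<lambda>A. \<exists>l\<in>?L. op_bounded n A \<and> (\<exists>x. N A x \<and> unstructured n (t l) x \<and> \<not> unstructured n (2 * t l) x))"
    by (rule mprob_disj)
  also have "\<dots> \<le> exp (- real n / 100 + 1) + real n * exp (- 2 * real n)"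
  proof (rule add_mono)
    show "mprob n (\<lambda>A. op_bounded n A \<and> (\<exists>x. N A x \<and> \<not> unstructured n (t 0) x)) \<le> exp (- real n / 100 + 1)"
      using mprob_low_level[OF n k] by (simp add: N_def t_def conj_assoc)
    have "card ?L \<le> card {..<n}" by (intro card_mono) auto
    then show "mprob n (\<lambda>A. \<exists>l\<in>?L. op_bounded n A \<and> (\<exists>x. N A x \<and> unstructured n (t l) x \<and> \<not> unstructured n (2 * t l) x))
        \<le> real n * exp (- 2 * real n)"
      using mprob_level[OF n big k t_ge]
      by (intro mprob_Bex_le) (auto simp: N_def M_def conj_assoc)
  qed
  finally show ?thesis by (simp add: N_def M_def conj_assoc)
qed

section \<open>Spread vectors and resampling of a row\<close>

lemma tmul_diff: "tmul n A (\<lambda>i. y i - z i) j = tmul n A y j - tmul n A z j"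
  by (simp add: tmul_def sum_subtractf left_diff_distrib)

text \<open>Otherwise \<open>y\<close> is nearly supported on the small set \<open>J\<close>, and
  rounding a multiple of its restriction gives a nonzero integer point with few nonzero entries
  whose image under the transpose is too short.\<close>

lemma card_large_coordinates:
  assumes A: "op_bounded n A" and n: "n \<ge> 200"
    and sp: "\<not> (\<exists>p\<in>int_pts n (real n / 2000). nrm n (ri p) > 0 \<and>
      (nrm n (tmul n A (ri p)))\<^sup>2 \<le> 3/100 * real n * (nrm n (ri p))\<^sup>2)"
    and y: "nrm n y = 1" "nrm n (tmul n A y) \<le> e / sqrt (real n)" and e: "e \<le> 2"
  shows "real n / (32 * 10 ^ 7) \<le> real (card {k \<in> {..<n}. 1 / 400 \<le> sqrt (real n) * \<bar>y k\<bar>})"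
proof (rule ccontr)
  define J where "J = {k \<in> {..<n}. 1 / 400 \<le> sqrt (real n) * \<bar>y k\<bar>}"
  assume "\<not> real n / (32 * 10 ^ 7) \<le> real (card {k \<in> {..<n}. 1 / 400 \<le> sqrt (real n) * \<bar>y k\<bar>})"
  then have J: "real (card J) \<le> real n / (32 * 10 ^ 7)" by (simp add: J_def)
  have fin: "finite J" "J \<subseteq> {..<n}" by (auto simp: J_def)
  \<comment> \<open>The constant 32 * 10^7 is chosen so that card J / 4 \<le> (\<theta> /
    400)^2.\<close>
  define \<theta> where "\<theta> = sqrt (real n / 8000)"
  have sn: "sqrt (real n) > 0" using n by simp
  have \<theta>: "\<theta> > 0" "\<theta>\<^sup>2 = real n / 8000" using n by (auto simp: \<theta>_def)
  define y' where "y' j = (if j \<in> J then y j else 0)" for j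
  define p where "p = round_pt n (\<lambda>j. \<theta> * y' j)"
  have d1: "nrm n (\<lambda>j. y j - y' j) \<le> 1 / 400"
  proof -
    have "nrm n (\<lambda>j. y j - y' j) \<le> sqrt (real n) * (1 / (400 * sqrt (real n)))"
      by (rule nrm_le_bound) (use sn in \<open>auto simp: y'_def J_def not_le field_simps\<close>)
    then show ?thesis using sn by simp
  qed
  have d2: "nrm n (\<lambda>j. \<theta> * y' j - ri p j) \<le> \<theta> / 400"
  proof -
    \<comment> \<open>Off \<open>J\<close> the value 0 is rounded without error, so only the
      coordinates in \<open>J\<close> contribute.\<close>
    have "(nrm n (\<lambda>j. \<theta> * y' j - ri p j))\<^sup>2 \<le> (\<Sum>j<n. if j \<in> J then 1 / 4 else 0)"
      unfolding L2_set_square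
    proof (rule sum_mono)
      fix j assume "j \<in> {..<n}"
      then have pj: "p j = round (\<theta> * y' j)" by (simp add: p_def round_pt_def)
      have "\<bar>\<theta> * y' j - ri p j\<bar> \<le> 1 / 2"
        unfolding pj using of_int_round_abs_le[of "\<theta> * y' j"] by (simp add: abs_minus_commute)
      then have "\<bar>\<theta> * y' j - ri p j\<bar>\<^sup>2 \<le> (1 / 2)\<^sup>2" by (intro power_mono) auto
      moreover have "j \<notin> J \<Longrightarrow> \<theta> * y' j - ri p j = 0" by (simp add: pj y'_def)
      ultimately show "(\<theta> * y' j - ri p j)\<^sup>2 \<le> (if j \<in> J then 1 / 4 else 0)"
        by (auto simp: power_divide)
    qed
    also have "\<dots> = real (card J) / 4"
      using fin by (simp add: sum.inter_restrict[symmetric] Int_absorb1)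
    also have "\<dots> \<le> (\<theta> / 400)\<^sup>2" using J \<theta> by (simp add: power_divide)
    finally show ?thesis by (rule power2_le_imp_le) (use \<theta> in simp)
  qed
  have "nrm n (\<lambda>j. \<theta> * y j - ri p j) \<le> nrm n (\<lambda>j. \<theta> * (y j - y' j)) + nrm n (\<lambda>j. \<theta> * y' j - ri p j)"
    using L2_set_triangle_ineq[of "\<lambda>j. \<theta> * (y j - y' j)" "\<lambda>j. \<theta> * y' j - ri p j" "{..<n}"]
    by (simp add: algebra_simps)
  also have "\<dots> \<le> \<theta> * (1 / 400) + \<theta> / 400"
    using \<theta> d1 by (intro add_mono d2) (simp add: L2_set_mult_left mult_left_mono)
  finally have d: "nrm n (\<lambda>j. \<theta> * y j - ri p j) \<le> \<theta> / 200" by simp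
  have lo: "199 / 200 * \<theta> \<le> nrm n (ri p)" and hi: "nrm n (ri p) \<le> 201 / 200 * \<theta>"
    using nrm_int_close[OF y(1) _ d] \<theta> by simp_all
  have pos: "nrm n (ri p) > 0" using lo \<theta> by linarith
  have "(\<Sum>j<n. \<bar>ri p j\<bar>) \<le> (nrm n (ri p))\<^sup>2" by (rule sum_abs_int_le_square)
  also have "\<dots> \<le> (201 / 200 * \<theta>)\<^sup>2" using hi by (intro power_mono) auto
  also have "\<dots> \<le> real n / 2000" by (simp add: power_mult_distrib power_divide \<theta>)
  finally have mem: "p \<in> int_pts n (real n / 2000)" by (simp add: int_pts_iff p_def round_pt_extensional)
  have "nrm n (tmul n A (ri p)) = nrm n (\<lambda>j. \<theta> * tmul n A y j - tmul n A (\<lambda>j. \<theta> * y j - ri p j) j)"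
    by (simp add: tmul_diff tmul_scale)
  also have "\<dots> \<le> \<theta> * nrm n (tmul n A y) + nrm n (tmul n A (\<lambda>j. \<theta> * y j - ri p j))"
    using L2_set_triangle_diff[of "\<lambda>j. \<theta> * tmul n A y j" "tmul n A (\<lambda>j. \<theta> * y j - ri p j)" "{..<n}"] \<theta>
    by (simp add: L2_set_mult_left)
  \<comment> \<open>The coefficients 1/100 and 18/200 sum to 1/10, whose square is below 3/100 *
    (199/200)^2.\<close>
  also have "\<dots> \<le> \<theta> * (sqrt (real n) / 100) + 18 * sqrt (real n) * (\<theta> / 200)"
  proof (intro add_mono mult_left_mono)
    have "e / sqrt (real n) \<le> 2 / sqrt (real n)" using e sn by (intro divide_right_mono) auto
    also have "2 / sqrt (real n) \<le> sqrt (real n) / 100"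
      using n sn by (simp add: field_simps)
    finally show "nrm n (tmul n A y) \<le> sqrt (real n) / 100" by (rule order_trans[OF y(2)])
    show "nrm n (tmul n A (\<lambda>j. \<theta> * y j - ri p j)) \<le> 18 * sqrt (real n) * (\<theta> / 200)"
      by (rule order_trans[OF op_bounded_tmul[OF A]]) (intro mult_left_mono d; simp)
  qed (use \<theta> in simp)
  also have "\<dots> = sqrt (real n) * \<theta> / 10" by simp
  finally have "(nrm n (tmul n A (ri p)))\<^sup>2 \<le> (sqrt (real n) * \<theta> / 10)\<^sup>2"
    by (intro power_mono) auto
  also have "\<dots> \<le> 3 / 100 * real n * (199 / 200 * \<theta>)\<^sup>2"
    by (simp add: power_mult_distrib power_divide)
  also have "\<dots> \<le> 3 / 100 * real n * (nrm n (ri p))\<^sup>2"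
    using lo \<theta> by (intro mult_left_mono power_mono) auto
  finally show False using sp mem pos by blast
qed

text \<open>The expected number of indices \<open>k\<close> for which the event holds is at most
  \<open>n * b\<close>. Asking for a proportion \<open>d\<close> of them avoids the factor
  \<open>n\<close> of a union bound.\<close>

lemma mprob_Markov_card:
  assumes n: "n > 0" and d: "d > 0" and b: "\<And>k. k < n \<Longrightarrow> mprob n (\<lambda>A. P A \<and> E k A) \<le> b"
  shows "mprob n (\<lambda>A. P A \<and> d * real n \<le> real (card {k \<in> {..<n}. E k A})) \<le> b / d"
proof (rule mprob_le_sum)
  let ?I = "\<lambda>k A. if P A \<and> E k A then 1 else 0 :: real"
  let ?F = "\<lambda>A. 1 / (d * real n) * (\<Sum>k<n. ?I k A)"
  show "?F A \<ge> 0" for A using d by (intro mult_nonneg_nonneg sum_nonneg) auto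
  show "?F A \<ge> 1" if "P A \<and> d * real n \<le> real (card {k \<in> {..<n}. E k A})" for A
  proof -
    have "(\<Sum>k<n. ?I k A) = real (card {k \<in> {..<n}. E k A})"
      using that by (simp add: sum.If_cases Int_def)
    then show ?thesis using that n d by (simp add: field_simps)
  qed
  have I: "(\<Sum>A\<in>mats n. ?I k A) = real (card (mats n)) * mprob n (\<lambda>A. P A \<and> E k A)" for k
    using card_mats_pos[of n] by (simp add: mprob_def sum.If_cases Int_def)
  have "(\<Sum>A\<in>mats n. ?F A) = 1 / (d * real n) * (\<Sum>k<n. \<Sum>A\<in>mats n. ?I k A)"
    unfolding sum_distrib_left[symmetric] by (subst sum.swap) simp
  also have "\<dots> = 1 / (d * real n) * (\<Sum>k<n. real (card (mats n)) * mprob n (\<lambda>A. P A \<and> E k A))"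
    by (simp only: I)
  also have "1 / (d * real n) * (\<Sum>k<n. real (card (mats n)) * mprob n (\<lambda>A. P A \<and> E k A))
      \<le> 1 / (d * real n) * (\<Sum>k<n. real (card (mats n)) * b)"
    using d by (intro mult_left_mono sum_mono b) auto
  also have "\<dots> = real (card (mats n)) * (b / d)" using n by simp
  finally show "(\<Sum>A\<in>mats n. ?F A) \<le> real (card (mats n)) * (b / d)" .
qed

section \<open>Conditioning on all rows but one\<close>

lemma sum_mats_split:
  fixes F :: "_ \<Rightarrow> real"
  assumes k: "k < n"
  shows "(\<Sum>A\<in>mats n. F A) = (\<Sum>B\<in>{..<n} - {k} \<rightarrow>\<^sub>E half_rows n. \<Sum>r\<in>half_rows n. F (B(k := r)))"
proof -
  have ins: "{..<n} = insert k ({..<n} - {k})" using k by auto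
  have "mats n = (\<lambda>(r, B). B(k := r)) ` (half_rows n \<times> ({..<n} - {k} \<rightarrow>\<^sub>E half_rows n))"
    unfolding mats_def by (subst ins, subst PiE_insert_eq) simp
  moreover have "inj_on (\<lambda>(r, B). B(k := r)) (half_rows n \<times> ({..<n} - {k} \<rightarrow>\<^sub>E half_rows n))"
    using inj_combinator[of k "{..<n} - {k}" "\<lambda>_. half_rows n"] by simp
  ultimately have "(\<Sum>A\<in>mats n. F A) = (\<Sum>(r, B)\<in>half_rows n \<times> ({..<n} - {k} \<rightarrow>\<^sub>E half_rows n). F (B(k := r)))"
    by (simp add: sum.reindex case_prod_unfold o_def)
  then show ?thesis
    by (simp add: sum.cartesian_product[symmetric] sum.swap[of _ "half_rows n"])
qed

text \<open>With the other rows fixed, \<open>X\<close> and \<open>P\<close> are constants, and only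
  the choice of row \<open>k\<close> is left to average over.\<close>

lemma mprob_resample_row:
  assumes k: "k < n" and X: "\<And>A r. X (A(k := r)) = X A" and P: "\<And>A r. P (A(k := r)) = P A"
    and b: "\<And>A. P A \<Longrightarrow> real (card {r \<in> half_rows n. E r (X A)}) \<le> real (card (half_rows n)) * b" and b0: "b \<ge> 0"
  shows "mprob n (\<lambda>A. P A \<and> E (A k) (X A)) \<le> b"
proof (rule mprob_le_sum)
  let ?F = "\<lambda>A. if P A \<and> E (A k) (X A) then 1 else 0 :: real"
  let ?M = "{..<n} - {k} \<rightarrow>\<^sub>E half_rows n"
  have "(\<Sum>A\<in>mats n. ?F A) = (\<Sum>B\<in>?M. \<Sum>r\<in>half_rows n. if P B \<and> E r (X B) then 1 else 0)"
    by (simp add: sum_mats_split[OF k] X P)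
  also have "\<dots> \<le> (\<Sum>B\<in>?M. real (card (half_rows n)) * b)"
  proof (rule sum_mono)
    fix B
    show "(\<Sum>r\<in>half_rows n. if P B \<and> E r (X B) then 1 else 0) \<le> real (card (half_rows n)) * b"
      using b[of B] b0 by (cases "P B") (simp_all add: sum.If_cases Int_def)
  qed
  also have "\<dots> = real (card (mats n)) * b"
    using k by (simp add: card_mats card_PiE power_eq_if)
  finally show "(\<Sum>A\<in>mats n. ?F A) \<le> real (card (mats n)) * b" .
qed auto

section \<open>The distance from a row to the span of the others\<close>

lemma nrm_normalize:
  assumes "j0 < n" "v j0 \<noteq> 0"
  defines "x \<equiv> \<lambda>j. (1 / nrm n v) * v j"
  shows "nrm n v > 0" "nrm n x = 1"
proof -
  have "nrm n v \<noteq> 0" using assms by (auto simp: L2_set_eq_0_iff)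
  then show "nrm n v > 0" using L2_set_nonneg[of v "{..<n}"] by linarith
  then show "nrm n x = 1" unfolding x_def by (subst L2_set_mult_left) simp
qed

lemma mult_mat_vec_index:
  fixes Q :: "real mat"
  assumes "Q \<in> carrier_mat n n" "v \<in> carrier_vec n" "i < n"
  shows "(Q *\<^sub>v v) $ i = ip n (\<lambda>j. Q $$ (i, j)) (\<lambda>j. v $ j)"
  using assms by (auto simp: scalar_prod_def atLeast0LessThan intro!: sum.cong)

lemma det_0_obtain_unit:
  fixes Q :: "real mat"
  assumes Q: "Q \<in> carrier_mat n n" and "Determinant.det Q = 0"
  obtains x where "nrm n x = 1" "\<And>i. i < n \<Longrightarrow> ip n (\<lambda>j. Q $$ (i, j)) x = 0"
proof -
  obtain v where v: "v \<in> carrier_vec n" "v \<noteq> 0\<^sub>v n" "Q *\<^sub>v v = 0\<^sub>v n"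
    using det_0_iff_vec_prod_zero[OF Q] assms(2) by blast
  then obtain j0 where j0: "j0 < n" "v $ j0 \<noteq> 0"
    by (metis carrier_vecD eq_vecI index_zero_vec(1) index_zero_vec(2))
  let ?x = "\<lambda>j. (1 / nrm n (($) v)) * v $ j"
  have "ip n (\<lambda>j. Q $$ (i, j)) ?x = 0" if "i < n" for i
  proof -
    have "ip n (\<lambda>j. Q $$ (i, j)) (\<lambda>j. v $ j) = 0"
      using mult_mat_vec_index[OF Q v(1) that] v(3) that by simp
    moreover have "ip n (\<lambda>j. Q $$ (i, j)) ?x = (1 / nrm n (($) v)) * ip n (\<lambda>j. Q $$ (i, j)) (\<lambda>j. v $ j)"
      unfolding sum_distrib_left by (simp add: mult_ac)
    ultimately show ?thesis by simp
  qed
  then show thesis using that nrm_normalize(2)[of j0 n "($) v"] j0 by blast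
qed

text \<open>Replacing row \<open>k\<close> by zero makes the matrix singular, and any unit kernel
  vector will do.\<close>

lemma exists_unit_normal:
  assumes k: "k < n"
  shows "\<exists>x. nrm n x = 1 \<and> (\<forall>i<n. i \<noteq> k \<longrightarrow> ip n (A i) x = 0)"
proof -
  let ?c = "\<lambda>i. Matrix.vec n (A i)"
  let ?Q = "mat\<^sub>r n n (\<lambda>i. if i = k then 0\<^sub>v n else ?c i)"
  have "Determinant.det ?Q = 0" by (rule det_row_0[OF k]) simp
  moreover have "?Q \<in> carrier_mat n n" by simp
  ultimately obtain x where x: "nrm n x = 1" "\<And>i. i < n \<Longrightarrow> ip n (\<lambda>j. ?Q $$ (i, j)) x = 0"
    using det_0_obtain_unit by blast
  have "ip n (A i) x = 0" if "i < n" "i \<noteq> k" for i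
  proof -
    have e: "ip n (\<lambda>j. ?Q $$ (i, j)) x = ip n (A i) x"
      using that by (intro sum.cong refl) simp
    show ?thesis using x(2)[OF that(1)] unfolding e .
  qed
  then show ?thesis using x(1) by blast
qed

text \<open>A square matrix and its transpose have the same least singular value. The independence
  is between rows, so the smallness is needed for combinations of rows.\<close>

lemma small_left_vector:
  fixes Q :: "real mat"
  assumes Q: "Q \<in> carrier_mat n n" and x: "nrm n x = 1"
    and s: "nrm n (\<lambda>i. ip n (\<lambda>j. Q $$ (i, j)) x) \<le> s"
  shows "\<exists>y. nrm n y = 1 \<and> nrm n (tmul n (\<lambda>i j. Q $$ (i, j)) y) \<le> s"
proof (cases "Determinant.det Q = 0")
  case True
  have "Determinant.det (transpose_mat Q) = 0" using det_transpose[OF Q] True by simp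
  moreover have "transpose_mat Q \<in> carrier_mat n n" using Q by simp
  ultimately obtain y where y: "nrm n y = 1" "\<And>i. i < n \<Longrightarrow> ip n (\<lambda>j. transpose_mat Q $$ (i, j)) y = 0"
    using det_0_obtain_unit by blast
  have "tmul n (\<lambda>i j. Q $$ (i, j)) y i = 0" if "i < n" for i
  proof -
    have "tmul n (\<lambda>i j. Q $$ (i, j)) y i = ip n (\<lambda>j. transpose_mat Q $$ (i, j)) y"
      unfolding tmul_def using that Q by (intro sum.cong refl) (simp add: mult.commute)
    then show ?thesis using y(2) that by simp
  qed
  then have "nrm n (tmul n (\<lambda>i j. Q $$ (i, j)) y) = 0" by (simp add: L2_set_eq_0_iff)
  moreover have "s \<ge> 0" using s L2_set_nonneg order_trans by blast
  ultimately show ?thesis using y(1) by auto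
next
  case False
  from det_non_zero_imp_unit[OF Q False, of "()"]
  obtain B where BQ: "B * Q = 1\<^sub>m n" and B: "B \<in> carrier_mat n n"
    unfolding Units_def ring_mat_def by auto
  let ?A = "\<lambda>i j. Q $$ (i, j)"
  have BA: "(\<Sum>l<n. B $$ (i, l) * Q $$ (l, j)) = (if i = j then 1 else 0)" if "i < n" "j < n" for i j
  proof -
    have "(\<Sum>l<n. B $$ (i, l) * Q $$ (l, j)) = (B * Q) $$ (i, j)"
      using that B Q by (auto simp: scalar_prod_def atLeast0LessThan intro!: sum.cong)
    then show ?thesis using that by (simp add: BQ)
  qed
  \<comment> \<open>This \<open>y\<close> is sent to \<open>x\<close> by the transpose. Then 1 is
    the inner product of \<open>y\<close> with the image of \<open>x\<close>, which forces the norm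
    of \<open>y\<close> to be at least \<open>1 / s\<close>.\<close>
  define y where "y l = (\<Sum>i<n. x i * B $$ (i, l))" for l
  define w where "w = (\<lambda>i. ip n (?A i) x)"
  have ty: "tmul n ?A y j = x j" if "j < n" for j
  proof -
    have "tmul n ?A y j = (\<Sum>l<n. \<Sum>i<n. x i * (B $$ (i, l) * Q $$ (l, j)))"
      unfolding tmul_def y_def sum_distrib_right by (simp add: mult.assoc)
    also have "\<dots> = (\<Sum>i<n. x i * (\<Sum>l<n. B $$ (i, l) * Q $$ (l, j)))"
      by (subst sum.swap) (simp add: sum_distrib_left)
    also have "\<dots> = (\<Sum>i<n. if i = j then x i else 0)"
      using that by (intro sum.cong refl) (simp add: BA)
    finally show ?thesis using that by simp
  qed
  have "1 = (nrm n x)\<^sup>2" using x by simp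
  also have "\<dots> = ip n (tmul n ?A y) x"
    unfolding L2_set_square by (intro sum.cong refl) (simp add: ty power2_eq_square)
  also have "\<dots> = ip n y w" unfolding bil_tmul[symmetric] by (simp add: bil_def w_def)
  also have "\<dots> \<le> nrm n y * nrm n w" using abs_ip_le[where n = n and x = y and y = w] by simp
  also have "\<dots> \<le> nrm n y * s" using s unfolding w_def[symmetric] by (intro mult_left_mono) auto
  finally have 1: "1 \<le> nrm n y * s" .
  have y0: "nrm n y > 0"
  proof (rule ccontr)
    assume "\<not> nrm n y > 0"
    then have "nrm n y = 0" using L2_set_nonneg[of y "{..<n}"] by linarith
    with 1 show False by simp
  qed
  let ?y = "\<lambda>l. (1 / nrm n y) * y l"
  have "nrm n ?y = 1" by (subst L2_set_mult_left) (use y0 in simp)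
  moreover have "nrm n (tmul n ?A y) = nrm n x" by (rule L2_set_cong) (simp_all add: ty)
  then have "nrm n (tmul n ?A ?y) = 1 / nrm n y"
    unfolding tmul_scale using y0 x by (subst L2_set_mult_left) simp
  moreover have "1 / nrm n y \<le> s" using 1 y0 by (simp add: field_simps)
  ultimately show ?thesis by (metis (no_types, lifting))
qed

definition normal_vec :: "nat \<Rightarrow> nat \<Rightarrow> (nat \<Rightarrow> nat \<Rightarrow> real) \<Rightarrow> nat \<Rightarrow> real" where
  "normal_vec n k A = (SOME x. nrm n x = 1 \<and> (\<forall>i<n. i \<noteq> k \<longrightarrow> ip n (A i) x = 0))"

lemma normal_vec:
  assumes "k < n"
  shows "nrm n (normal_vec n k A) = 1" "\<And>i. i < n \<Longrightarrow> i \<noteq> k \<Longrightarrow> ip n (A i) (normal_vec n k A) = 0"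
  using someI_ex[OF exists_unit_normal[OF assms, of A]] by (auto simp: normal_vec_def)

text \<open>The choice operator sees only the predicate, which does not mention row
  \<open>k\<close>; the normal is thus independent of that row.\<close>

lemma normal_vec_upd: "normal_vec n k (A(k := r)) = normal_vec n k A"
proof -
  have "(\<forall>i<n. i \<noteq> k \<longrightarrow> ip n ((A(k := r)) i) x = 0) = (\<forall>i<n. i \<noteq> k \<longrightarrow> ip n (A i) x = 0)" for x
    by auto
  then show ?thesis by (simp only: normal_vec_def)
qed

text \<open>Adding \<open>1 / M\<close> to the threshold makes the frequency condition of the small
  ball estimate hold for every \<open>t\<close>, including 0.\<close>

lemma mprob_distance_small:
  assumes n: "even n" and big: "lcd_const * sqrt (real n) \<ge> 1" and k: "k < n" and t: "t \<ge> 0"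
  shows "mprob n (\<lambda>A. op_bounded n A \<and> \<bar>ip n (A k) (normal_vec n k A)\<bar> \<le> t)
    \<le> exp (- real n / 100 + 1) + real n * exp (- 2 * real n)
      + (10200 * (t + exp (- (lcd_const\<^sup>2 * real n / 2))) + 8 * exp (- (lcd_const\<^sup>2 * real n)))"
proof -
  define M where "M = exp (lcd_const\<^sup>2 * real n / 2)"
  define t' where "t' = t + exp (- (lcd_const\<^sup>2 * real n / 2))"
  have n0: "n > 0" using k by simp
  have t': "t' > 0" "t \<le> t'" using t exp_gt_zero[of "- (lcd_const\<^sup>2 * real n / 2)"] by (auto simp: t'_def add_nonneg_pos)
  have tM: "1 / (pi * t') \<le> M"
  proof -
    have "1 / M \<le> t'" using t by (simp add: t'_def M_def exp_minus inverse_eq_divide)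
    then have "1 \<le> M * t'" by (simp add: M_def field_simps)
    moreover have "1 * (M * t') \<le> pi * (M * t')"
      using t' pi_approx by (intro mult_right_mono mult_nonneg_nonneg) (auto simp: M_def)
    ultimately show ?thesis using t' by (simp add: field_simps)
  qed
  let ?X = "normal_vec n k"
  \<comment> \<open>The norm bound involves row \<open>k\<close>, so it is kept only for a
    structured normal and dropped where row \<open>k\<close> is resampled.\<close>
  have "mprob n (\<lambda>A. op_bounded n A \<and> \<bar>ip n (A k) (?X A)\<bar> \<le> t)
    \<le> mprob n (\<lambda>A. (op_bounded n A \<and> (\<exists>x. nrm n x = 1 \<and> (\<forall>i<n. i \<noteq> k \<longrightarrow> ip n (A i) x = 0) \<and>
        \<not> unstructured n M x)) \<or> (unstructured n M (?X A) \<and> \<bar>ip n (A k) (?X A)\<bar> \<le> t'))"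
    using normal_vec[OF k] t' by (intro mprob_mono) (metis order_trans)
  also have "\<dots> \<le> (exp (- real n / 100 + 1) + real n * exp (- 2 * real n))
      + (10200 * t' + 8 * exp (- (lcd_const\<^sup>2 * real n)))"
  proof (rule order_trans[OF mprob_disj], rule add_mono)
    show "mprob n (\<lambda>A. op_bounded n A \<and> (\<exists>x. nrm n x = 1 \<and> (\<forall>i<n. i \<noteq> k \<longrightarrow> ip n (A i) x = 0) \<and>
        \<not> unstructured n M x)) \<le> exp (- real n / 100 + 1) + real n * exp (- 2 * real n)"
      unfolding M_def by (rule mprob_structured_normal[OF n n0 big k])
    show "mprob n (\<lambda>A. unstructured n M (?X A) \<and> \<bar>ip n (A k) (?X A)\<bar> \<le> t')
        \<le> 10200 * t' + 8 * exp (- (lcd_const\<^sup>2 * real n))"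
    proof (rule mprob_resample_row[where E = "\<lambda>r x. \<bar>ip n r x\<bar> \<le> t'", OF k])
      show "real (card {r \<in> half_rows n. \<bar>ip n r (?X A)\<bar> \<le> t'})
          \<le> real (card (half_rows n)) * (10200 * t' + 8 * exp (- (lcd_const\<^sup>2 * real n)))"
        if "unstructured n M (?X A)" for A
        by (rule card_half_rows_small_ip_le[OF n n0 that t'(1) tM])
    qed (use t' in \<open>simp_all add: normal_vec_upd\<close>)
  qed
  finally show ?thesis by (simp add: t'_def)
qed

definition small_left :: "nat \<Rightarrow> real \<Rightarrow> (nat \<Rightarrow> nat \<Rightarrow> real) \<Rightarrow> bool" where
  "small_left n e A \<longleftrightarrow> (\<exists>y. nrm n y = 1 \<and> nrm n (tmul n A y) \<le> e / sqrt (real n))"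

lemma mprob_small_left:
  assumes n: "even n" and big: "lcd_const * sqrt (real n) \<ge> 1" and e: "0 \<le> e" "e \<le> 2"
  shows "mprob n (small_left n e) \<le> exp (- real n) + exp (- real n / 100)
    + (exp (- real n / 100 + 1) + real n * exp (- 2 * real n)
      + (10200 * (400 * e + exp (- (lcd_const\<^sup>2 * real n / 2))) + 8 * exp (- (lcd_const\<^sup>2 * real n)))) / (1 / (32 * 10 ^ 7))"
proof -
  have sn: "sqrt (real n) \<ge> 10 ^ 11" using big by (simp add: lcd_const_def)
  have "(10 ^ 11) * (10 ^ 11) \<le> sqrt (real n) * sqrt (real n)"
    by (intro mult_mono sn) auto
  then have n200: "n \<ge> 200" and n0: "n > 0" by auto
  let ?sp = "\<lambda>A. \<exists>p\<in>int_pts n (real n / 2000). nrm n (ri p) > 0 \<and>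
      (nrm n (tmul n A (ri p)))\<^sup>2 \<le> 3/100 * real n * (nrm n (ri p))\<^sup>2"
  let ?E = "\<lambda>k A. \<bar>ip n (A k) (normal_vec n k A)\<bar> \<le> 400 * e"
  have "mprob n (small_left n e) \<le> mprob n (\<lambda>A. (\<not> op_bounded n A \<or> ?sp A) \<or>
      op_bounded n A \<and> 1 / (32 * 10 ^ 7) * real n \<le> real (card {k \<in> {..<n}. ?E k A}))"
  proof (rule mprob_mono)
    fix A assume "small_left n e A"
    then obtain y where y: "nrm n y = 1" "nrm n (tmul n A y) \<le> e / sqrt (real n)"
      unfolding small_left_def by blast
    show "(\<not> op_bounded n A \<or> ?sp A) \<or>
      op_bounded n A \<and> 1 / (32 * 10 ^ 7) * real n \<le> real (card {k \<in> {..<n}. ?E k A})"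
    proof (cases "op_bounded n A \<and> \<not> ?sp A")
      case True
      let ?J = "{k \<in> {..<n}. 1 / 400 \<le> sqrt (real n) * \<bar>y k\<bar>}"
      have "?J \<subseteq> {k \<in> {..<n}. ?E k A}"
      proof (rule subsetI)
        fix k assume k: "k \<in> ?J"
        define x where "x = normal_vec n k A"
        have kn: "k < n" using k by simp
        \<comment> \<open>The normal annihilates every row but the \<open>k\<close>-th, so pairing
          it with the short combination isolates \<open>y k\<close> times the inner product in
          question.\<close>
        have "ip n (tmul n A y) x = (\<Sum>i<n. y i * ip n (A i) x)" unfolding bil_tmul[symmetric] bil_def ..
        also have "\<dots> = (\<Sum>i<n. if i = k then y k * ip n (A k) x else 0)"
          using normal_vec(2)[OF kn, of _ A] by (intro sum.cong) (auto simp: x_def)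
        also have "\<dots> = y k * ip n (A k) x" using kn by simp
        finally have "\<bar>y k\<bar> * \<bar>ip n (A k) x\<bar> = \<bar>ip n (tmul n A y) x\<bar>" by (simp add: abs_mult)
        also have "\<dots> \<le> nrm n (tmul n A y) * nrm n x" by (rule abs_ip_le)
        also have "\<dots> \<le> e / sqrt (real n)" using y(2) normal_vec(1)[OF kn, of A] by (simp add: x_def)
        finally have "sqrt (real n) * (\<bar>y k\<bar> * \<bar>ip n (A k) x\<bar>) \<le> e"
          using n0 by (simp add: field_simps)
        moreover have "1 / 400 * \<bar>ip n (A k) x\<bar> \<le> (sqrt (real n) * \<bar>y k\<bar>) * \<bar>ip n (A k) x\<bar>"
          using k by (intro mult_right_mono) auto
        ultimately have "\<bar>ip n (A k) x\<bar> \<le> 400 * e" by (simp add: mult.assoc)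
        then show "k \<in> {k \<in> {..<n}. ?E k A}" using kn by (simp add: x_def)
      qed
      then have "card ?J \<le> card {k \<in> {..<n}. ?E k A}" by (intro card_mono) auto
      moreover have "real n / (32 * 10 ^ 7) \<le> real (card ?J)"
        using True by (intro card_large_coordinates[OF _ n200 _ y e(2)]) auto
      ultimately show ?thesis using True by simp
    qed blast
  qed
  also have "\<dots> \<le> (exp (- real n) + exp (- real n / 100)) +
    (exp (- real n / 100 + 1) + real n * exp (- 2 * real n)
      + (10200 * (400 * e + exp (- (lcd_const\<^sup>2 * real n / 2))) + 8 * exp (- (lcd_const\<^sup>2 * real n)))) / (1 / (32 * 10 ^ 7))"
  proof (rule order_trans[OF mprob_disj], rule add_mono)
    show "mprob n (\<lambda>A. \<not> op_bounded n A \<or> ?sp A) \<le> exp (- real n) + exp (- real n / 100)"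
      using mprob_not_op_bounded[OF n0] mprob_col_sparse[OF n n0]
      by (intro order_trans[OF mprob_disj] add_mono) auto
    show "mprob n (\<lambda>A. op_bounded n A \<and> 1 / (32 * 10 ^ 7) * real n \<le> real (card {k \<in> {..<n}. ?E k A}))
      \<le> (exp (- real n / 100 + 1) + real n * exp (- 2 * real n)
        + (10200 * (400 * e + exp (- (lcd_const\<^sup>2 * real n / 2))) + 8 * exp (- (lcd_const\<^sup>2 * real n)))) / (1 / (32 * 10 ^ 7))"
      using e by (intro mprob_Markov_card[OF n0] mprob_distance_small[OF n big]) auto
  qed
  finally show ?thesis by simp
qed

section \<open>The least singular value\<close>

lemma bij_betw_mats:
  "bij_betw (\<lambda>Q. \<lambda>i\<in>{..<n}. \<lambda>j\<in>{..<n}. Q $$ (i, j)) (signed_row_regular n (n div 2)) (mats n)"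
proof (rule bij_betw_byWitness[where f' = "\<lambda>A. Matrix.mat n n (\<lambda>(i, j). A i j)"])
  let ?f = "\<lambda>Q. \<lambda>i\<in>{..<n}. \<lambda>j\<in>{..<n}. Q $$ (i, j) :: real"
  let ?g = "\<lambda>A. Matrix.mat n n (\<lambda>(i, j). A i j) :: real mat"
  have ext: "A i \<in> {..<n} \<rightarrow>\<^sub>E {-1, 0, 1} \<and> (\<Sum>j<n. \<bar>A i j\<bar>) = real (n div 2)" if "A \<in> mats n" "i < n" for A i
  proof -
    have "A i \<in> half_rows n" using that unfolding mats_def by (blast dest: PiE_mem)
    then show ?thesis by (simp add: half_rows_def signed_rows_def)
  qed
  show "\<forall>Q\<in>signed_row_regular n (n div 2). ?g (?f Q) = Q"
    by (auto simp: signed_row_regular_def intro!: eq_matI)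
  show "\<forall>A\<in>mats n. ?f (?g A) = A"
  proof
    fix A assume A: "A \<in> mats n"
    show "?f (?g A) = A"
    proof (rule extensionalityI[of _ "{..<n}"])
      show "A \<in> extensional {..<n}" using A by (simp add: mats_def PiE_def)
      fix i assume i: "i \<in> {..<n}"
      show "?f (?g A) i = A i"
      proof (rule extensionalityI[of _ "{..<n}"])
        show "A i \<in> extensional {..<n}" using ext[OF A, of i] i by (simp add: PiE_def)
      qed (use i in auto)
    qed auto
  qed
  show "?f ` signed_row_regular n (n div 2) \<subseteq> mats n"
  proof (rule image_subsetI)
    fix Q assume Q: "Q \<in> signed_row_regular n (n div 2)"
    have "(\<lambda>j\<in>{..<n}. Q $$ (i, j)) \<in> half_rows n" if "i < n" for i
    proof -
      have "(\<lambda>j\<in>{..<n}. Q $$ (i, j)) \<in> {..<n} \<rightarrow>\<^sub>E {-1, 0, 1}"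
        using Q that unfolding signed_row_regular_def restrict_PiE_iff by blast
      then show ?thesis using Q that by (simp add: half_rows_def signed_rows_def signed_row_regular_def)
    qed
    then show "?f Q \<in> mats n" unfolding mats_def restrict_PiE_iff by blast
  qed
  show "?g ` mats n \<subseteq> signed_row_regular n (n div 2)"
  proof (rule image_subsetI)
    fix A assume A: "A \<in> mats n"
    have "A i j \<in> {-1, 0, 1}" if "i < n" "j < n" for i j
      using ext[OF A that(1)] that(2) by (blast dest: PiE_mem)
    then show "?g A \<in> signed_row_regular n (n div 2)"
      using ext[OF A] by (simp add: signed_row_regular_def)
  qed
qed

text \<open>The strict inequality yields a unit vector below the bound directly from the infimum,
  without showing that it is attained.\<close>

lemma prob_least_singular_value_le_pr:
  assumes n: "n > 0" and t: "t < e / sqrt (real n)"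
  shows "measure_pmf.prob (pmf_of_set (signed_row_regular n (n div 2))) {Q. least_singular_value Q \<le> t}
    \<le> mprob n (small_left n e)"
proof -
  let ?S = "signed_row_regular n (n div 2)"
  let ?f = "\<lambda>Q. \<lambda>i\<in>{..<n}. \<lambda>j\<in>{..<n}. Q $$ (i, j) :: real"
  let ?B = "{Q. least_singular_value Q \<le> t}"
  have "small_left n e (?f Q)" if Q: "Q \<in> ?S" "least_singular_value Q \<le> t" for Q
  proof -
    have Qc: "Q \<in> carrier_mat n n" using Q(1) by (simp add: signed_row_regular_def)
    have "unit_vec n 0 \<in> unit_sphere_vec n"
    proof -
      have "(\<Sum>i<n. (unit_vec n 0 $ i :: real)\<^sup>2) = (\<Sum>i<n. if i = 0 then 1 else 0)"
        by (intro sum.cong) auto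
      then show ?thesis using n by (simp add: unit_sphere_vec_def vec_norm2_def L2_set_def)
    qed
    then have ne: "(\<lambda>x. vec_norm2 (Q *\<^sub>v x)) ` unit_sphere_vec n \<noteq> {}" by blast
    have "Inf ((\<lambda>x. vec_norm2 (Q *\<^sub>v x)) ` unit_sphere_vec n) < e / sqrt (real n)"
      using Q(2) t Qc by (simp add: least_singular_value_def)
    from cInf_lessD[OF ne this] obtain v where v: "v \<in> unit_sphere_vec n" "vec_norm2 (Q *\<^sub>v v) < e / sqrt (real n)"
      by blast
    have vc: "v \<in> carrier_vec n" and nv: "nrm n (\<lambda>j. v $ j) = 1"
      using v(1) by (auto simp: unit_sphere_vec_def vec_norm2_def)
    have "nrm n (\<lambda>i. ip n (\<lambda>j. Q $$ (i, j)) (\<lambda>j. v $ j)) = vec_norm2 (Q *\<^sub>v v)"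
      unfolding vec_norm2_def using Qc
      by (intro L2_set_cong) (simp_all add: mult_mat_vec_index[OF Qc vc] del: index_mult_mat_vec)
    with v(2) have "nrm n (\<lambda>i. ip n (\<lambda>j. Q $$ (i, j)) (\<lambda>j. v $ j)) \<le> e / sqrt (real n)" by simp
    from small_left_vector[OF Qc nv this] obtain y where y: "nrm n y = 1"
      "nrm n (tmul n (\<lambda>i j. Q $$ (i, j)) y) \<le> e / sqrt (real n)" by blast
    have "nrm n (tmul n (?f Q) y) = nrm n (tmul n (\<lambda>i j. Q $$ (i, j)) y)"
      by (intro L2_set_cong refl) (simp add: tmul_def)
    then show ?thesis unfolding small_left_def using y by auto
  qed
  then have sub: "?f ` (?S \<inter> ?B) \<subseteq> {A \<in> mats n. small_left n e A}"
    using bij_betw_imp_surj_on[OF bij_betw_mats] by blast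
  have inj: "inj_on ?f (?S \<inter> ?B)"
    using bij_betw_imp_inj_on[OF bij_betw_mats] by (rule inj_on_subset) blast
  have "card (?S \<inter> ?B) = card (?f ` (?S \<inter> ?B))" by (rule card_image[OF inj, symmetric])
  also have "\<dots> \<le> card {A \<in> mats n. small_left n e A}" by (rule card_mono[OF _ sub]) simp
  finally have "real (card (?S \<inter> ?B)) / real (card ?S) \<le> mprob n (small_left n e)"
    unfolding mprob_def bij_betw_same_card[OF bij_betw_mats] by (intro divide_right_mono) simp_all
  then show ?thesis
    by (subst measure_pmf_of_set) (simp_all add: finite_signed_row_regular signed_row_regular_nonempty)
qed

theorem theorem1p1:
  shows "\<exists>C c :: real. C > 0 \<and> c > 0 \<and>
    (\<exists>N :: nat. \<forall>n \<ge> N. even n \<longrightarrow>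
      (\<forall>\<epsilon> :: real. \<epsilon> \<ge> 0 \<longrightarrow>
        measure_pmf.prob (pmf_of_set (signed_row_regular n (n div 2)))
            {Q. least_singular_value Q \<le> \<epsilon> * real n powr (- 1 / 2)}
          \<le> C * \<epsilon> + exp (- c * real n)))"
proof -
  define a where "a = lcd_const\<^sup>2"
  define C :: real where "C = 10200 * 400 * (32 * 10 ^ 7)"
  \<comment> \<open>\<open>C\<close> and \<open>K\<close> collect the coefficients of \<epsilon> and
    of \<open>q\<close> in \<open>mprob_small_left\<close>. In \<open>N\<close>, 10^22 makes
    \<open>lcd_const\<close> * \<surd>n at least 1, and 4 K / a lets half of the exponent of
    \<open>q\<close> absorb \<open>K\<close>.\<close>
  define K :: real where "K = 2 + (12 + 10200 * 401) * (32 * 10 ^ 7)"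
  define N where "N = 10 ^ 22 + nat \<lceil>4 * K / a\<rceil>"
  have a: "0 < a" "a \<le> 1 / 100" by (simp_all add: a_def lcd_const_def power_divide)
  have "measure_pmf.prob (pmf_of_set (signed_row_regular n (n div 2)))
      {Q. least_singular_value Q \<le> \<epsilon> * real n powr (- 1 / 2)} \<le> C * \<epsilon> + exp (- (a / 4) * real n)"
    if n: "N \<le> n" "even n" and \<epsilon>: "0 \<le> \<epsilon>" for n and \<epsilon> :: real
  proof (cases "\<epsilon> \<le> 1")
    case False
    \<comment> \<open>For \<epsilon> > 1 the bound exceeds 1; the other case keeps \<open>e\<close>
      below the limit 2 of \<open>mprob_small_left\<close>.\<close>
    then have "1 * 1 \<le> C * \<epsilon>" unfolding C_def by (intro mult_mono) auto
    then have "1 \<le> C * \<epsilon> + exp (- (a / 4) * real n)" by (simp add: add_increasing2)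
    then show ?thesis using measure_pmf.prob_le_1 order_trans by blast
  next
    case True
    have nN: "real n \<ge> 10 ^ 22" "real n \<ge> 4 * K / a"
    proof -
      have "10 ^ 22 \<le> n" using n(1) by (simp add: N_def)
      from of_nat_mono[OF this] show "real n \<ge> 10 ^ 22" by simp
      have "nat \<lceil>4 * K / a\<rceil> \<le> N" unfolding N_def by (rule le_add2)
      from this n(1) have "nat \<lceil>4 * K / a\<rceil> \<le> n" by (rule le_trans)
      from order_trans[OF real_nat_ceiling_ge of_nat_mono[OF this]] show "real n \<ge> 4 * K / a" .
    qed
    have n0: "n > 0" using nN(1) by (intro gr0I) simp
    have big: "lcd_const * sqrt (real n) \<ge> 1"
    proof -
      have "sqrt ((10 ^ 11)\<^sup>2) \<le> sqrt (real n)" using nN(1) by (intro real_sqrt_le_mono) simp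
      then show ?thesis by (simp add: lcd_const_def)
    qed
    \<comment> \<open>The exponentially small increment provides the strict inequality, also for
      \<epsilon> = 0.\<close>
    define e where "e = \<epsilon> + exp (- real n)"
    define q where "q = exp (- (a * real n / 2))"
    have an: "a * real n \<le> real n / 100" using mult_right_mono[OF a(2), of "real n"] by simp
    have b1: "exp (- real n) \<le> q" and b2: "exp (- real n / 100) \<le> q" and b5: "exp (- (a * real n)) \<le> q"
      using an a by (simp_all add: q_def)
    have b3: "exp (- real n / 100 + 1) \<le> 3 * q"
      unfolding exp_add mult.commute[of _ "exp 1"] by (intro mult_mono exp_le b2) auto
    have b4: "real n * exp (- 2 * real n) \<le> q"
    proof -
      have "real n \<le> exp (real n)" using exp_ge_add_one_self[of "real n"] by linarith
      then have "real n * exp (- 2 * real n) \<le> exp (real n) * exp (- 2 * real n)" by (intro mult_right_mono) auto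
      also have "\<dots> = exp (- real n)" by (simp add: exp_add[symmetric])
      finally show ?thesis using b1 by simp
    qed
    have e: "0 \<le> e" "e \<le> 2" "\<epsilon> < e" using \<epsilon> True n0 by (auto simp: e_def intro: add_mono[of \<epsilon> 1 _ 1, simplified])
    have "\<epsilon> * real n powr (- 1 / 2) = \<epsilon> / sqrt (real n)"
      using powr_minus[of "real n" "1/2"] n0 by (simp add: powr_half_sqrt inverse_eq_divide)
    also have "\<dots> < e / sqrt (real n)" using e(3) n0 by (simp add: divide_strict_right_mono)
    finally have "measure_pmf.prob (pmf_of_set (signed_row_regular n (n div 2)))
      {Q. least_singular_value Q \<le> \<epsilon> * real n powr (- 1 / 2)} \<le> mprob n (small_left n e)"
      by (rule prob_least_singular_value_le_pr[OF n0])
    also have "\<dots> \<le> exp (- real n) + exp (- real n / 100)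
      + (exp (- real n / 100 + 1) + real n * exp (- 2 * real n)
        + (10200 * (400 * e + q) + 8 * exp (- (a * real n)))) / (1 / (32 * 10 ^ 7))"
      using mprob_small_left[OF n(2) big e(1,2)] unfolding q_def a_def .
    also have "\<dots> \<le> q + q + (3 * q + q + (10200 * (400 * (\<epsilon> + q) + q) + 8 * q)) / (1 / (32 * 10 ^ 7))"
      using b1 by (intro add_mono divide_right_mono mult_left_mono b1 b2 b3 b4 b5) (simp_all add: e_def)
    also have "\<dots> = C * \<epsilon> + K * q" by (simp add: C_def K_def algebra_simps)
    also have "K * q \<le> exp (- (a / 4) * real n)"
    proof -
      have "K \<le> a * real n / 4" using nN(2) a by (simp add: field_simps)
      also have "\<dots> \<le> exp (a * real n / 4)" using exp_ge_add_one_self[of "a * real n / 4"] by linarith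
      finally have "K * q \<le> exp (a * real n / 4) * q" by (simp add: q_def)
      also have "\<dots> = exp (- (a / 4) * real n)" unfolding q_def exp_add[symmetric] by (simp add: field_simps)
      finally show ?thesis .
    qed
    finally show ?thesis by simp
  qed
  moreover have "C > 0" "a / 4 > 0" using a by (simp_all add: C_def)
  ultimately show ?thesis by blast
qed

end
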